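(* Assume regularly varying tails $\mu(y\in Y:\varphi(y)>n)=\ell(n)n^{-\beta}$ with $\beta\in(0,1]$, and hypotheses (H1) and (H2)(i) of the context. Let $v\in L^1(X)$. Then $$\lim_{n\to\infty}m(n)n^{-\beta}\sum_{j=1}^nL^jv=\beta^{-1}d_\beta\int_Xv\,d\mu,\quad\text{almost everywhere on }X.$$
   Context: Setting. $(X,\mu)$ is an infinite ($\sigma$-finite) measure space, $f:X\to X$ a conservative measure preserving map, $Y\subset X$ measurable with $\mu(Y)\in(0,\infty)$, $\bigcup_{k\ge0}f^{-k}Y=X$ up to a null set, and $\mu$ is rescaled so that $\mu(Y)=1$. Let $\varphi:Y\to\mathbb{Z}^+$, $\varphi(y)=\inf\{n\ge1:f^ny\in Y\}$ (finite a.e.), and $F=f^\varphi:Y\to Y$ the first return map. It is assumed that $\mu(y\in Y:\varphi(y)>n)=\ell(n)n^{-\beta}$ where $\beta\in(0,1]$ and $\ell:(0,\infty)\to(0,\infty)$ is slowly varying (measurable with $\lim_{x\to\infty}\ell(\lambda x)/\ell(x)=1$ for all $\lambda>0$). Let $L:L^1(X)\to L^1(X)$ and $R:L^1(Y)\to L^1(Y)$ be the transfer operators of $f$ and $F$: $\int_XLv\,w\,d\mu=\int_Xv\,w\circ f\,d\mu$ and $\int_YRv\,w\,d\mu=\int_Yv\,w\circ F\,d\mu$ for bounded measurable $w$. Set $R_nv=R(1_{\{\varphi=n\}}v)$, $n\ge1$. $\mathcal{B}\subset L^\infty(Y)$ is a (real) Banach space of functions containing the constants with norm satisfying $|v|_\infty\le\|v\|$,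 such that: (H1) there is $C>0$ such that for all $n\ge1$, $R_n:\mathcal{B}\to\mathcal{B}$ is bounded with $\|R_n\|\le C\mu(\varphi=n)$. (H2)(i) the eigenvalue $1$ is simple and isolated in the spectrum of $R:\mathcal{B}\to\mathcal{B}$. $d_\beta=\frac1\pi\sin\beta\pi$ for $\beta\in(0,1)$, $d_1=1$; $m(n)=\ell(n)$ for $\beta\in(0,1)$, and $m(n)=\sum_{j=1}^n\ell(j)j^{-1}$ for $\beta=1$.
   Formalization: The map f is additionally assumed ergodic; without this the claim fails (two disjoint copies of a Bernoulli tower with B the constants satisfy (H1) and (H2)(i)), and the claim for all v in L^1(X) forces ergodicity. *)

theory Defs
  imports "HOL-Analysis.Analysis"
begin

section \<open>Measure preserving maps and first returns\<close>

definition measure_preserving_map :: "'a measure \<Rightarrow> ('a \<Rightarrow> 'a) \<Rightarrow> bool" where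
  "measure_preserving_map M f \<longleftrightarrow> f \<in> measurable M M \<and> distr M M f = M"

definition wandering_set :: "'a measure \<Rightarrow> ('a \<Rightarrow> 'a) \<Rightarrow> 'a set \<Rightarrow> bool" where
  "wandering_set M f W \<longleftrightarrow>
     W \<in> sets M \<and> disjoint_family (\<lambda>n::nat. (f ^^ n) -` W \<inter> space M)"

definition conservative_map :: "'a measure \<Rightarrow> ('a \<Rightarrow> 'a) \<Rightarrow> bool" where
  "conservative_map M f \<longleftrightarrow> (\<forall>W. wandering_set M f W \<longrightarrow> emeasure M W = 0)"

text \<open>Ergodicity cannot be derived from the spectral hypotheses below: \<open>B\<close> need not be dense in
  \<open>L\<^sup>1(Y)\<close>. If \<open>f\<close> is the tower over a Bernoulli shift on sequences of positive integers with
  height the first entry, then two disjoint copies of it, with \<open>B\<close> the constants, satisfy all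
  of them. Conversely, convergence of the normalised sums to a multiple of the integral for all
  \<open>v\<close> forces ergodicity.\<close>

definition ergodic_map :: "'a measure \<Rightarrow> ('a \<Rightarrow> 'a) \<Rightarrow> bool" where
  "ergodic_map M f \<longleftrightarrow>
     (\<forall>A\<in>sets M. f -` A \<inter> space M = A \<longrightarrow> emeasure M A = 0 \<or> emeasure M (space M - A) = 0)"

text \<open>Points that never return to \<open>Y\<close> get return time \<open>Inf {} = 0\<close> instead of infinity.
  When \<open>f\<close> is conservative they form a null subset of \<open>Y\<close>.\<close>

definition return_time :: "('a \<Rightarrow> 'a) \<Rightarrow> 'a set \<Rightarrow> 'a \<Rightarrow> nat" where
  "return_time f Y y = Inf {n. n \<ge> 1 \<and> (f ^^ n) y \<in> Y}"

definition first_return_map :: "('a \<Rightarrow> 'a) \<Rightarrow> 'a set \<Rightarrow> 'a \<Rightarrow> 'a" where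
  "first_return_map f Y y = (f ^^ return_time f Y y) y"

text \<open>Elements of \<open>L\<^sup>1\<close> are represented by integrable functions, so the defining duality
  determines \<open>L v\<close> only almost everywhere; \<open>L\<close> is an arbitrary choice of versions.\<close>

definition transfer_operator ::
    "'a measure \<Rightarrow> ('a \<Rightarrow> 'a) \<Rightarrow> (('a \<Rightarrow> real) \<Rightarrow> 'a \<Rightarrow> real) \<Rightarrow> bool" where
  "transfer_operator M f L \<longleftrightarrow>
     (\<forall>v. integrable M v \<longrightarrow>
        integrable M (L v) \<and>
        (\<forall>w. w \<in> borel_measurable M \<and> (\<exists>K. \<forall>x\<in>space M. \<bar>w x\<bar> \<le> K) \<longrightarrow>
           (\<integral>x. L v x * w x \<partial>M) = (\<integral>x. v x * w (f x) \<partial>M)))"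

section \<open>Regular variation\<close>

definition slowly_varying :: "(real \<Rightarrow> real) \<Rightarrow> bool" where
  "slowly_varying l \<longleftrightarrow>
     l \<in> borel_measurable (restrict_space borel {0<..}) \<and>
     (\<forall>x>0. l x > 0) \<and>
     (\<forall>c>0. ((\<lambda>x. l (c * x) / l x) \<longlongrightarrow> 1) at_top)"

definition d_const :: "real \<Rightarrow> real" where
  "d_const \<beta> = (if \<beta> = 1 then 1 else sin (\<beta> * pi) / pi)"

definition m_seq :: "real \<Rightarrow> (real \<Rightarrow> real) \<Rightarrow> nat \<Rightarrow> real" where
  "m_seq \<beta> l n = (if \<beta> = 1 then (\<Sum>j=1..n. l (real j) / real j) else l (real n))"

section \<open>Banach spaces contained in \<open>L\<^sup>\<infinity>\<close>\<close>

text \<open>A Banach space \<open>B\<close> contained in \<open>L\<^sup>\<infinity>(N)\<close> with \<open>|v|\<^sub>\<infinity> \<le> \<parallel>v\<parallel>\<close> is given by a type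
  \<open>'b\<close> of class \<open>banach\<close> and a map \<open>\<iota>\<close> choosing a representative of each element. Since
  elements of \<open>L\<^sup>\<infinity>\<close> are classes modulo almost everywhere equality, linearity and injectivity
  of the inclusion are required modulo null sets.\<close>

definition Linf_subspace :: "'a measure \<Rightarrow> ('b::banach \<Rightarrow> 'a \<Rightarrow> real) \<Rightarrow> bool" where
  "Linf_subspace N \<iota> \<longleftrightarrow>
     (\<forall>b. \<iota> b \<in> borel_measurable N) \<and>
     (\<forall>b. AE y in N. \<bar>\<iota> b y\<bar> \<le> norm b) \<and>
     (\<forall>b c. AE y in N. \<iota> (b + c) y = \<iota> b y + \<iota> c y) \<and>
     (\<forall>s b. AE y in N. \<iota> (s *\<^sub>R b) y = s * \<iota> b y) \<and>
     (\<forall>b. (AE y in N. \<iota> b y = 0) \<longrightarrow> b = 0)"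

definition contains_constants :: "'a measure \<Rightarrow> ('b::banach \<Rightarrow> 'a \<Rightarrow> real) \<Rightarrow> bool" where
  "contains_constants N \<iota> \<longleftrightarrow> (\<forall>s. \<exists>b. AE y in N. \<iota> b y = s)"

text \<open>The operator \<open>A\<close> on functions maps \<open>B\<close> to \<open>B\<close>, where it is the bounded operator \<open>T\<close>.\<close>

definition restricts_to ::
    "'a measure \<Rightarrow> ('b::banach \<Rightarrow> 'a \<Rightarrow> real) \<Rightarrow> (('a \<Rightarrow> real) \<Rightarrow> 'a \<Rightarrow> real) \<Rightarrow> ('b \<Rightarrow>\<^sub>L 'b) \<Rightarrow> bool"
  where
  "restricts_to N \<iota> A T \<longleftrightarrow> (\<forall>b. AE y in N. \<iota> (blinfun_apply T b) y = A (\<iota> b) y)"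

section \<open>Spectrum and simple isolated eigenvalues\<close>

text \<open>The spectrum of an operator on a real Banach space is that of its complexification. A pair
  \<open>(u, w)\<close> stands for \<open>u + i w\<close>; the product norm is equivalent to every usual
  complexification norm.\<close>

definition cscale :: "complex \<Rightarrow> 'b::real_vector \<times> 'b \<Rightarrow> 'b \<times> 'b" where
  "cscale z p = (Re z *\<^sub>R fst p - Im z *\<^sub>R snd p, Im z *\<^sub>R fst p + Re z *\<^sub>R snd p)"

lift_definition cscalar :: "complex \<Rightarrow> ('b::banach \<times> 'b) \<Rightarrow>\<^sub>L ('b \<times> 'b)" is cscale
  unfolding cscale_def
  by (intro bounded_linear_Pair bounded_linear_sub bounded_linear_add
        bounded_linear_scaleR_right[THEN bounded_linear_compose]
        bounded_linear_fst bounded_linear_snd)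

lift_definition complexification :: "('b::banach \<Rightarrow>\<^sub>L 'b) \<Rightarrow> ('b \<times> 'b) \<Rightarrow>\<^sub>L ('b \<times> 'b)"
  is "\<lambda>T p. (T (fst p), T (snd p))"
  by (intro bounded_linear_Pair bounded_linear_compose[OF _ bounded_linear_fst]
        bounded_linear_compose[OF _ bounded_linear_snd])

definition is_inverse_op :: "('c::banach \<Rightarrow>\<^sub>L 'c) \<Rightarrow> ('c \<Rightarrow>\<^sub>L 'c) \<Rightarrow> bool" where
  "is_inverse_op A S \<longleftrightarrow> S o\<^sub>L A = id_blinfun \<and> A o\<^sub>L S = id_blinfun"

definition spectrum_op :: "('b::banach \<Rightarrow>\<^sub>L 'b) \<Rightarrow> complex set" where
  "spectrum_op T = {z. \<nexists>S. is_inverse_op (cscalar z - complexification T) S}"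

definition resolvent_op :: "('b::banach \<Rightarrow>\<^sub>L 'b) \<Rightarrow> complex \<Rightarrow> ('b \<times> 'b) \<Rightarrow>\<^sub>L ('b \<times> 'b)" where
  "resolvent_op T z = (THE S. is_inverse_op (cscalar z - complexification T) S)"

text \<open>The spectral projection \<open>(1 / 2 \<pi> i) \<integral> (z - T)\<^sup>-\<^sup>1 dz\<close> over the circle of radius \<open>r\<close>
  about \<open>z0\<close>, in the parametrisation \<open>z = z0 + r exp (2 \<pi> i t)\<close>.\<close>

definition spectral_projection ::
    "('b::banach \<Rightarrow>\<^sub>L 'b) \<Rightarrow> complex \<Rightarrow> real \<Rightarrow> ('b \<times> 'b) \<Rightarrow>\<^sub>L ('b \<times> 'b)" where
  "spectral_projection T z0 r =
     integral {0..1}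
       (\<lambda>t. cscalar (of_real r * cis (2 * pi * t)) o\<^sub>L
            resolvent_op T (z0 + of_real r * cis (2 * pi * t)))"

definition eigenvalue_op :: "('b::banach \<Rightarrow>\<^sub>L 'b) \<Rightarrow> complex \<Rightarrow> bool" where
  "eigenvalue_op T z0 \<longleftrightarrow>
     (\<exists>p. p \<noteq> 0 \<and> blinfun_apply (complexification T) p = cscale z0 p)"

text \<open>Simple means of algebraic multiplicity one: the spectral projection at the isolated point
  \<open>z0\<close> of the spectrum has a range of complex dimension one. It does not depend on \<open>r\<close>, as long
  as \<open>z0\<close> is the only point of the spectrum in the closed disc of radius \<open>r\<close>.\<close>

definition simple_isolated_eigenvalue :: "('b::banach \<Rightarrow>\<^sub>L 'b) \<Rightarrow> complex \<Rightarrow> bool" where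
  "simple_isolated_eigenvalue T z0 \<longleftrightarrow>
     eigenvalue_op T z0 \<and>
     (\<exists>r>0. spectrum_op T \<inter> cball z0 r = {z0} \<and>
        (\<exists>e. e \<noteq> 0 \<and>
           range (blinfun_apply (spectral_projection T z0 r)) = range (\<lambda>z. cscale z e)))"

section \<open>The hypotheses on the first return operator\<close>

text \<open>In both hypotheses \<open>\<phi>\<close> is the return time and \<open>R\<close> the transfer operator of the first return
  map, on \<open>N\<close>, the restriction of the measure to \<open>Y\<close>.\<close>

definition R_level ::
    "('a \<Rightarrow> nat) \<Rightarrow> (('a \<Rightarrow> real) \<Rightarrow> 'a \<Rightarrow> real) \<Rightarrow> nat \<Rightarrow> ('a \<Rightarrow> real) \<Rightarrow> 'a \<Rightarrow> real" where
  "R_level \<phi> R n v = R (\<lambda>y. indicator {y. \<phi> y = n} y * v y)"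

definition H1 ::
    "'a measure \<Rightarrow> ('a \<Rightarrow> nat) \<Rightarrow> (('a \<Rightarrow> real) \<Rightarrow> 'a \<Rightarrow> real) \<Rightarrow> ('b::banach \<Rightarrow> 'a \<Rightarrow> real) \<Rightarrow> bool"
  where
  "H1 N \<phi> R \<iota> \<longleftrightarrow>
     (\<exists>C>0. \<forall>n\<ge>1. \<exists>T. restricts_to N \<iota> (R_level \<phi> R n) T \<and>
        norm T \<le> C * measure N {y \<in> space N. \<phi> y = n})"

definition H2i ::
    "'a measure \<Rightarrow> (('a \<Rightarrow> real) \<Rightarrow> 'a \<Rightarrow> real) \<Rightarrow> ('b::banach \<Rightarrow> 'a \<Rightarrow> real) \<Rightarrow> bool" where
  "H2i N R \<iota> \<longleftrightarrow> (\<exists>T. restricts_to N \<iota> R T \<and> simple_isolated_eigenvalue T 1)"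

end

theory Submission
  imports Defs "HOL-Real_Asymp.Real_Asymp"
begin

text \<open>
  Write \<open>\<epsilon>(u) = \<integral>\<^sub>Y (1 - exp (- u \<phi>)) d\<mu>\<close>, where \<open>\<phi>\<close> is the return time, and let
  \<open>G\<^sub>u = \<Sum>\<^sub>n exp (- u n) L\<^sup>n 1\<^sub>Y\<close>. The proof finds the size of \<open>G\<^sub>u\<close> on \<open>Y\<close> as \<open>u\<close> tends to \<open>0\<close>, passes
  from these Laplace transforms to the sums \<open>S\<^sub>n = \<Sum>\<^sub>j\<^sub><\<^sub>n L\<^sup>j 1\<^sub>Y\<close>, then from \<open>Y\<close> to \<open>X\<close>, and finally from
  \<open>1\<^sub>Y\<close> to an arbitrary integrable \<open>v\<close>.

  Splitting an orbit at its first return to \<open>Y\<close> gives \<open>(I - R\<^sub>u) G\<^sub>u = 1\<close> on \<open>Y\<close>, where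
  \<open>R\<^sub>u v = R (exp (- u \<phi>) v)\<close> (\<open>renewal_identity\<close>). By (H1) the distance from \<open>R\<close> to \<open>R\<^sub>u\<close> on the
  Banach space is \<open>O(\<epsilon>(u))\<close>. By (H2)(i) the operator \<open>I - R\<close> can be inverted modulo the constants
  (\<open>reduced_resolvent\<close>), and a fixed point argument then produces an element \<open>h\<^sub>u\<close> close to \<open>1\<close> with
  \<open>(I - R\<^sub>u) h\<^sub>u = \<kappa>\<^sub>u\<close>, a constant, where \<open>\<kappa>\<^sub>u = \<epsilon>(u) (1 + o(1))\<close> (\<open>perturbed_eigenvector\<close>). Hence
  \<open>\<kappa>\<^sub>u G\<^sub>u = h\<^sub>u\<close> and \<open>\<epsilon>(u) G\<^sub>u\<close> tends to \<open>1\<close> uniformly almost everywhere on \<open>Y\<close> (\<open>resolvent_asymptotic\<close>).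
  Real \<open>u > 0\<close> suffice for this. The tail \<open>\<mu>(\<phi> > n)\<close> is monotone and regularly varying, which determines
  the size of \<open>\<epsilon>(k / N)\<close> (\<open>laplace_norming\<close>), and Karamata's Tauberian theorem, applied at almost
  every point of \<open>Y\<close>, gives \<open>b\<^sub>n S\<^sub>n \<rightarrow> 1 / \<Gamma>(1 + \<beta>)\<close> there for a norming sequence \<open>b\<close>
  (\<open>return_sums_asymptotic\<close>).

  To reach \<open>X\<close>, let \<open>B\<^sub>k\<close> be the set of points whose first visit to \<open>Y\<close> takes place at time \<open>k\<close>. The preimage
  of \<open>B\<^sub>k\<close> is \<open>B\<^sub>k\<^sub>+\<^sub>1\<close> together with a part of \<open>Y\<close>, and \<open>\<mu>(B\<^sub>k) = \<mu>(\<phi> > k)\<close> tends to \<open>0\<close>. The suprema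
  \<open>D\<^sub>n\<close> of \<open>|b\<^sub>m S\<^sub>m - c|\<close> over \<open>m \<ge> n\<close> are bounded and satisfy \<open>\<integral>\<^sub>E D\<^sub>n \<le> \<integral>\<^sub>E\<^sub>' D\<^sub>n + o(1) \<mu>(E)\<close> with \<open>E'\<close> the preimage of \<open>E\<close>,
  so the mass of \<open>D\<^sub>n\<close> on \<open>B\<^sub>k\<close> can be pushed to some \<open>B\<^sub>k\<^sub>+\<^sub>J\<close>, which is small, and to \<open>Y\<close>, where \<open>D\<^sub>n\<close> tends to \<open>0\<close>
  (\<open>convergence_extends\<close>).

  For general \<open>v\<close>, a maximal inequality of Hopf type makes the set of all \<open>v\<close> with the required limit
  closed in \<open>L\<^sup>1\<close>. It contains \<open>1\<^sub>Y\<close> and all \<open>v - n\<^sup>-\<^sup>1 \<Sum>\<^sub>k\<^sub><\<^sub>n L\<^sup>k v\<close> with \<open>v\<close> bounded, whose sums stay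
  bounded because \<open>L\<close> preserves bounds. Ergodicity enters through \<open>ergodic_cesaro_L1\<close>: if
  \<open>\<integral>v = 0\<close>, the averages \<open>n\<^sup>-\<^sup>1 \<Sum>\<^sub>k\<^sub><\<^sub>n L\<^sup>k v\<close> become arbitrarily small in \<open>L\<^sup>1\<close>. Together this is
  \<open>pointwise_dual_ergodic\<close>. The constant comes from \<open>\<Gamma>(1 - \<beta>) \<Gamma>(1 + \<beta>) = \<pi>\<beta> / sin \<pi>\<beta>\<close> when \<open>\<beta> < 1\<close>. When
  \<open>\<beta> = 1\<close> the norming is \<open>n\<^sup>-\<^sup>1 \<Sum>\<^sub>j\<^sub>\<le>\<^sub>n \<mu>(\<phi> > j)\<close>, and the term \<open>j = 0\<close>, which is missing from \<open>m(n)\<close>, is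
  negligible because the sums diverge: this is Kac's formula for an infinite measure.
\<close>

section \<open>Monotone regularly varying sequences\<close>

text \<open>Bounds with an auxiliary parameter \<open>q\<close>: first \<open>N\<close>, then
  \<open>q\<close> tends to infinity. The limit theorems below discretise at scale
  \<open>q\<close> and use this form.\<close>

lemma tendsto_iterated_sandwich:
  fixes f :: "nat \<Rightarrow> real"
  assumes up: "\<forall>\<^sub>F q in sequentially. (\<forall>\<^sub>F N in sequentially. f N \<le> U q N) \<and> U q \<longlonglongrightarrow> u q"
    and u: "u \<longlonglongrightarrow> l"
    and lo: "\<forall>\<^sub>F q in sequentially. (\<forall>\<^sub>F N in sequentially. W q N \<le> f N) \<and> W q \<longlonglongrightarrow> w q"
    and w: "w \<longlonglongrightarrow> l"
  shows "f \<longlonglongrightarrow> l"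
proof (rule order_tendstoI)
  fix a assume "a < l"
  then obtain q where q: "a < w q" "\<forall>\<^sub>F N in sequentially. W q N \<le> f N" "W q \<longlonglongrightarrow> w q"
    using eventually_happens'[OF _ eventually_conj[OF lo order_tendstoD(1)[OF w]]]
    by (auto simp: trivial_limit_sequentially)
  from q(2) order_tendstoD(1)[OF q(3,1)] show "\<forall>\<^sub>F N in sequentially. a < f N"
    by eventually_elim auto
next
  fix a assume "l < a"
  then obtain q where q: "u q < a" "\<forall>\<^sub>F N in sequentially. f N \<le> U q N" "U q \<longlonglongrightarrow> u q"
    using eventually_happens'[OF _ eventually_conj[OF up order_tendstoD(2)[OF u]]]
    by (auto simp: trivial_limit_sequentially)
  from q(2) order_tendstoD(2)[OF q(3,1)] show "\<forall>\<^sub>F N in sequentially. f N < a"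
    by eventually_elim auto
qed

lemma filterlim_div_at_top: "q > 0 \<Longrightarrow> filterlim (\<lambda>N::nat. N div q) sequentially sequentially"
  unfolding filterlim_at_top
proof
  fix Z :: nat assume "q > 0"
  show "\<forall>\<^sub>F N in sequentially. Z \<le> N div q"
    using eventually_ge_at_top[of "q * Z"]
    by eventually_elim (metis \<open>q > 0\<close> div_le_mono nonzero_mult_div_cancel_left less_numeral_extra(3))
qed

lemma cesaro_null_sequence:
  fixes r :: "nat \<Rightarrow> real"
  assumes r: "r \<longlonglongrightarrow> 0" and r0: "\<And>n. r n \<ge> 0"
  shows "(\<lambda>N. (\<Sum>n\<le>N. r n) / real N) \<longlonglongrightarrow> 0"
proof -
  have "\<exists>m. \<forall>n\<ge>m. r n \<le> 1 / real (q + 1)" for q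
  proof -
    have "\<forall>\<^sub>F n in sequentially. r n < 1 / real (q + 1)" using r by (rule order_tendstoD) simp
    thus ?thesis by (auto simp: eventually_sequentially intro: less_imp_le)
  qed
  then obtain m where m: "\<And>q n. n \<ge> m q \<Longrightarrow> r n \<le> 1 / real (q + 1)" by metis
  define U where "U q N = (\<Sum>n\<le>m q. r n) / real N + (real N + 1) / real N * (1 / real (q + 1))" for q N
  have le: "(\<Sum>n\<le>N. r n) / real N \<le> U q N" for q N
  proof -
    have "(\<Sum>n\<le>N. r n) \<le> (\<Sum>n\<in>{..m q} \<union> {m q..N}. r n)" by (intro sum_mono2 r0) auto
    also have "\<dots> \<le> (\<Sum>n\<le>m q. r n) + (\<Sum>n\<in>{m q..N}. r n)"
      using sum.union_inter[of "{..m q}" "{m q..N}" r] sum_nonneg[of "{..m q} \<inter> {m q..N}" r] r0 by simp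
    also have "(\<Sum>n\<in>{m q..N}. r n) \<le> (\<Sum>n\<in>{m q..N}. 1 / real (q + 1))" by (intro sum_mono m) auto
    also have "\<dots> \<le> (real N + 1) * (1 / real (q + 1))"
      unfolding sum_constant by (intro mult_right_mono) auto
    finally have "(\<Sum>n\<le>N. r n) / real N \<le> ((\<Sum>n\<le>m q. r n) + (real N + 1) * (1 / real (q + 1))) / real N"
      by (intro divide_right_mono) auto
    also have "\<dots> = U q N"
      by (simp only: U_def add_divide_distrib[of "sum r {..m q}"] times_divide_eq_left)
    finally show ?thesis .
  qed
  have U: "U q \<longlonglongrightarrow> 0 + 1 * (1 / real (q + 1))" for q
    unfolding U_def[abs_def] by (intro tendsto_intros tendsto_divide_0[OF tendsto_const]) real_asymp+
  show ?thesis
  proof (rule tendsto_iterated_sandwich[where U = U and u = "\<lambda>q. 0 + 1 * (1 / real (q + 1))"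
        and W = "\<lambda>_ _. 0" and w = "\<lambda>_. 0"])
    show "(\<lambda>q. 0 + 1 * (1 / real (q + 1))) \<longlonglongrightarrow> 0" by real_asymp
    show "\<forall>\<^sub>F q in sequentially. (\<forall>\<^sub>F N in sequentially. 0 \<le> (\<Sum>n\<le>N. r n) / real N) \<and> (\<lambda>_. 0) \<longlonglongrightarrow> (0::real)"
      using r0 by (auto intro!: always_eventually divide_nonneg_nonneg sum_nonneg)
    show "\<forall>\<^sub>F q in sequentially. (\<forall>\<^sub>F N in sequentially. (\<Sum>n\<le>N. r n) / real N \<le> U q N) \<and>
        U q \<longlonglongrightarrow> 0 + 1 * (1 / real (q + 1))"
      using le U by simp
  qed simp
qed

text \<open>Only multiplication by integers is assumed, since a tail of a return time gives information at
  integers alone. Monotonicity supplies the remaining scales.\<close>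

locale regularly_varying_tail =
  fixes t :: "nat \<Rightarrow> real" and \<beta> :: real
  assumes dec: "decseq t" and pos: "\<And>n. t n > 0"
    and rv: "\<And>c::nat. c \<ge> 1 \<Longrightarrow> (\<lambda>N. t (c * N) / t N) \<longlonglongrightarrow> real c powr -\<beta>"
begin

lemma antimono: "m \<le> n \<Longrightarrow> t n \<le> t m"
  using dec by (rule decseqD)

lemma ratio_multiples:
  assumes "p \<ge> 1" "q \<ge> 1"
  shows "(\<lambda>M. t (p * M) / t (q * M)) \<longlonglongrightarrow> (real p / real q) powr -\<beta>"
proof -
  have "(\<lambda>M. (t (p * M) / t M) / (t (q * M) / t M)) \<longlonglongrightarrow> (real p powr -\<beta>) / (real q powr -\<beta>)"
    using assms by (intro tendsto_divide rv) auto
  moreover have "(t (p * M) / t M) / (t (q * M) / t M) = t (p * M) / t (q * M)" for M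
    using pos[of M] by (simp add: field_simps)
  ultimately have "(\<lambda>M. t (p * M) / t (q * M)) \<longlonglongrightarrow> (real p powr -\<beta>) / (real q powr -\<beta>)"
    by (simp only:)
  thus ?thesis by (simp add: powr_divide)
qed

text \<open>Monotonicity replaces the uniform convergence theorem for slowly varying functions. With
  \<open>M = N div q\<close> and \<open>N \<ge> q\<^sup>2\<close> the number \<open>N\<close> lies
  between \<open>q M\<close> and \<open>(q + 1) M\<close>, so that both arguments can be compared
  with multiples of \<open>M\<close>.\<close>

lemma ratio_real:
  assumes x: "x > 0"
  shows "(\<lambda>N. t (nat \<lfloor>x * real N\<rfloor>) / t N) \<longlonglongrightarrow> x powr -\<beta>"
proof -
  define p p' where "p q = nat \<lfloor>x * real q\<rfloor>" and "p' q = nat \<lceil>x * real (q + 1)\<rceil>" for q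
  have p: "x * real q - 1 \<le> real (p q)" "real (p q) \<le> x * real q" for q
    using x by (auto simp: p_def)
  have p': "x * real (q + 1) \<le> real (p' q)" "real (p' q) \<le> x * real (q + 1) + 1" for q
  proof -
    have "0 \<le> x * real (q + 1)" using x by simp
    hence "real (p' q) = of_int \<lceil>x * real (q + 1)\<rceil>" unfolding p'_def by simp
    thus "x * real (q + 1) \<le> real (p' q)" "real (p' q) \<le> x * real (q + 1) + 1" by linarith+
  qed
  have "filterlim (\<lambda>q. x * real q - 1) at_top sequentially" using x by real_asymp
  hence big: "\<forall>\<^sub>F q in sequentially. x * real q - 1 \<ge> 1" unfolding filterlim_at_top by (rule spec)
  have l1: "(\<lambda>q. real (p q) / real (q + 1)) \<longlonglongrightarrow> x"
  proof (rule tendsto_sandwich)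
    show "\<forall>\<^sub>F q in sequentially. (x * real q - 1) / real (q + 1) \<le> real (p q) / real (q + 1)"
      using p by (intro always_eventually allI divide_right_mono) auto
    show "\<forall>\<^sub>F q in sequentially. real (p q) / real (q + 1) \<le> x * real q / real (q + 1)"
      using p by (intro always_eventually allI divide_right_mono) auto
    show "(\<lambda>q. (x * real q - 1) / real (q + 1)) \<longlonglongrightarrow> x" by real_asymp
    show "(\<lambda>q. x * real q / real (q + 1)) \<longlonglongrightarrow> x" by real_asymp
  qed
  have l2: "(\<lambda>q. real (p' q) / real q) \<longlonglongrightarrow> x"
  proof (rule tendsto_sandwich)
    show "\<forall>\<^sub>F q in sequentially. (x * real (q + 1)) / real q \<le> real (p' q) / real q"
      using p' by (intro always_eventually allI divide_right_mono) auto
    show "\<forall>\<^sub>F q in sequentially. real (p' q) / real q \<le> (x * real (q + 1) + 1) / real q"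
      using p' by (intro always_eventually allI divide_right_mono) auto
    show "(\<lambda>q. (x * real (q + 1)) / real q) \<longlonglongrightarrow> x" by real_asymp
    show "(\<lambda>q. (x * real (q + 1) + 1) / real q) \<longlonglongrightarrow> x" by real_asymp
  qed
  show ?thesis
  proof (rule tendsto_iterated_sandwich[where
        U = "\<lambda>q N. t (p q * (N div q)) / t ((q + 1) * (N div q))" and
        u = "\<lambda>q. (real (p q) / real (q + 1)) powr -\<beta>" and
        W = "\<lambda>q N. t (p' q * (N div q)) / t (q * (N div q))" and
        w = "\<lambda>q. (real (p' q) / real q) powr -\<beta>"])
    show "(\<lambda>q. (real (p q) / real (q + 1)) powr -\<beta>) \<longlonglongrightarrow> x powr -\<beta>"
      using x by (intro tendsto_powr l1 tendsto_const) auto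
    show "(\<lambda>q. (real (p' q) / real q) powr -\<beta>) \<longlonglongrightarrow> x powr -\<beta>"
      using x by (intro tendsto_powr l2 tendsto_const) auto
    have NM: "q * (N div q) \<le> N \<and> N \<le> (q + 1) * (N div q)" if "q \<ge> 1" "N \<ge> q * q" for N q :: nat
    proof -
      have "N div q \<ge> q" using that by (metis div_le_mono nonzero_mult_div_cancel_left not_one_le_zero)
      moreover have "N mod q < q" using that by simp
      moreover have "q * (N div q) + N mod q = N" by simp
      moreover have "(q + 1) * (N div q) = q * (N div q) + N div q" by simp
      ultimately show ?thesis by linarith
    qed
    show "\<forall>\<^sub>F q in sequentially. (\<forall>\<^sub>F N in sequentially. t (nat \<lfloor>x * real N\<rfloor>) / t N
          \<le> t (p q * (N div q)) / t ((q + 1) * (N div q))) \<and>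
         (\<lambda>N. t (p q * (N div q)) / t ((q + 1) * (N div q))) \<longlonglongrightarrow> (real (p q) / real (q + 1)) powr -\<beta>"
      using big eventually_ge_at_top[of 1]
    proof eventually_elim
      case (elim q)
      have "real (p q) \<ge> 1" using p[of q] elim by linarith
      hence p1: "p q \<ge> 1" by simp
      have "\<forall>\<^sub>F N in sequentially. t (nat \<lfloor>x * real N\<rfloor>) / t N
          \<le> t (p q * (N div q)) / t ((q + 1) * (N div q))"
        using eventually_ge_at_top[of "q * q"]
      proof eventually_elim
        case (elim N)
        note NM = NM[OF \<open>1 \<le> q\<close> elim]
        have "real (p q * (N div q)) \<le> x * real q * real (N div q)"
          using p(2)[of q] by (simp add: mult_right_mono)
        also have "\<dots> = x * real (q * (N div q))" by simp
        also have "\<dots> \<le> x * real N" using NM x by (intro mult_left_mono) (auto simp del: of_nat_mult)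
        finally have "p q * (N div q) \<le> nat \<lfloor>x * real N\<rfloor>" by (rule le_nat_floor)
        thus ?case using NM by (intro frac_le antimono less_imp_le[OF pos] pos) auto
      qed
      moreover have "(\<lambda>N. t (p q * (N div q)) / t ((q + 1) * (N div q))) \<longlonglongrightarrow> (real (p q) / real (q + 1)) powr -\<beta>"
        using filterlim_compose[OF ratio_multiples[OF p1, of "q+1"] filterlim_div_at_top[of q]] elim by simp
      ultimately show ?case by blast
    qed
    show "\<forall>\<^sub>F q in sequentially. (\<forall>\<^sub>F N in sequentially. t (p' q * (N div q)) / t (q * (N div q))
          \<le> t (nat \<lfloor>x * real N\<rfloor>) / t N) \<and>
         (\<lambda>N. t (p' q * (N div q)) / t (q * (N div q))) \<longlonglongrightarrow> (real (p' q) / real q) powr -\<beta>"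
      using eventually_ge_at_top[of 1]
    proof eventually_elim
      case (elim q)
      have "x * real (q + 1) > 0" using x by simp
      hence "real (p' q) > 0" using p'(1)[of q] by linarith
      hence p1: "p' q \<ge> 1" by simp
      have "\<forall>\<^sub>F N in sequentially. t (p' q * (N div q)) / t (q * (N div q)) \<le> t (nat \<lfloor>x * real N\<rfloor>) / t N"
        using eventually_ge_at_top[of "q * q"]
      proof eventually_elim
        case (elim N)
        note NM = NM[OF \<open>1 \<le> q\<close> elim]
        have "x * real N \<le> x * real ((q + 1) * (N div q))"
          using NM x by (intro mult_left_mono) (auto simp del: of_nat_mult)
        also have "\<dots> = x * real (q + 1) * real (N div q)" by (simp add: algebra_simps)
        also have "\<dots> \<le> real (p' q) * real (N div q)"
          using p'(1)[of q] by (intro mult_right_mono) auto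
        finally have "nat \<lfloor>x * real N\<rfloor> \<le> p' q * (N div q)"
          by (metis floor_mono floor_of_nat nat_int nat_mono of_nat_mult)
        thus ?case using NM by (intro frac_le antimono less_imp_le[OF pos] pos) auto
      qed
      moreover have "(\<lambda>N. t (p' q * (N div q)) / t (q * (N div q))) \<longlonglongrightarrow> (real (p' q) / real q) powr -\<beta>"
        using filterlim_compose[OF ratio_multiples[OF p1, of q] filterlim_div_at_top[of q]] elim by simp
      ultimately show ?case by blast
    qed
  qed
qed

text \<open>A bound of Potter type. It dominates \<open>t k / t N\<close> by a power of \<open>k / N\<close>
  with exponent slightly below \<open>- \<beta>\<close>, and it holds from the first index on
  because \<open>t\<close> is positive.\<close>

lemma potter_bound:
  assumes \<gamma>: "\<gamma> > \<beta>" "\<gamma> > 0"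
  obtains C where "C > 0" "\<And>N k. N \<ge> 1 \<Longrightarrow> k \<le> N \<Longrightarrow>
    real (k + 1) powr \<gamma> * t k \<le> C * (real N powr \<gamma> * t N)"
proof -
  define w where "w n = real n powr \<gamma> * t n" for n
  have wpos: "n \<ge> 1 \<Longrightarrow> w n > 0" for n using pos by (simp add: w_def)
  have "(\<lambda>N. 2 powr \<gamma> * (t (2 * N) / t N)) \<longlonglongrightarrow> 2 powr \<gamma> * (real 2 powr -\<beta>)"
    by (intro tendsto_intros rv) simp
  hence "(\<lambda>N. 2 powr \<gamma> * (t (2 * N) / t N)) \<longlonglongrightarrow> 2 powr (\<gamma> - \<beta>)"
    by (simp add: powr_add[symmetric])
  moreover have "2 powr (\<gamma> - \<beta>) > (1::real)" using \<gamma> by simp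
  ultimately have "\<forall>\<^sub>F N in sequentially. 2 powr \<gamma> * (t (2 * N) / t N) > 1"
    by (rule order_tendstoD(1))
  then obtain N0 where N0: "\<And>N. N \<ge> N0 \<Longrightarrow> 2 powr \<gamma> * (t (2 * N) / t N) > 1"
    by (auto simp: eventually_sequentially)
  define n0 where "n0 = max 1 N0"
  \<comment> \<open>The exponent \<open>\<gamma> > \<beta>\<close> makes \<open>w\<close> eventually
    increase under doubling; between powers of two monotonicity of \<open>t\<close>
    costs a factor \<open>2\<^sup>\<gamma>\<close>.\<close>
  have dbl: "w N \<le> w (2 * N)" if "N \<ge> n0" for N
  proof -
    have "t N \<le> 2 powr \<gamma> * t (2 * N)" using N0[of N] pos[of N] that by (simp add: n0_def field_simps)
    hence "real N powr \<gamma> * t N \<le> real N powr \<gamma> * (2 powr \<gamma> * t (2 * N))"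
      by (rule mult_left_mono) simp
    thus ?thesis by (simp add: w_def powr_mult mult_ac)
  qed
  have pw: "w k \<le> w (2 ^ i * k)" if "k \<ge> n0" for k i
  proof (induction i)
    case (Suc i)
    have "k \<le> 2 ^ i * k" by simp
    hence "n0 \<le> 2 ^ i * k" using that by linarith
    from dbl[OF this] Suc show ?case by (simp add: mult_ac)
  qed simp
  have big: "w k \<le> 2 powr \<gamma> * w N" if "k \<ge> n0" "k \<le> N" for k N
  proof -
    have k1: "k \<ge> 1" using that n0_def by simp
    hence "N div k \<ge> 1" using that by (simp add: Suc_leI div_greater_zero_iff)
    then obtain i where i: "2 ^ i \<le> N div k" "N div k < 2 ^ (i + 1)"
      using ex_power_ivl1[of 2 "N div k"] by auto
    have le: "2 ^ i * k \<le> N" using i(1) k1 by (metis div_times_less_eq_dividend le_trans mult_le_mono1)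
    have ge: "N \<le> 2 ^ (i + 1) * k" using i(2) k1
      by (metis div_less_iff_less_mult less_imp_le not_less_eq_eq zero_less_iff_neq_zero One_nat_def le_zero_eq not_one_le_zero)
    have "w k \<le> w (2 ^ (i + 1) * k)" by (rule pw) fact
    also have "\<dots> \<le> real (2 * N) powr \<gamma> * t N"
      unfolding w_def using ge le \<gamma>
      by (intro mult_mono antimono powr_mono2 less_imp_le[OF pos] ) (auto simp del: of_nat_mult)
    also have "\<dots> = 2 powr \<gamma> * w N" by (simp add: w_def powr_mult)
    finally show ?thesis .
  qed
  \<comment> \<open>A positive lower bound for \<open>w\<close>, which absorbs the finitely many
    indices below \<open>n0\<close>.\<close>
  define c where "c = min (w n0 / 2 powr \<gamma>) (t n0)"
  have n01: "n0 \<ge> 1" by (simp add: n0_def)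
  have c: "c > 0" using wpos[OF n01] pos by (simp add: c_def)
  have wc: "w N \<ge> c" if "N \<ge> 1" for N
  proof (cases "N \<ge> n0")
    case True
    have "w n0 \<le> 2 powr \<gamma> * w N" by (rule big) (use True in auto)
    hence "w n0 / 2 powr \<gamma> \<le> w N" by (simp add: field_simps)
    thus ?thesis by (simp add: c_def)
  next
    case False
    have "1 * t n0 \<le> real N powr \<gamma> * t N"
      using False that \<gamma> by (intro mult_mono antimono ge_one_powr_ge_zero less_imp_le[OF pos]) auto
    thus ?thesis by (simp add: c_def w_def)
  qed
  define C where "C = 4 powr \<gamma> + real n0 powr \<gamma> * t 0 / c"
  show ?thesis
  proof (rule that)
    show "C > 0" using c pos[of 0] by (auto simp: C_def intro!: add_pos_nonneg)
    fix N k :: nat assume N: "N \<ge> 1" and k: "k \<le> N"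
    have wN: "w N \<ge> 0" using wpos[OF N] by simp
    show "real (k + 1) powr \<gamma> * t k \<le> C * (real N powr \<gamma> * t N)"
    proof (cases "k \<ge> n0")
      case True
      have "real (k + 1) powr \<gamma> * t k \<le> real (2 * k) powr \<gamma> * t k"
        using True n01 \<gamma> by (intro mult_right_mono powr_mono2 less_imp_le[OF pos]) auto
      also have "\<dots> = 2 powr \<gamma> * w k" by (simp add: w_def powr_mult)
      also have "\<dots> \<le> 2 powr \<gamma> * (2 powr \<gamma> * w N)" by (intro mult_left_mono big True k) auto
      also have "\<dots> = 4 powr \<gamma> * w N" by (simp add: powr_mult[symmetric] mult.assoc[symmetric])
      also have "\<dots> \<le> C * w N" using wN c pos[of 0] by (intro mult_right_mono) (auto simp: C_def)
      finally show ?thesis by (simp add: w_def)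
    next
      case False
      have "real (k + 1) powr \<gamma> * t k \<le> real n0 powr \<gamma> * t 0"
        using False \<gamma> by (intro mult_mono powr_mono2 antimono less_imp_le[OF pos]) auto
      also have "\<dots> = (real n0 powr \<gamma> * t 0 / c) * c" using c by simp
      also have "\<dots> \<le> (real n0 powr \<gamma> * t 0 / c) * w N"
        using c pos[of 0] by (intro mult_left_mono wc N) auto
      also have "\<dots> \<le> C * w N" using wN by (intro mult_right_mono) (auto simp: C_def)
      finally show ?thesis by (simp add: w_def)
    qed
  qed
qed

end

section \<open>Laplace transforms of regularly varying tails\<close>

lemma has_bochner_integral_step:
  fixes g :: "nat \<Rightarrow> real"
  assumes g: "\<And>n. g n \<ge> 0" and sm: "summable g" and N: "N \<ge> (1::nat)"
  shows "has_bochner_integral lborel (\<lambda>x. indicator {0..} x * g (nat \<lfloor>x * real N\<rfloor>)) ((\<Sum>n. g n) / N)"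
proof (rule has_bochner_integral_nn_integral)
  define h where "h y = indicator {0..} y * g (nat \<lfloor>y\<rfloor>)" for y :: real
  have hm [measurable]: "h \<in> borel_measurable borel"
    unfolding h_def[abs_def] by measurable
  have "ennreal (h y) = (\<Sum>n. ennreal (g n) * indicator {real n..<real n + 1} y)" for y
  proof (cases "y \<ge> 0")
    case True
    have "(\<Sum>n. ennreal (g n) * indicator {real n..<real n + 1} y)
      = (\<Sum>n\<in>{nat \<lfloor>y\<rfloor>}. ennreal (g n) * indicator {real n..<real n + 1} y)"
    proof (rule suminf_finite)
      fix n assume "n \<notin> {nat \<lfloor>y\<rfloor>}"
      hence "\<not> (real n \<le> y \<and> y < real n + 1)"
        by (metis floor_unique nat_int of_int_of_nat_eq singletonI)
      thus "ennreal (g n) * indicator {real n..<real n + 1} y = 0" by simp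
    qed simp
    also have "\<dots> = ennreal (h y)"
    proof -
      have "real (nat \<lfloor>y\<rfloor>) \<le> y \<and> y < real (nat \<lfloor>y\<rfloor>) + 1" using True by (simp; linarith)
      thus ?thesis using True by (simp add: h_def)
    qed
    finally show ?thesis by simp
  next
    case False
    hence "indicator {real n..<real n + 1} y = (0::ennreal)" for n by (simp add: indicator_def)
    thus ?thesis using False by (simp add: h_def)
  qed
  hence "(\<integral>\<^sup>+y. ennreal (h y) \<partial>lborel) = (\<Sum>n. \<integral>\<^sup>+y. ennreal (g n) * indicator {real n..<real n + 1} y \<partial>lborel)"
    by (simp add: nn_integral_suminf)
  also have "\<dots> = (\<Sum>n. ennreal (g n))"
    by (intro suminf_cong) (simp add: nn_integral_cmult_indicator)
  also have "\<dots> = ennreal (\<Sum>n. g n)" using g sm by (intro suminf_ennreal2) auto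
  finally have h1: "(\<integral>\<^sup>+y. ennreal (h y) \<partial>lborel) = ennreal (\<Sum>n. g n)" .
  have "(\<integral>\<^sup>+y. ennreal (h y) \<partial>lborel) = ennreal (real N) * (\<integral>\<^sup>+x. ennreal (h (x * real N)) \<partial>lborel)"
    using nn_integral_real_affine[of "\<lambda>y. ennreal (h y)" "real N" 0] N by (simp add: mult.commute)
  hence h2: "ennreal (real N) * (\<integral>\<^sup>+x. ennreal (h (x * real N)) \<partial>lborel) = ennreal (\<Sum>n. g n)"
    using h1 by simp
  have heq: "h (x * real N) = indicator {0..} x * g (nat \<lfloor>x * real N\<rfloor>)" for x
    using N by (simp add: h_def indicator_def zero_le_mult_iff)
  have "ennreal (1 / real N) * (ennreal (real N) * (\<integral>\<^sup>+x. ennreal (h (x * real N)) \<partial>lborel)) = ennreal ((\<Sum>n. g n) / N)"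
    unfolding h2 using suminf_nonneg[OF sm g] by (simp add: ennreal_mult[symmetric])
  also have "ennreal (1 / real N) * (ennreal (real N) * (\<integral>\<^sup>+x. ennreal (h (x * real N)) \<partial>lborel)) = (\<integral>\<^sup>+x. ennreal (h (x * real N)) \<partial>lborel)"
    using N by (simp add: mult.assoc[symmetric] ennreal_mult[symmetric])
  finally show "(\<integral>\<^sup>+x. ennreal (indicator {0..} x * g (nat \<lfloor>x * real N\<rfloor>)) \<partial>lborel) = ennreal ((\<Sum>n. g n) / N)"
    by (simp add: heq)
  show "(\<Sum>n. g n) / N \<ge> 0" using suminf_nonneg[OF sm g] by simp
  show "AE x in lborel. 0 \<le> indicator {0..} x * g (nat \<lfloor>x * real N\<rfloor>)" using g by simp
  have "(\<lambda>x. h (x * real N)) \<in> borel_measurable borel" by measurable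
  thus "(\<lambda>x. indicator {0..} x * g (nat \<lfloor>x * real N\<rfloor>)) \<in> borel_measurable lborel" by (simp add: heq)
qed

lemma has_bochner_integral_Gamma:
  fixes s k :: real
  assumes s: "s > 0" and k: "k > 0"
  shows "has_bochner_integral lborel (\<lambda>x. indicator {0<..} x * (x powr (s - 1) * exp (- (k * x)))) (Gamma s * k powr -s)"
proof (rule has_bochner_integral_nn_integral)
  define h where "h x = indicator {0..} x * (x powr (s - 1) / exp x)" for x :: real
  have hm [measurable]: "h \<in> borel_measurable borel" unfolding h_def[abs_def] by measurable
  have "(\<integral>\<^sup>+x. ennreal (h x) \<partial>lborel) = ennreal (Gamma s)"
    unfolding h_def by (rule nn_integral_has_integral_lebesgue[OF _ Gamma_integral_real[OF s]]) auto
  moreover have "(\<integral>\<^sup>+x. ennreal (h x) \<partial>lborel) = ennreal k * (\<integral>\<^sup>+x. ennreal (h (k * x)) \<partial>lborel)"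
    using nn_integral_real_affine[of "\<lambda>y. ennreal (h y)" k 0] k by simp
  moreover have "(\<integral>\<^sup>+x. ennreal (h (k * x)) \<partial>lborel) =
     (\<integral>\<^sup>+x. ennreal (k powr (s - 1)) * ennreal (indicator {0<..} x * (x powr (s - 1) * exp (- (k * x)))) \<partial>lborel)"
  proof (rule nn_integral_cong_AE)
    have "AE x in lborel. x \<noteq> (0::real)" by (rule AE_lborel_singleton)
    thus "AE x in lborel. ennreal (h (k * x)) =
       ennreal (k powr (s - 1)) * ennreal (indicator {0<..} x * (x powr (s - 1) * exp (- (k * x))))"
    proof eventually_elim
      case (elim x)
      have "h (k * x) = k powr (s - 1) * (indicator {0<..} x * (x powr (s - 1) * exp (- (k * x))))"
        using k elim by (cases "x > 0") (auto simp: h_def powr_mult exp_minus field_simps indicator_def zero_le_mult_iff)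
      thus ?case by (simp add: ennreal_mult)
    qed
  qed
  ultimately have "ennreal (Gamma s) = ennreal k * (ennreal (k powr (s - 1)) * (\<integral>\<^sup>+x. ennreal (indicator {0<..} x * (x powr (s - 1) * exp (- (k * x)))) \<partial>lborel))"
    by (simp add: nn_integral_cmult)
  also have "\<dots> = ennreal (k powr s) * (\<integral>\<^sup>+x. ennreal (indicator {0<..} x * (x powr (s - 1) * exp (- (k * x)))) \<partial>lborel)"
    using k by (simp add: mult.assoc[symmetric] ennreal_mult[symmetric] powr_diff)
  finally have e: "ennreal (k powr -s) * ennreal (Gamma s) = ennreal (k powr -s) * (ennreal (k powr s) * (\<integral>\<^sup>+x. ennreal (indicator {0<..} x * (x powr (s - 1) * exp (- (k * x)))) \<partial>lborel))"
    by simp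
  have "ennreal (k powr -s) * ennreal (k powr s) = 1"
    using k by (simp add: ennreal_mult[symmetric] powr_add[symmetric])
  hence "ennreal (k powr -s) * (ennreal (k powr s) * X) = X" for X
    by (simp add: mult.assoc[symmetric])
  with e show "(\<integral>\<^sup>+x. ennreal (indicator {0<..} x * (x powr (s - 1) * exp (- (k * x)))) \<partial>lborel) = ennreal (Gamma s * k powr -s)"
    using Gamma_real_pos[OF s] by (simp add: ennreal_mult mult.commute)
  show "0 \<le> Gamma s * k powr -s" using Gamma_real_pos[OF s] by simp
qed auto

context regularly_varying_tail
begin

abbreviation laplace :: "real \<Rightarrow> real" where
  "laplace u \<equiv> (\<Sum>n. t n * exp (- (u * real n)))"

lemma summable_laplace:
  assumes c: "c > 0"
  shows "summable (\<lambda>n. t n * exp (- (c * real n)))"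
proof (rule summable_comparison_test')
  have "summable (\<lambda>n. t 0 * exp (-c) ^ n)" using c by (intro summable_mult summable_geometric) auto
  thus "summable (\<lambda>n. t 0 * exp (- (c * real n)))"
    by (simp add: exp_of_nat_mult[symmetric] mult.commute)
  show "norm (t n * exp (- (c * real n))) \<le> t 0 * exp (- (c * real n))" for n
    using pos[of n] antimono[of 0 n] by (simp add: abs_mult)
qed

text \<open>The transform is \<open>N t N\<close> times the integral of a step function of mesh \<open>1 /
  N\<close>, which converges to \<open>x\<^sup>-\<^sup>\<beta> exp (- k x)\<close>. Potter's bound
  makes this convergence dominated, with an exponent \<open>\<gamma> < 1\<close> that is
  integrable at \<open>0\<close>.\<close>

lemma laplace_asymptotic_lt1:
  assumes \<beta>: "0 < \<beta>" "\<beta> < 1" and k: "k > 0"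
  shows "(\<lambda>N. laplace (k / real N) / (real N * t N)) \<longlonglongrightarrow> Gamma (1 - \<beta>) * k powr (\<beta> - 1)"
proof -
  define \<gamma> where "\<gamma> = (\<beta> + 1) / 2"
  have \<gamma>: "\<gamma> > \<beta>" "\<gamma> > 0" "\<gamma> < 1" using \<beta> by (auto simp: \<gamma>_def)
  obtain C where C: "C > 0" "\<And>N j. N \<ge> 1 \<Longrightarrow> j \<le> N \<Longrightarrow>
    real (j + 1) powr \<gamma> * t j \<le> C * (real N powr \<gamma> * t N)"
    using potter_bound[OF \<gamma>(1,2)] by metis
  define F where "F N x = indicator {0..} x * (t (nat \<lfloor>x * real N\<rfloor>) * exp (- (k / real N * real (nat \<lfloor>x * real N\<rfloor>))) / t N)"
    for N :: nat and x :: real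
  define f where "f x = indicator {0<..} x * (x powr ((1 - \<beta>) - 1) * exp (- (k * x)))" for x :: real
  define w where "w x = C * exp k * (indicator {0<..} x * (x powr ((1 - \<gamma>) - 1) * exp (- (k * x))))
     + exp k * (indicator {0<..} x * (x powr (1 - 1) * exp (- (k * x))))" for x :: real
  have F: "has_bochner_integral lborel (F N) (laplace (k / real N) / (real N * t N))"
    if N: "N \<ge> 1" for N
  proof -
    have "summable (\<lambda>n. t n * exp (- (k / real N * real n)))"
      using k N by (intro summable_laplace) auto
    hence "has_bochner_integral lborel (F N) ((\<Sum>n. t n * exp (- (k / real N * real n)) / t N) / N)"
      unfolding F_def[abs_def] using less_imp_le[OF pos] N
      by (intro has_bochner_integral_step summable_divide) auto
    moreover have "(\<Sum>n. t n * exp (- (k / real N * real n)) / t N) = laplace (k / real N) / t N"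
      using \<open>summable _\<close> by (rule suminf_divide)
    ultimately show ?thesis by (simp add: mult.commute)
  qed
  have f: "has_bochner_integral lborel f (Gamma (1 - \<beta>) * k powr -(1 - \<beta>))"
    unfolding f_def[abs_def] using \<beta> k by (intro has_bochner_integral_Gamma) auto
  have w: "integrable lborel w"
    unfolding w_def[abs_def] using \<gamma> k
    by (intro Bochner_Integration.integrable_add integrable_mult_right
          integrable.intros[OF has_bochner_integral_Gamma]) auto
  have "(\<lambda>i. integral\<^sup>L lborel (F (Suc i))) \<longlonglongrightarrow> integral\<^sup>L lborel f"
  proof (rule integral_dominated_convergence[where w = w])
    show "f \<in> borel_measurable lborel" using f by (auto simp: has_bochner_integral_iff dest: borel_measurable_integrable)
    show "F (Suc i) \<in> borel_measurable lborel" for i using F[of "Suc i"] by (auto simp: has_bochner_integral_iff dest: borel_measurable_integrable)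
    show "integrable lborel w" by fact
    have ne: "AE x in lborel. x \<noteq> (0::real)" by (rule AE_lborel_singleton)
    thus "AE x in lborel. (\<lambda>i. F (Suc i) x) \<longlonglongrightarrow> f x"
    proof eventually_elim
      case (elim x)
      show ?case
      proof (cases "x > 0")
        case True
        have e: "(\<lambda>N. real (nat \<lfloor>x * real N\<rfloor>) / real N) \<longlonglongrightarrow> x"
        proof (rule tendsto_sandwich)
          have fl: "x * real N - 1 \<le> real (nat \<lfloor>x * real N\<rfloor>) \<and> real (nat \<lfloor>x * real N\<rfloor>) \<le> x * real N" for N
            using True by auto
          show "\<forall>\<^sub>F N in sequentially. (x * real N - 1) / real N \<le> real (nat \<lfloor>x * real N\<rfloor>) / real N"
            using fl by (intro always_eventually allI divide_right_mono) auto
          show "\<forall>\<^sub>F N in sequentially. real (nat \<lfloor>x * real N\<rfloor>) / real N \<le> x * real N / real N"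
            using fl by (intro always_eventually allI divide_right_mono) auto
          show "(\<lambda>N. (x * real N - 1) / real N) \<longlonglongrightarrow> x" by real_asymp
          show "(\<lambda>N. x * real N / real N) \<longlonglongrightarrow> x" by real_asymp
        qed
        have "(\<lambda>N. (t (nat \<lfloor>x * real N\<rfloor>) / t N) * exp (- (k * (real (nat \<lfloor>x * real N\<rfloor>) / real N))))
            \<longlonglongrightarrow> x powr -\<beta> * exp (- (k * x))"
          by (intro tendsto_intros e ratio_real True)
        hence "(\<lambda>N. F N x) \<longlonglongrightarrow> f x" using True by (simp add: F_def f_def)
        thus ?thesis by (rule LIMSEQ_Suc)
      next
        case False
        thus ?thesis using elim by (simp add: F_def f_def)
      qed
    qed
    fix i
    define N where "N = Suc i"
    have N: "N \<ge> 1" by (simp add: N_def)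
    from ne show "AE x in lborel. norm (F (Suc i) x) \<le> w x"
    proof eventually_elim
      case (elim x)
      show ?case
      proof (cases "x > 0")
        case True
        define j where "j = nat \<lfloor>x * real N\<rfloor>"
        have j: "x * real N \<le> real j + 1" using True unfolding j_def by linarith
        have r: "t j / t N \<le> C * x powr -\<gamma> + 1"
        proof (cases "j \<le> N")
          case jN: True
          have "(x * real N) powr \<gamma> * t j \<le> real (j + 1) powr \<gamma> * t j"
            using j True \<gamma> by (intro mult_right_mono powr_mono2 less_imp_le[OF pos]) auto
          also have "\<dots> \<le> C * (real N powr \<gamma> * t N)" by (rule C(2)[OF N jN])
          finally have "real N powr \<gamma> * (x powr \<gamma> * t j) \<le> real N powr \<gamma> * (C * t N)"
            using True by (simp add: powr_mult mult_ac)
          hence "x powr \<gamma> * t j \<le> C * t N" using N by (simp add: mult_le_cancel_left)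
          hence "t j / t N \<le> C * x powr -\<gamma>"
            using pos[of N] True by (simp add: powr_minus field_simps)
          thus ?thesis by simp
        next
          case False
          hence "t j / t N \<le> 1" using pos antimono[of N j] by (simp add: pos_divide_le_eq)
          moreover have "C * x powr -\<gamma> \<ge> 0" using C by simp
          ultimately show ?thesis by linarith
        qed
        have "k * x \<le> k * ((real j + 1) / real N)"
          using j N k by (intro mult_left_mono) (auto simp: field_simps)
        also have "\<dots> \<le> k / real N * real j + k" using N k by (simp add: field_simps)
        finally have e: "exp (- (k / real N * real j)) \<le> exp k * exp (- (k * x))"
          by (simp add: exp_add[symmetric])
        have "norm (F N x) = (t j / t N) * exp (- (k / real N * real j))"
          using True pos[of j] pos[of N] by (simp add: F_def j_def abs_mult)
        also have "\<dots> \<le> (C * x powr -\<gamma> + 1) * (exp k * exp (- (k * x)))"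
          using r e C pos[of j] pos[of N] by (intro mult_mono) (auto intro: add_nonneg_nonneg)
        also have "\<dots> = w x" using True by (simp add: w_def algebra_simps)
        finally show ?thesis by (simp add: N_def)
      next
        case False
        thus ?thesis using elim by (simp add: F_def w_def)
      qed
    qed
  qed
  hence "(\<lambda>i. laplace (k / real (Suc i)) / (real (Suc i) * t (Suc i)))
     \<longlonglongrightarrow> Gamma (1 - \<beta>) * k powr -(1 - \<beta>)"
    using F f by (simp add: has_bochner_integral_iff del: of_nat_Suc)
  from LIMSEQ_imp_Suc[OF this] show ?thesis by simp
qed

definition partial_sum :: "nat \<Rightarrow> real" where "partial_sum N = (\<Sum>n\<le>N. t n)"

lemma partial_sum_pos: "partial_sum N > 0"
  unfolding partial_sum_def by (intro sum_pos pos) auto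

lemma partial_sum_mono: "m \<le> n \<Longrightarrow> partial_sum m \<le> partial_sum n"
  unfolding partial_sum_def by (intro sum_mono2 less_imp_le[OF pos]) auto

lemma block_sum_le: "real M * (\<Sum>j=1..c. t (j * M)) \<le> (\<Sum>n\<in>{1..c * M}. t n)"
proof (induction c)
  case (Suc c)
  have "real (card {c * M + 1..Suc c * M}) * t (Suc c * M) \<le> (\<Sum>n\<in>{c * M + 1..Suc c * M}. t n)"
    by (rule sum_bounded_below) (auto intro: antimono)
  moreover have "(\<Sum>n\<in>{1..Suc c * M}. t n) = (\<Sum>n\<in>{1..c * M}. t n) + (\<Sum>n\<in>{c * M + 1..Suc c * M}. t n)"
    by (subst sum.union_disjoint[symmetric]) (auto intro!: sum.cong)
  ultimately show ?case using Suc by (simp add: algebra_simps)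
qed simp

text \<open>In the boundary case each of the \<open>c\<close> blocks of length \<open>N div c\<close> up to
  \<open>N\<close> contributes about \<open>N t N / j\<close>, for \<open>j = 1, \<dots>,
  c\<close>. Thus the limit superior of the quotient is at most the reciprocal of the harmonic
  number of \<open>c\<close>.\<close>

lemma index1_term_negligible:
  assumes \<beta>: "\<beta> = 1"
  shows "(\<lambda>N. real N * t N / partial_sum N) \<longlonglongrightarrow> 0"
proof -
  let ?U = "\<lambda>c M. (real c * (real M + 1) / real M) * (1 / (\<Sum>j=1..c. t (j * M) / t (c * M)))"
  let ?u = "\<lambda>c. real c * (1 / (\<Sum>j=1..c. (real j / real c) powr -\<beta>))"
  show ?thesis
  proof (rule tendsto_iterated_sandwich[where
      U = "\<lambda>c N. ?U c (N div c)"
      and u = "\<lambda>c. ?u c" and W = "\<lambda>_ _. 0" and w = "\<lambda>_. 0"])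
    show "\<forall>\<^sub>F q in sequentially. (\<forall>\<^sub>F N in sequentially. 0 \<le> real N * t N / partial_sum N) \<and> (\<lambda>_. 0) \<longlonglongrightarrow> (0::real)"
      using less_imp_le[OF pos] less_imp_le[OF partial_sum_pos] by simp
    show "(\<lambda>_. 0) \<longlonglongrightarrow> (0::real)" by simp
    have "?u c = 1 / harm c" if "c \<ge> 1" for c
    proof -
      have "(\<Sum>j=1..c. (real j / real c) powr -\<beta>) = (\<Sum>j=1..c. real c * inverse (real j))"
        using that by (intro sum.cong) (auto simp: \<beta> powr_minus field_simps)
      also have "\<dots> = real c * harm c" by (simp add: harm_def sum_distrib_left)
      finally show ?thesis using that by simp
    qed
    hence "\<forall>\<^sub>F c in sequentially. 1 / harm c = ?u c"
      by (intro eventually_mono[OF eventually_ge_at_top[of 1]]) simp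
    moreover have "(\<lambda>c. 1 / harm c) \<longlonglongrightarrow> (0::real)"
      using tendsto_inverse_0_at_top[OF harm_at_top] by (simp add: inverse_eq_divide)
    ultimately show "(\<lambda>c. ?u c) \<longlonglongrightarrow> 0"
      by (rule Lim_transform_eventually[rotated])
    show "\<forall>\<^sub>F c in sequentially. (\<forall>\<^sub>F N in sequentially. real N * t N / partial_sum N
        \<le> ?U c (N div c))
      \<and> (\<lambda>N. ?U c (N div c))
        \<longlonglongrightarrow> ?u c"
      using eventually_ge_at_top[of 1]
    proof (eventually_elim, intro conjI)
      case (elim c)
      show "\<forall>\<^sub>F N in sequentially. real N * t N / partial_sum N
        \<le> ?U c (N div c)"
        using eventually_ge_at_top[of c]
      proof eventually_elim
        case (elim N)
        define M where "M = N div c"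
        have M: "M \<ge> 1" using elim \<open>1 \<le> c\<close> unfolding M_def by (simp add: Suc_leI div_greater_zero_iff)
        have cM: "c * M \<le> N" "N \<le> c * (M + 1)"
          using \<open>1 \<le> c\<close> unfolding M_def
          by (simp_all add: dividend_less_times_div less_imp_le)
        define S where "S = (\<Sum>j=1..c. t (j * M))"
        have S: "S > 0" unfolding S_def using \<open>1 \<le> c\<close> by (intro sum_pos pos) auto
        have "real M * S \<le> (\<Sum>n\<in>{1..c * M}. t n)" unfolding S_def by (rule block_sum_le)
        also have "\<dots> \<le> partial_sum N"
          unfolding partial_sum_def using cM by (intro sum_mono2 less_imp_le[OF pos]) auto
        finally have 1: "real M * S \<le> partial_sum N" .
        have "real N \<le> real (c * (M + 1))" using cM(2) by (rule of_nat_mono)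
        hence 2: "real N * t N \<le> real c * (real M + 1) * t (c * M)"
          using cM by (intro mult_mono antimono less_imp_le[OF pos]) (auto simp: algebra_simps)
        have "real N * t N / partial_sum N \<le> (real c * (real M + 1) * t (c * M)) / (real M * S)"
          using 1 2 M S pos[of "c * M"] less_imp_le[OF pos] by (intro frac_le) auto
        also have "\<dots> = (real c * (real M + 1) / real M) * (1 / (S / t (c * M)))" by simp
        also have "S / t (c * M) = (\<Sum>j=1..c. t (j * M) / t (c * M))"
          by (simp add: S_def sum_divide_distrib)
        finally show ?case by (simp add: M_def)
      qed
      have "(\<lambda>M. ?U c M)
        \<longlonglongrightarrow> ?u c"
      proof (intro tendsto_mult tendsto_divide tendsto_const tendsto_sum ratio_multiples)
        show "(\<lambda>M. real c * (real M + 1) / real M) \<longlonglongrightarrow> real c" by real_asymp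
        have "(\<Sum>j=1..c. (real j / real c) powr -\<beta>) > 0" using elim by (intro sum_pos) auto
        thus "(\<Sum>j=1..c. (real j / real c) powr -\<beta>) \<noteq> 0" by simp
      qed (use elim in auto)
      from filterlim_compose[OF this filterlim_div_at_top[of c]] elim
      show "(\<lambda>N. ?U c (N div c))
        \<longlonglongrightarrow> ?u c" by simp
    qed
  qed
qed

text \<open>Beyond \<open>N\<close> the transform is at most a multiple of \<open>N t N\<close>, which is
  negligible. Up to \<open>N\<close>, replacing \<open>exp (- k n / N)\<close> by \<open>1\<close>
  costs \<open>k / N\<close> times the sum of \<open>n t n\<close>, which is negligible as a
  Cesaro mean of the null sequence in the previous lemma.\<close>

lemma laplace_asymptotic_1:
  assumes \<beta>: "\<beta> = 1" and k: "k > 0"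
  shows "(\<lambda>N. laplace (k / real N) / partial_sum N) \<longlonglongrightarrow> 1"
proof -
  define r where "r N = real N * t N / partial_sum N" for N
  have r: "r \<longlonglongrightarrow> 0" unfolding r_def[abs_def] by (rule index1_term_negligible) fact
  have r0: "r n \<ge> 0" for n using less_imp_le[OF pos] less_imp_le[OF partial_sum_pos] by (simp add: r_def)
  have ces: "(\<lambda>N. (\<Sum>n\<le>N. r n) / real N) \<longlonglongrightarrow> 0" by (rule cesaro_null_sequence[OF r r0])
  have bounds: "1 - k * ((\<Sum>n\<le>N. r n) / real N) \<le> laplace (k / real N) / partial_sum N"
    "laplace (k / real N) / partial_sum N \<le> 1 + r N * (1 / (real N * (1 - exp (- (k / real N)))))"
    if N: "N \<ge> 1" for N
  proof -
    define e where "e n = exp (- (k / real N * real n))" for n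
    have sm: "summable (\<lambda>n. t n * e n)" unfolding e_def using N k by (intro summable_laplace) auto
    have e1: "e n \<le> 1" "e n > 0" for n using k by (auto simp: e_def)
    have "(\<Sum>n\<le>N. t n * (1 - k / real N * real n)) \<le> (\<Sum>n\<le>N. t n * e n)"
      using exp_ge_add_one_self[of "- (k / real N * real n)" for n] less_imp_le[OF pos]
      by (intro sum_mono mult_left_mono) (auto simp: e_def)
    also have "\<dots> \<le> (\<Sum>n. t n * e n)"
      using e1 less_imp_le[OF pos] by (intro sum_le_suminf sm) (auto intro!: mult_nonneg_nonneg simp: less_imp_le)
    also have "(\<Sum>n\<le>N. t n * (1 - k / real N * real n)) = partial_sum N - k / real N * (\<Sum>n\<le>N. real n * t n)"
      by (simp add: partial_sum_def algebra_simps sum_subtractf sum_distrib_left sum_divide_distrib)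
    finally have 1: "partial_sum N - k / real N * (\<Sum>n\<le>N. real n * t n) \<le> (\<Sum>n. t n * e n)" .
    have "(\<Sum>n\<le>N. real n * t n) = (\<Sum>n\<le>N. r n * partial_sum n)"
      using partial_sum_pos by (intro sum.cong) (auto simp: r_def less_imp_neq[symmetric])
    also have "\<dots> \<le> (\<Sum>n\<le>N. r n * partial_sum N)" by (intro sum_mono mult_left_mono partial_sum_mono r0) auto
    also have "\<dots> = (\<Sum>n\<le>N. r n) * partial_sum N" by (simp add: sum_distrib_right)
    finally have "k / real N * (\<Sum>n\<le>N. real n * t n) \<le> k / real N * ((\<Sum>n\<le>N. r n) * partial_sum N)"
      using k by (intro mult_left_mono) auto
    with 1 have "(1 - k * ((\<Sum>n\<le>N. r n) / real N)) * partial_sum N \<le> (\<Sum>n. t n * e n)"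
      by (simp add: algebra_simps)
    thus "1 - k * ((\<Sum>n\<le>N. r n) / real N) \<le> laplace (k / real N) / partial_sum N"
      using partial_sum_pos[of N] by (simp add: pos_le_divide_eq e_def)
    have eg: "e n = exp (- (k / real N)) ^ n" for n by (simp add: e_def exp_of_nat_mult[symmetric] mult.commute)
    have lt1: "exp (- (k / real N)) < 1" using k N by simp
    have sg: "summable e" unfolding eg using lt1 by (intro summable_geometric) auto
    have "(\<Sum>n. t n * e n) \<le> (\<Sum>n. (if n \<le> N then t n else 0) + t N * e n)"
    proof (rule suminf_le[OF _ sm])
      show "t n * e n \<le> (if n \<le> N then t n else 0) + t N * e n" for n
      proof (cases "n \<le> N")
        case True
        have "t n * e n \<le> t n * 1" using e1 less_imp_le[OF pos] by (intro mult_left_mono) auto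
        moreover have "t N * e n \<ge> 0" using pos[of N] e1(2)[of n] by simp
        ultimately show ?thesis using True by simp
      next
        case False
        thus ?thesis using e1(2)[of n] antimono[of N n] by (auto intro!: mult_right_mono)
      qed
      show "summable (\<lambda>n. (if n \<le> N then t n else 0) + t N * e n)"
        by (intro summable_add summable_mult sg summable_finite[of "{..N}"]) auto
    qed
    also have "\<dots> = (\<Sum>n. (if n \<le> N then t n else 0)) + t N * (\<Sum>n. e n)"
      by (subst suminf_add[symmetric]) (auto intro!: summable_mult sg summable_finite[of "{..N}"] simp: suminf_mult[OF sg])
    also have "(\<Sum>n. (if n \<le> N then t n else 0)) = partial_sum N"
      unfolding partial_sum_def by (subst suminf_finite[of "{..N}"]) auto
    also have "(\<Sum>n. e n) = 1 / (1 - exp (- (k / real N)))"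
      unfolding eg using lt1 by (intro suminf_geometric) auto
    finally have "(\<Sum>n. t n * e n) / partial_sum N \<le> (partial_sum N + t N * (1 / (1 - exp (- (k / real N))))) / partial_sum N"
      using partial_sum_pos[of N] by (intro divide_right_mono) auto
    also have "\<dots> = 1 + r N * (1 / (real N * (1 - exp (- (k / real N)))))"
      using partial_sum_pos[of N] N lt1 by (simp add: r_def field_simps)
    finally show "laplace (k / real N) / partial_sum N \<le> 1 + r N * (1 / (real N * (1 - exp (- (k / real N)))))"
      by (simp add: e_def)
  qed
  show ?thesis
  proof (rule tendsto_sandwich)
    show "\<forall>\<^sub>F N in sequentially. 1 - k * ((\<Sum>n\<le>N. r n) / real N) \<le> laplace (k / real N) / partial_sum N"
      using eventually_ge_at_top[of 1] by eventually_elim (rule bounds)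
    show "\<forall>\<^sub>F N in sequentially. laplace (k / real N) / partial_sum N \<le> 1 + r N * (1 / (real N * (1 - exp (- (k / real N)))))"
      using eventually_ge_at_top[of 1] by eventually_elim (rule bounds)
    have "(\<lambda>N. 1 - k * ((\<Sum>n\<le>N. r n) / real N)) \<longlonglongrightarrow> 1 - k * 0" by (intro tendsto_intros ces)
    thus "(\<lambda>N. 1 - k * ((\<Sum>n\<le>N. r n) / real N)) \<longlonglongrightarrow> 1" by simp
    have "(\<lambda>N. 1 / (real N * (1 - exp (- (k / real N))))) \<longlonglongrightarrow> inverse k" using k by real_asymp
    hence "(\<lambda>N. 1 + r N * (1 / (real N * (1 - exp (- (k / real N)))))) \<longlonglongrightarrow> 1 + 0 * inverse k"
      by (intro tendsto_intros r)
    thus "(\<lambda>N. 1 + r N * (1 / (real N * (1 - exp (- (k / real N)))))) \<longlonglongrightarrow> 1" by simp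
  qed
qed

text \<open>Up to a factor tending to \<open>1\<close>, this is \<open>u\<close> times the Laplace transform
  of \<open>t\<close> at \<open>u = 1 / N\<close>.\<close>

definition norming :: "nat \<Rightarrow> real" where
  "norming N = (if \<beta> = 1 then partial_sum N / real N else Gamma (1 - \<beta>) * t N)"

text \<open>The form in which regular variation enters the Tauberian theorem: along \<open>u = k / N\<close>
  the quantity \<open>(1 - exp (- u)) \<Sum>\<^sub>n t n exp (- u n)\<close> is regularly varying
  of index \<open>\<beta>\<close>, for \<open>\<beta> < 1\<close> and \<open>\<beta> = 1\<close>
  alike.\<close>

lemma laplace_norming:
  assumes \<beta>: "0 < \<beta>" "\<beta> \<le> 1" and k: "k > 0"
  shows "(\<lambda>N. (1 - exp (- (k / real N))) * laplace (k / real N) / norming N) \<longlonglongrightarrow> k powr \<beta>"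
proof -
  have e: "(\<lambda>N. real N * (1 - exp (- (k / real N)))) \<longlonglongrightarrow> k" using k by real_asymp
  show ?thesis
  proof (cases "\<beta> = 1")
    case True
    have "(\<lambda>N. (real N * (1 - exp (- (k / real N)))) * (laplace (k / real N) / partial_sum N)) \<longlonglongrightarrow> k * 1"
      by (intro tendsto_mult e laplace_asymptotic_1 True k)
    moreover have "(real N * (1 - exp (- (k / real N)))) * (laplace (k / real N) / partial_sum N)
       = (1 - exp (- (k / real N))) * laplace (k / real N) / norming N" for N
      unfolding norming_def using True by simp
    moreover have "k * 1 = k powr \<beta>" using True k by simp
    ultimately show ?thesis by (simp only:)
  next
    case False
    hence b: "\<beta> < 1" using \<beta> by simp
    have G: "Gamma (1 - \<beta>) > 0" using b by (intro Gamma_real_pos) simp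
    have l: "(\<lambda>N. (real N * (1 - exp (- (k / real N)))) * (laplace (k / real N) / (real N * t N)) / Gamma (1 - \<beta>))
       \<longlonglongrightarrow> k * (Gamma (1 - \<beta>) * k powr (\<beta> - 1)) / Gamma (1 - \<beta>)"
      using G by (intro tendsto_mult tendsto_divide tendsto_const e laplace_asymptotic_lt1 b \<beta> k) auto
    have c: "k * (Gamma (1 - \<beta>) * k powr (\<beta> - 1)) / Gamma (1 - \<beta>) = k powr \<beta>"
      using G k by (simp add: powr_diff)
    have "\<forall>\<^sub>F N in sequentially. (real N * (1 - exp (- (k / real N)))) * (laplace (k / real N) / (real N * t N)) / Gamma (1 - \<beta>)
       = (1 - exp (- (k / real N))) * laplace (k / real N) / norming N"
      using eventually_gt_at_top[of 0] by eventually_elim (use False in \<open>simp add: norming_def\<close>)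
    from Lim_transform_eventually[OF l this] show ?thesis by (simp only: c)
  qed
qed

lemma norming_1: "\<beta> = 1 \<Longrightarrow> norming N = partial_sum N / real N"
  unfolding norming_def by simp

lemma norming_less_1: "\<beta> \<noteq> 1 \<Longrightarrow> norming N = Gamma (1 - \<beta>) * t N"
  unfolding norming_def by simp

lemma norming_nonneg:
  assumes "\<beta> \<le> 1" shows "norming N \<ge> 0"
proof (cases "\<beta> = 1")
  case True
  show ?thesis unfolding norming_1[OF True] using less_imp_le[OF partial_sum_pos] by simp
next
  case False
  show ?thesis unfolding norming_less_1[OF False]
    using False assms by (intro mult_nonneg_nonneg less_imp_le[OF pos] less_imp_le[OF Gamma_real_pos]) simp
qed

lemma norming_pos:
  assumes "0 < \<beta>" "\<beta> \<le> 1" "N \<ge> 1"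
  shows "norming N > 0"
  using assms pos[of N] partial_sum_pos[of N] Gamma_real_pos[of "1 - \<beta>"] by (auto simp: norming_def)

end

section \<open>Karamata's Tauberian theorem\<close>

text \<open>Both the discrete sums and the limiting Gamma integral are treated as functionals on the
  continuous functions on \<open>[0, 1]\<close>, in the variable \<open>s = exp (- x)\<close>. The
  functionals are defined on all functions, hence the restriction to continuous arguments.\<close>

definition positive_functional :: "((real \<Rightarrow> real) \<Rightarrow> real) \<Rightarrow> bool" where
  "positive_functional J \<longleftrightarrow>
     (\<forall>f g. continuous_on {0..1} f \<longrightarrow> continuous_on {0..1} g \<longrightarrow> J (\<lambda>s. f s + g s) = J f + J g) \<and>
     (\<forall>c f. continuous_on {0..1} f \<longrightarrow> J (\<lambda>s. c * f s) = c * J f) \<and>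
     (\<forall>f g. continuous_on {0..1} f \<longrightarrow> continuous_on {0..1} g \<longrightarrow> (\<forall>s\<in>{0..1}. f s \<le> g s) \<longrightarrow> J f \<le> J g)"

lemma positive_functional_polynomial:
  assumes "positive_functional J"
  shows "J (\<lambda>s. \<Sum>i\<le>n. a i * s ^ i) = (\<Sum>i\<le>(n::nat). a i * J (\<lambda>s. s ^ i))"
proof (induction n)
  case 0
  have "J (\<lambda>s. a 0 * s ^ 0) = a 0 * J (\<lambda>s. s ^ 0)"
    using assms unfolding positive_functional_def
    by (elim conjE) (drule spec, drule spec, erule mp, (intro continuous_intros)+)
  thus ?case by simp
next
  case (Suc n)
  have "J (\<lambda>s. (\<Sum>i\<le>n. a i * s ^ i) + a (Suc n) * s ^ Suc n)
     = J (\<lambda>s. \<Sum>i\<le>n. a i * s ^ i) + J (\<lambda>s. a (Suc n) * s ^ Suc n)"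
    using assms unfolding positive_functional_def
    by (elim conjE) (drule spec, drule spec, erule mp[THEN mp], (intro continuous_intros)+)
  also have "J (\<lambda>s. a (Suc n) * s ^ Suc n) = a (Suc n) * J (\<lambda>s. s ^ Suc n)"
    using assms unfolding positive_functional_def
    by (elim conjE) (drule spec, drule spec, erule mp, (intro continuous_intros)+)
  finally show ?case using Suc by simp
qed

text \<open>The Weierstrass approximation theorem: positivity turns uniform approximation by polynomials
  into convergence of the functionals.\<close>

lemma positive_functional_moments:
  assumes J: "\<And>N. positive_functional (J N)" and J0: "positive_functional J0"
    and mom: "\<And>k. (\<lambda>N::nat. J N (\<lambda>s. s ^ k)) \<longlonglongrightarrow> J0 (\<lambda>s. s ^ k)"
    and g: "continuous_on {0..1} g"
  shows "(\<lambda>N. J N g) \<longlonglongrightarrow> J0 g"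
proof -
  have "\<exists>a n. \<forall>s\<in>{0..1}. \<bar>g s - (\<Sum>i\<le>n. a i * s ^ i)\<bar> < 1 / real (q + 1)" for q :: nat
  proof -
    obtain p where "real_polynomial_function p" "\<And>s. s \<in> {0..1} \<Longrightarrow> \<bar>g s - p s\<bar> < 1 / real (q + 1)"
      using Stone_Weierstrass_real_polynomial_function[of "{0..1}" g "1 / real (q + 1)"] g by auto
    moreover from this(1) obtain a n where "p = (\<lambda>s. \<Sum>i\<le>n. a i * s ^ i)"
      unfolding real_polynomial_function_iff_sum by blast
    ultimately show ?thesis by blast
  qed
  then obtain a n where an: "\<And>q s. s \<in> {0..1} \<Longrightarrow> \<bar>g s - (\<Sum>i\<le>n q. a q i * s ^ i)\<bar> < 1 / real (q + 1)"
    by metis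
  define p where "p q s = (\<Sum>i\<le>n q. a q i * s ^ i)" for q :: nat and s :: real
  have pc: "continuous_on {0..1} (p q)" for q unfolding p_def[abs_def] by (intro continuous_intros)
  have pl: "(\<lambda>N. J N (p q)) \<longlonglongrightarrow> J0 (p q)" for q
    unfolding p_def[abs_def] positive_functional_polynomial[OF J] positive_functional_polynomial[OF J0]
    by (intro tendsto_intros mom)
  have one: "(\<lambda>N. J N (\<lambda>_. 1)) \<longlonglongrightarrow> J0 (\<lambda>_. 1)" using mom[of 0] by simp
  have bd: "K (p q) - 1 / real (q + 1) * K (\<lambda>_. 1) \<le> K g \<and> K g \<le> K (p q) + 1 / real (q + 1) * K (\<lambda>_. 1)"
    if K: "positive_functional K" for K q
  proof -
    have addK: "K (\<lambda>s. f s + h s) = K f + K h" if "continuous_on {0..1} f" "continuous_on {0..1} h" for f h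
      using K that unfolding positive_functional_def by blast
    have scK: "K (\<lambda>s. c * f s) = c * K f" if "continuous_on {0..1} f" for c f
      using K that unfolding positive_functional_def by blast
    have moK: "K f \<le> K h" if "continuous_on {0..1} f" "continuous_on {0..1} h" "\<And>s. s \<in> {0..1} \<Longrightarrow> f s \<le> h s" for f h
      using K that unfolding positive_functional_def by blast
    have eq: "K (\<lambda>s. p q s + c * 1) = K (p q) + c * K (\<lambda>_. 1)" for c
      using scK[of "\<lambda>_. 1" c] by (subst addK[OF pc]) (auto intro!: continuous_intros)
    have cc: "continuous_on {0..1} (\<lambda>s. p q s + c * 1)" for c by (intro continuous_intros pc)
    have pg: "\<bar>g s - p q s\<bar> < 1 / real (q + 1)" if "s \<in> {0..1}" for s
      using an[OF that] unfolding p_def .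
    have "K (\<lambda>s. p q s + (- (1 / real (q + 1))) * 1) \<le> K g"
    proof (rule moK[OF cc g])
      fix s :: real assume "s \<in> {0..1}"
      from pg[OF this] show "p q s + (- (1 / real (q + 1))) * 1 \<le> g s" by linarith
    qed
    moreover have "K g \<le> K (\<lambda>s. p q s + (1 / real (q + 1)) * 1)"
    proof (rule moK[OF g cc])
      fix s :: real assume "s \<in> {0..1}"
      from pg[OF this] show "g s \<le> p q s + (1 / real (q + 1)) * 1" by linarith
    qed
    ultimately show ?thesis unfolding eq by simp
  qed
  have inv: "(\<lambda>q. 1 / real (q + 1) * J0 (\<lambda>_. 1)) \<longlonglongrightarrow> 0"
  proof -
    have "(\<lambda>q. 1 / real (q + 1) * J0 (\<lambda>_. 1)) \<longlonglongrightarrow> 0 * J0 (\<lambda>_. 1)"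
      by (intro tendsto_mult tendsto_const) real_asymp
    thus ?thesis by simp
  qed
  have plim: "(\<lambda>q. J0 (p q)) \<longlonglongrightarrow> J0 g"
  proof (rule tendsto_sandwich)
    show "\<forall>\<^sub>F q in sequentially. J0 g - 1 / real (q + 1) * J0 (\<lambda>_. 1) \<le> J0 (p q)"
      "\<forall>\<^sub>F q in sequentially. J0 (p q) \<le> J0 g + 1 / real (q + 1) * J0 (\<lambda>_. 1)"
      using bd[OF J0] by (auto intro!: always_eventually simp: algebra_simps)
    show "(\<lambda>q. J0 g - 1 / real (q + 1) * J0 (\<lambda>_. 1)) \<longlonglongrightarrow> J0 g"
      using tendsto_diff[OF tendsto_const inv] by simp
    show "(\<lambda>q. J0 g + 1 / real (q + 1) * J0 (\<lambda>_. 1)) \<longlonglongrightarrow> J0 g"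
      using tendsto_add[OF tendsto_const inv] by simp
  qed
  show ?thesis
  proof (rule tendsto_iterated_sandwich[where
      U = "\<lambda>q N. J N (p q) + 1 / real (q + 1) * J N (\<lambda>_. 1)" and u = "\<lambda>q. J0 (p q) + 1 / real (q + 1) * J0 (\<lambda>_. 1)"
      and W = "\<lambda>q N. J N (p q) - 1 / real (q + 1) * J N (\<lambda>_. 1)" and w = "\<lambda>q. J0 (p q) - 1 / real (q + 1) * J0 (\<lambda>_. 1)"])
    show "\<forall>\<^sub>F q in sequentially. (\<forall>\<^sub>F N in sequentially. J N g \<le> J N (p q) + 1 / real (q + 1) * J N (\<lambda>_. 1)) \<and>
       (\<lambda>N. J N (p q) + 1 / real (q + 1) * J N (\<lambda>_. 1)) \<longlonglongrightarrow> J0 (p q) + 1 / real (q + 1) * J0 (\<lambda>_. 1)"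
      using bd[OF J] by (intro always_eventually allI conjI tendsto_intros pl one) auto
    show "\<forall>\<^sub>F q in sequentially. (\<forall>\<^sub>F N in sequentially. J N (p q) - 1 / real (q + 1) * J N (\<lambda>_. 1) \<le> J N g) \<and>
       (\<lambda>N. J N (p q) - 1 / real (q + 1) * J N (\<lambda>_. 1)) \<longlonglongrightarrow> J0 (p q) - 1 / real (q + 1) * J0 (\<lambda>_. 1)"
      using bd[OF J] by (intro always_eventually allI conjI tendsto_intros pl one) auto
    show "(\<lambda>q. J0 (p q) + 1 / real (q + 1) * J0 (\<lambda>_. 1)) \<longlonglongrightarrow> J0 g"
      using tendsto_add[OF plim inv] by simp
    show "(\<lambda>q. J0 (p q) - 1 / real (q + 1) * J0 (\<lambda>_. 1)) \<longlonglongrightarrow> J0 g"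
      using tendsto_diff[OF plim inv] by simp
  qed
qed

abbreviation gamma_integrand :: "real \<Rightarrow> (real \<Rightarrow> real) \<Rightarrow> real \<Rightarrow> real" where
  "gamma_integrand \<beta> g x \<equiv> indicator {0<..} x * (x powr (\<beta> - 1) * exp (- x) * g (exp (- x)))"

definition gamma_functional :: "real \<Rightarrow> (real \<Rightarrow> real) \<Rightarrow> real" where
  "gamma_functional \<beta> g =
     (\<integral>x. gamma_integrand \<beta> g x \<partial>lborel) / Gamma \<beta>"

lemma integrable_gamma_functional:
  assumes \<beta>: "\<beta> > 0" and g: "continuous_on {0..1} g"
  shows "integrable lborel (\<lambda>x::real. gamma_integrand \<beta> g x)"
proof -
  have "bounded (g ` {0..1})" by (intro compact_imp_bounded compact_continuous_image g) simp
  then obtain K where "\<forall>y\<in>g ` {0..1}. norm y \<le> K" unfolding bounded_iff by blast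
    hence K: "\<And>s. s \<in> {0..1} \<Longrightarrow> \<bar>g s\<bar> \<le> K" by simp
  show ?thesis
  proof (rule Bochner_Integration.integrable_bound)
    show "integrable lborel (\<lambda>x. K * (indicator {0<..} x * (x powr (\<beta> - 1) * exp (- (1 * x)))))"
      using \<beta> by (intro integrable_mult_right integrable.intros[OF has_bochner_integral_Gamma]) auto
    have "continuous_on {0<..} (\<lambda>x::real. g (exp (- x)))"
      by (rule continuous_on_compose2[OF g]) (auto intro!: continuous_intros)
    hence "continuous_on {0<..} (\<lambda>x::real. x powr (\<beta> - 1) * exp (- x) * g (exp (- x)))"
      by (intro continuous_intros) auto
    from borel_measurable_continuous_on_indicator[OF _ this]
    show "(\<lambda>x::real. gamma_integrand \<beta> g x) \<in> borel_measurable lborel"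
      by simp
    show "AE x in lborel. norm (gamma_integrand \<beta> g x)
        \<le> norm (K * (indicator {0<..} x * (x powr (\<beta> - 1) * exp (- (1 * x)))))"
    proof (intro AE_I2)
      fix x :: real
      show "norm (gamma_integrand \<beta> g x)
        \<le> norm (K * (indicator {0<..} x * (x powr (\<beta> - 1) * exp (- (1 * x)))))"
      proof (cases "x > 0")
        case True
        hence "\<bar>g (exp (- x))\<bar> \<le> \<bar>K\<bar>" using K[of "exp (- x)"] by auto
        thus ?thesis using True by (simp add: abs_mult mult.commute mult_left_mono)
      qed simp
    qed
  qed
qed

lemma positive_functional_gamma:
  assumes \<beta>: "\<beta> > 0"
  shows "positive_functional (gamma_functional \<beta>)"
  unfolding positive_functional_def
proof (intro conjI allI impI)
  note G = Gamma_real_pos[OF \<beta>]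
  fix f g :: "real \<Rightarrow> real" and c :: real assume f: "continuous_on {0..1} f"
  note I = integrable_gamma_functional[OF \<beta>]
  have e: "gamma_functional \<beta> (\<lambda>s. c * f s) = (\<integral>x. c * (gamma_integrand \<beta> f x) \<partial>lborel) / Gamma \<beta>"
    unfolding gamma_functional_def by (intro arg_cong2[of _ _ _ _ "(/)"] Bochner_Integration.integral_cong) (auto simp: algebra_simps)
  show "gamma_functional \<beta> (\<lambda>s. c * f s) = c * gamma_functional \<beta> f"
    unfolding e by (simp add: gamma_functional_def)
  assume g: "continuous_on {0..1} g"
  have "gamma_functional \<beta> (\<lambda>s. f s + g s) = (\<integral>x. gamma_integrand \<beta> f x + gamma_integrand \<beta> g x \<partial>lborel) / Gamma \<beta>"
    unfolding gamma_functional_def by (intro arg_cong2[of _ _ _ _ "(/)"] Bochner_Integration.integral_cong) (auto simp: algebra_simps)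
  thus "gamma_functional \<beta> (\<lambda>s. f s + g s) = gamma_functional \<beta> f + gamma_functional \<beta> g"
    by (simp add: Bochner_Integration.integral_add[OF I[OF f] I[OF g]] gamma_functional_def add_divide_distrib)
  assume le: "\<forall>s\<in>{0..1}. f s \<le> g s"
  show "gamma_functional \<beta> f \<le> gamma_functional \<beta> g"
    unfolding gamma_functional_def
    by (intro divide_right_mono less_imp_le[OF G] integral_mono I f g)
       (use le in \<open>auto simp: indicator_def intro!: mult_left_mono\<close>)
qed

lemma gamma_functional_power:
  assumes \<beta>: "\<beta> > 0"
  shows "gamma_functional \<beta> (\<lambda>s. s ^ k) = real (Suc k) powr -\<beta>"
proof -
  have "(\<integral>x. indicator {0<..} x * (x powr (\<beta> - 1) * exp (- x) * exp (- x) ^ k) \<partial>lborel)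
     = (\<integral>x. indicator {0<..} x * (x powr (\<beta> - 1) * exp (- (real (Suc k) * x))) \<partial>lborel)"
    by (intro Bochner_Integration.integral_cong) (auto simp: exp_of_nat_mult[symmetric] exp_add[symmetric] algebra_simps)
  also have "\<dots> = Gamma \<beta> * real (Suc k) powr -\<beta>"
    by (rule has_bochner_integral_integral_eq[OF has_bochner_integral_Gamma]) (use \<beta> in auto)
  finally show ?thesis using Gamma_real_pos[OF \<beta>] by (simp add: gamma_functional_def)
qed

lemma has_bochner_integral_powr_Icc:
  fixes A \<beta> :: real
  assumes "\<beta> > 0" "A \<ge> 0"
  shows "has_bochner_integral lborel (\<lambda>x. indicator {0..A} x * x powr (\<beta> - 1)) (A powr \<beta> / \<beta>)"
proof (rule has_bochner_integral_nn_integral)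
  show "(\<integral>\<^sup>+x. ennreal (indicator {0..A} x * x powr (\<beta> - 1)) \<partial>lborel) = ennreal (A powr \<beta> / \<beta>)"
    using nn_integral_has_integral_lebesgue[OF _ has_integral_powr_from_0[of "\<beta> - 1" A]] assms by simp
qed (use assms in auto)

text \<open>The function \<open>s * ramp_quotient a b s\<close> increases continuously from \<open>0\<close>
  at \<open>a\<close> to \<open>1\<close> at \<open>b\<close>. The factor \<open>max s a\<close>
  instead of \<open>s\<close> keeps the quotient continuous at \<open>0\<close>.\<close>

definition ramp_quotient :: "real \<Rightarrow> real \<Rightarrow> real \<Rightarrow> real" where
  "ramp_quotient a b s = min 1 (max 0 ((s - a) / (b - a))) / max s a"

lemma ramp_quotient_props:
  assumes ab: "0 < a" "a < b" and s: "s > 0"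
  shows "0 \<le> s * ramp_quotient a b s" "s * ramp_quotient a b s \<le> 1"
    "s \<le> a \<Longrightarrow> ramp_quotient a b s = 0" "b \<le> s \<Longrightarrow> s * ramp_quotient a b s = 1"
proof -
  show "0 \<le> s * ramp_quotient a b s" using assms by (auto simp: ramp_quotient_def)
  have "s / max s a * min 1 (max 0 ((s - a) / (b - a))) \<le> 1 * 1"
    using assms by (intro mult_mono) auto
  thus "s * ramp_quotient a b s \<le> 1" by (simp add: ramp_quotient_def)
  show "ramp_quotient a b s = 0" if "s \<le> a"
  proof -
    have "(s - a) / (b - a) \<le> 0" using that ab by (simp add: divide_nonpos_pos)
    thus ?thesis by (simp add: ramp_quotient_def max_def)
  qed
  show "s * ramp_quotient a b s = 1" if "b \<le> s"
  proof -
    have "1 \<le> (s - a) / (b - a)" using that ab by simp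
    hence "min 1 (max 0 ((s - a) / (b - a))) = 1" by linarith
    moreover have "max s a = s" using that ab by simp
    ultimately show ?thesis using s by (simp add: ramp_quotient_def)
  qed
qed

lemma continuous_ramp_quotient:
  assumes "0 < a" "a < b"
  shows "continuous_on {0..1} (ramp_quotient a b)"
proof -
  have "continuous_on {0..1} (\<lambda>s. min 1 (max 0 ((s - a) / (b - a))) / max s a)"
  proof (rule continuous_on_divide)
    show "continuous_on {0..1} (\<lambda>s. min 1 (max 0 ((s - a) / (b - a))))"
      using assms by (intro continuous_intros) simp
    show "continuous_on {0..1} (\<lambda>s. max s a)" by (intro continuous_intros)
    show "\<forall>s\<in>{0..1}. max s a \<noteq> 0" using assms by (auto simp: max_def)
  qed
  thus ?thesis by (simp add: ramp_quotient_def[abs_def])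
qed

text \<open>Since \<open>s * ramp_quotient a b s\<close> lies between the indicators of \<open>s \<ge>
  b\<close> and \<open>s \<ge> a\<close>, the functional lies between the integrals of
  \<open>x\<^sup>\<beta>\<^sup>-\<^sup>1 / \<Gamma>(\<beta>)\<close> over \<open>[0, B]\<close>
  and \<open>[0, A]\<close>.\<close>

lemma gamma_functional_ramp:
  assumes \<beta>: "\<beta> > 0" and AB: "0 \<le> B" "B < A"
  shows "B powr \<beta> / Gamma (\<beta> + 1) \<le> gamma_functional \<beta> (ramp_quotient (exp (-A)) (exp (-B)))"
    "gamma_functional \<beta> (ramp_quotient (exp (-A)) (exp (-B))) \<le> A powr \<beta> / Gamma (\<beta> + 1)"
proof -
  let ?r = "ramp_quotient (exp (-A)) (exp (-B))"
  have G: "Gamma (\<beta> + 1) = \<beta> * Gamma \<beta>" using Gamma_plus1[of \<beta>] \<beta>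
    by (metis nonpos_Ints_nonpos not_le)
  note I = integrable_gamma_functional[OF \<beta> continuous_ramp_quotient[of "exp (-A)" "exp (-B)"]]
  note p = ramp_quotient_props[of "exp (-A)" "exp (-B)"]
  have hB: "has_bochner_integral lborel (\<lambda>x. indicator {0..B} x * x powr (\<beta> - 1)) (B powr \<beta> / \<beta>)"
    and hA: "has_bochner_integral lborel (\<lambda>x. indicator {0..A} x * x powr (\<beta> - 1)) (A powr \<beta> / \<beta>)"
    using AB by (auto intro!: has_bochner_integral_powr_Icc \<beta>)
  have ne: "AE x in lborel. x \<noteq> (0::real)" by (rule AE_lborel_singleton)
  have "B powr \<beta> / \<beta> \<le> (\<integral>x. gamma_integrand \<beta> ?r x \<partial>lborel)"
    unfolding has_bochner_integral_integral_eq[OF hB, symmetric]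
  proof (rule integral_mono_AE)
    show "AE x in lborel. indicator {0..B} x * x powr (\<beta> - 1) \<le> gamma_integrand \<beta> ?r x"
      using ne
    proof eventually_elim
      case (elim x)
      show ?case
      proof (cases "x \<in> {0..B}")
        case True
        hence "exp (-x) * ?r (exp (- x)) = 1" using AB by (intro p) auto
        thus ?thesis using True elim by (simp add: mult.assoc)
      next
        case False
        have "0 \<le> exp (-x) * ?r (exp (- x))" using AB by (intro p) auto
        thus ?thesis using False by (simp add: mult.assoc)
      qed
    qed
  qed (use hB I AB in \<open>auto simp: has_bochner_integral_iff\<close>)
  thus "B powr \<beta> / Gamma (\<beta> + 1) \<le> gamma_functional \<beta> ?r"
    unfolding G gamma_functional_def divide_divide_eq_left[symmetric]
    by (intro divide_right_mono less_imp_le[OF Gamma_real_pos[OF \<beta>]])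
  have "(\<integral>x. gamma_integrand \<beta> ?r x \<partial>lborel) \<le> A powr \<beta> / \<beta>"
    unfolding has_bochner_integral_integral_eq[OF hA, symmetric]
  proof (rule integral_mono)
    fix x :: real
    show "gamma_integrand \<beta> ?r x \<le> indicator {0..A} x * x powr (\<beta> - 1)"
    proof (cases "x \<in> {0..A}")
      case True
      have "exp (-x) * ?r (exp (- x)) \<le> 1" using AB by (intro p) auto
      hence "x powr (\<beta> - 1) * (exp (-x) * ?r (exp (- x))) \<le> x powr (\<beta> - 1) * 1" by (intro mult_left_mono) auto
      thus ?thesis using True by (auto simp: mult.assoc indicator_def)
    next
      case False
      show ?thesis
      proof (cases "x > 0")
        case True
        with False have "?r (exp (- x)) = 0" using AB by (intro p(3)) auto
        thus ?thesis using False by simp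
      qed (use False in auto)
    qed
  qed (use hA I AB in \<open>auto simp: has_bochner_integral_iff\<close>)
  thus "gamma_functional \<beta> ?r \<le> A powr \<beta> / Gamma (\<beta> + 1)"
    unfolding G gamma_functional_def divide_divide_eq_left[symmetric]
    by (intro divide_right_mono less_imp_le[OF Gamma_real_pos[OF \<beta>]])
qed

text \<open>Karamata's argument. The hypothesis at \<open>k\<close> is the convergence of the moment of
  order \<open>k - 1\<close> of the measure with weights \<open>b N a\<^sub>n exp (- n /
  N)\<close> at the points \<open>exp (- n / N)\<close>, so only the values \<open>u = k /
  N\<close> of the Laplace transform matter. The sum over \<open>n \<le> N\<close> belongs to the
  discontinuous function \<open>1 / s\<close> for \<open>s \<ge> 1 / e\<close>, which the ramps
  approximate from both sides.\<close>

theorem karamata_tauberian: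
  fixes a b :: "nat \<Rightarrow> real"
  assumes \<beta>: "\<beta> > 0" and a: "\<And>n. a n \<ge> 0" and b: "\<And>N. b N \<ge> 0"
    and sm: "\<And>N. N \<ge> 1 \<Longrightarrow> summable (\<lambda>n. a n * exp (- (1 / real N * real n)))"
    and lim: "\<And>k::nat. k \<ge> 1 \<Longrightarrow>
       (\<lambda>N. b N * (\<Sum>n. a n * exp (- (real k / real N * real n)))) \<longlonglongrightarrow> real k powr -\<beta>"
  shows "(\<lambda>N. b N * (\<Sum>n\<le>N. a n)) \<longlonglongrightarrow> 1 / Gamma (\<beta> + 1)"
proof -
  define e where "e N n = exp (- (1 / real (Suc N) * real n))" for N n
  have e: "e N n \<in> {0..1}" "e N n > 0" for N n by (auto simp: e_def)
  have sme: "summable (\<lambda>n. a n * e N n)" for N unfolding e_def by (rule sm) simp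
  \<comment> \<open>Indexing by \<open>Suc N\<close> avoids the mesh \<open>1 / N\<close> at \<open>N
    = 0\<close>, where the sums need not converge.\<close>
  define J where "J N g = b (Suc N) * (\<Sum>n. a n * e N n * g (e N n))" for N g
  have smJ: "summable (\<lambda>n. a n * e N n * g (e N n))" if g: "continuous_on {0..1} g" for N g
  proof -
    have "bounded (g ` {0..1})" by (intro compact_imp_bounded compact_continuous_image g) simp
    then obtain K where "\<forall>y\<in>g ` {0..1}. norm y \<le> K" unfolding bounded_iff by blast
    hence K: "\<And>s. s \<in> {0..1} \<Longrightarrow> \<bar>g s\<bar> \<le> K" by simp
    show ?thesis
    proof (rule summable_comparison_test'[where g = "\<lambda>n. K * (a n * e N n)"])
      show "summable (\<lambda>n. K * (a n * e N n))" by (intro summable_mult sme)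
      show "norm (a n * e N n * g (e N n)) \<le> K * (a n * e N n)" for n
        using K[OF e(1)[of N n]] a[of n] e(2)[of N n] by (simp add: abs_mult mult.commute mult_right_mono)
    qed
  qed
  have J: "positive_functional (J N)" for N
    unfolding positive_functional_def
  proof (intro conjI allI impI)
    fix f g :: "real \<Rightarrow> real" and c :: real assume f: "continuous_on {0..1} f"
    have "(\<Sum>n. a n * e N n * (c * f (e N n))) = c * (\<Sum>n. a n * e N n * f (e N n))"
      by (subst suminf_mult[OF smJ[OF f], symmetric]) (simp add: mult_ac)
    thus "J N (\<lambda>s. c * f s) = c * J N f" by (simp add: J_def)
    assume g: "continuous_on {0..1} g"
    have "(\<Sum>n. a n * e N n * (f (e N n) + g (e N n))) = (\<Sum>n. a n * e N n * f (e N n)) + (\<Sum>n. a n * e N n * g (e N n))"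
      by (subst suminf_add[OF smJ[OF f] smJ[OF g]]) (simp add: algebra_simps)
    thus "J N (\<lambda>s. f s + g s) = J N f + J N g" by (simp add: J_def algebra_simps)
    assume le: "\<forall>s\<in>{0..1}. f s \<le> g s"
    have "a n * e N n * f (e N n) \<le> a n * e N n * g (e N n)" for n
      using le e a[of n] by (intro mult_left_mono) (auto intro: less_imp_le)
    from suminf_le[OF this smJ[OF f] smJ[OF g]] show "J N f \<le> J N g"
      unfolding J_def by (intro mult_left_mono b)
  qed
  have mom: "(\<lambda>N. J N (\<lambda>s. s ^ k)) \<longlonglongrightarrow> gamma_functional \<beta> (\<lambda>s. s ^ k)" for k
  proof -
    have "e N n * e N n ^ k = exp (- (real (Suc k) / real (Suc N) * real n))" for N n
    proof -
      have "e N n * e N n ^ k = e N n ^ Suc k" by simp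
      also have "\<dots> = exp (real (Suc k) * (- (1 / real (Suc N) * real n)))"
        unfolding e_def by (rule exp_of_nat_mult[symmetric])
      also have "real (Suc k) * (- (1 / real (Suc N) * real n)) = - (real (Suc k) / real (Suc N) * real n)"
        by (simp add: field_simps)
      finally show ?thesis .
    qed
    hence "J N (\<lambda>s. s ^ k) = b (Suc N) * (\<Sum>n. a n * exp (- (real (Suc k) / real (Suc N) * real n)))" for N
      unfolding J_def by (simp only: mult.assoc)
    thus ?thesis using LIMSEQ_Suc[OF lim[of "Suc k"]] gamma_functional_power[OF \<beta>, of k] by simp
  qed
  note conv = positive_functional_moments[OF J positive_functional_gamma[OF \<beta>] mom]
  define r where "r A B = ramp_quotient (exp (-A)) (exp (-B))" for A B :: real
  have rc: "continuous_on {0..1} (r A B)" if "B < A" for A B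
    unfolding r_def using that by (intro continuous_ramp_quotient) auto
  have eN: "n \<le> Suc N \<longleftrightarrow> exp (-1) \<le> e N n" for n N
  proof -
    have "n \<le> Suc N \<longleftrightarrow> real n \<le> real (Suc N)" by (simp only: of_nat_le_iff)
    also have "\<dots> \<longleftrightarrow> 1 / real (Suc N) * real n \<le> 1" by (simp add: pos_divide_le_eq del: of_nat_Suc)
    finally show ?thesis by (simp add: e_def del: of_nat_Suc)
  qed
  have upper: "b (Suc N) * (\<Sum>n\<le>Suc N. a n) \<le> J N (r A 1)" if A: "A > 1" for A N
  proof -
    have r1: "e N n * r A 1 (e N n) = 1" if "n \<le> Suc N" for n
      unfolding r_def using that A e(2) eN by (intro ramp_quotient_props(4)) auto
    have r0: "0 \<le> e N n * r A 1 (e N n)" for n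
      unfolding r_def using A e(2) by (intro ramp_quotient_props(1)) auto
    have "(\<Sum>n\<le>Suc N. a n) = (\<Sum>n\<le>Suc N. a n * e N n * r A 1 (e N n))"
      by (rule sum.cong) (simp_all add: mult.assoc r1)
    also have "\<dots> \<le> (\<Sum>n. a n * e N n * r A 1 (e N n))"
    proof (rule sum_le_suminf[OF smJ[OF rc[OF A]]])
      show "0 \<le> a n * e N n * r A 1 (e N n)" for n
        unfolding mult.assoc by (intro mult_nonneg_nonneg a r0)
    qed simp
    finally show ?thesis unfolding J_def by (intro mult_left_mono b)
  qed
  have lower: "J N (r 1 B) \<le> b (Suc N) * (\<Sum>n\<le>Suc N. a n)" if B: "B < 1" for B N
  proof -
    have r0: "r 1 B (e N n) = 0" if "\<not> n \<le> Suc N" for n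
      unfolding r_def using that B e(2) eN by (intro ramp_quotient_props(3)) auto
    have r1: "e N n * r 1 B (e N n) \<le> 1" for n
      unfolding r_def using B e(2) by (intro ramp_quotient_props(2)) auto
    have "(\<Sum>n. a n * e N n * r 1 B (e N n)) = (\<Sum>n\<le>Suc N. a n * e N n * r 1 B (e N n))"
      by (rule suminf_finite) (simp_all add: r0)
    also have "\<dots> \<le> (\<Sum>n\<le>Suc N. a n * 1)"
      unfolding mult.assoc by (intro sum_mono mult_left_mono r1 a)
    finally show ?thesis unfolding J_def by (intro mult_left_mono b) simp
  qed
  define A B where "A q = 1 + 1 / real (q + 2)" and "B q = 1 - 1 / real (q + 2)" for q :: nat
  have AB: "A q > 1" "B q < 1" "B q \<ge> 0" for q by (auto simp: A_def B_def)
  have "(\<lambda>N. b (Suc N) * (\<Sum>n\<le>Suc N. a n)) \<longlonglongrightarrow> 1 / Gamma (\<beta> + 1)"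
  proof (rule tendsto_iterated_sandwich[where U = "\<lambda>q N. J N (r (A q) 1)" and u = "\<lambda>q. gamma_functional \<beta> (r (A q) 1)"
        and W = "\<lambda>q N. J N (r 1 (B q))" and w = "\<lambda>q. gamma_functional \<beta> (r 1 (B q))"])
    show "\<forall>\<^sub>F q in sequentially. (\<forall>\<^sub>F N in sequentially. b (Suc N) * (\<Sum>n\<le>Suc N. a n) \<le> J N (r (A q) 1)) \<and>
      (\<lambda>N. J N (r (A q) 1)) \<longlonglongrightarrow> gamma_functional \<beta> (r (A q) 1)"
      using AB by (intro always_eventually allI conjI conv rc upper) auto
    show "\<forall>\<^sub>F q in sequentially. (\<forall>\<^sub>F N in sequentially. J N (r 1 (B q)) \<le> b (Suc N) * (\<Sum>n\<le>Suc N. a n)) \<and>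
      (\<lambda>N. J N (r 1 (B q))) \<longlonglongrightarrow> gamma_functional \<beta> (r 1 (B q))"
      using AB by (intro always_eventually allI conjI conv rc lower) auto
    have "A \<longlonglongrightarrow> 1" "B \<longlonglongrightarrow> 1" unfolding A_def[abs_def] B_def[abs_def] by real_asymp+
    hence "(\<lambda>q. A q powr \<beta> / Gamma (\<beta> + 1)) \<longlonglongrightarrow> 1 powr \<beta> / Gamma (\<beta> + 1)"
      "(\<lambda>q. B q powr \<beta> / Gamma (\<beta> + 1)) \<longlonglongrightarrow> 1 powr \<beta> / Gamma (\<beta> + 1)"
      using less_imp_neq[OF Gamma_real_pos[of "\<beta> + 1"]] \<beta>
      by (intro tendsto_divide tendsto_powr tendsto_const; simp)+
    hence lims: "(\<lambda>q. A q powr \<beta> / Gamma (\<beta> + 1)) \<longlonglongrightarrow> 1 / Gamma (\<beta> + 1)"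
      "(\<lambda>q. B q powr \<beta> / Gamma (\<beta> + 1)) \<longlonglongrightarrow> 1 / Gamma (\<beta> + 1)" by simp_all
    have g1: "1 / Gamma (\<beta> + 1) \<le> gamma_functional \<beta> (r (A q) 1)"
      "gamma_functional \<beta> (r (A q) 1) \<le> A q powr \<beta> / Gamma (\<beta> + 1)" for q
      using gamma_functional_ramp[OF \<beta>, of 1 "A q"] AB(1)[of q] by (simp_all add: r_def)
    have g2: "B q powr \<beta> / Gamma (\<beta> + 1) \<le> gamma_functional \<beta> (r 1 (B q))"
      "gamma_functional \<beta> (r 1 (B q)) \<le> 1 / Gamma (\<beta> + 1)" for q
      using gamma_functional_ramp[OF \<beta>, of "B q" 1] AB(2,3)[of q] by (simp_all add: r_def)
    show "(\<lambda>q. gamma_functional \<beta> (r (A q) 1)) \<longlonglongrightarrow> 1 / Gamma (\<beta> + 1)"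
      by (rule tendsto_sandwich[OF always_eventually always_eventually tendsto_const lims(1)]) (use g1 in blast)+
    show "(\<lambda>q. gamma_functional \<beta> (r 1 (B q))) \<longlonglongrightarrow> 1 / Gamma (\<beta> + 1)"
      by (rule tendsto_sandwich[OF always_eventually always_eventually lims(2) tendsto_const]) (use g2 in blast)+
  qed
  thus ?thesis by (rule LIMSEQ_imp_Suc)
qed

section \<open>Reduced resolvents and perturbation of a simple eigenvalue\<close>

lemma is_inverse_op_unique:
  assumes "is_inverse_op A S" "is_inverse_op A S'"
  shows "S = S'"
proof -
  have "S x = S' x" for x
  proof -
    have "A (S' x) = x" "S (A (S' x)) = S' x"
      using assms unfolding is_inverse_op_def
      by (metis blinfun_apply_blinfun_compose blinfun_apply_id_blinfun)+
    thus ?thesis by simp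
  qed
  thus ?thesis by (rule blinfun_eqI)
qed

text \<open>From \<open>S' - S = - S' (A' - A) S\<close>. The smallness condition bounds \<open>S'\<close>
  by \<open>2 S\<close> in norm, so that the estimate depends on \<open>S\<close> only.\<close>

lemma norm_inverse_op_diff:
  assumes "is_inverse_op A S" "is_inverse_op A' S'" "norm (A' - A) * norm S \<le> 1/2"
  shows "norm (S' - S) \<le> 2 * (norm S)\<^sup>2 * norm (A' - A)"
proof -
  have "S' - S = - (S' o\<^sub>L (A' - A) o\<^sub>L S)"
  proof (rule blinfun_eqI)
    fix x
    have a: "A' (S' y) = y" "S' (A' y) = y" "A (S y) = y" for y
      using assms unfolding is_inverse_op_def
      by (metis blinfun_apply_blinfun_compose blinfun_apply_id_blinfun)+
    show "(S' - S) x = (- (S' o\<^sub>L (A' - A) o\<^sub>L S)) x"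
      by (simp add: blinfun.diff_left blinfun.minus_left blinfun.diff_right a)
  qed
  hence "norm (S' - S) \<le> norm (S' o\<^sub>L (A' - A)) * norm S"
    by (simp add: norm_blinfun_compose)
  also have "\<dots> \<le> (norm S' * norm (A' - A)) * norm S"
    by (intro mult_right_mono norm_blinfun_compose) auto
  finally have eq: "norm (S' - S) \<le> norm S' * (norm (A' - A) * norm S)"
    by (simp add: mult.assoc)
  have "norm S' * (norm (A' - A) * norm S) \<le> norm S' * (1/2)" by (rule mult_left_mono) (use assms in auto)
  with eq have "norm (S' - S) \<le> norm S' / 2" by simp
  moreover have "norm S' \<le> norm S + norm (S' - S)" by (metis norm_triangle_sub)
  ultimately have "norm S' \<le> 2 * norm S" by simp
  hence "norm S' * (norm (A' - A) * norm S) \<le> (2 * norm S) * (norm (A' - A) * norm S)"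
    by (intro mult_right_mono) auto
  with eq show ?thesis by (simp add: power2_eq_square mult_ac)
qed

lemma continuous_on_inverse_op:
  assumes "continuous_on U A" and inv: "\<And>t. t \<in> U \<Longrightarrow> is_inverse_op (A t) (S t)"
  shows "continuous_on U S"
  unfolding continuous_on_def
proof
  fix t assume t: "t \<in> U"
  have lim: "((\<lambda>s. norm (A s - A t)) \<longlongrightarrow> 0) (at t within U)"
    using assms(1) t by (auto simp: continuous_on_def intro!: tendsto_norm_zero LIM_zero)
  have "((\<lambda>s. norm (A s - A t) * norm (S t)) \<longlongrightarrow> 0 * norm (S t)) (at t within U)"
    by (intro tendsto_intros lim)
  hence "eventually (\<lambda>s. norm (A s - A t) * norm (S t) < 1/2) (at t within U)"
    by (auto dest: order_tendstoD(2)[where a = "1/2"])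
  moreover have "eventually (\<lambda>s. s \<in> U) (at t within U)" by (simp add: eventually_at_filter)
  ultimately have "eventually (\<lambda>s. norm (S s - S t) \<le> 2 * (norm (S t))\<^sup>2 * norm (A s - A t)) (at t within U)"
    by eventually_elim (rule norm_inverse_op_diff[OF inv[OF t] inv], auto)
  moreover have "((\<lambda>s. 2 * (norm (S t))\<^sup>2 * norm (A s - A t)) \<longlongrightarrow> 2 * (norm (S t))\<^sup>2 * 0) (at t within U)"
    by (intro tendsto_intros lim)
  ultimately have "((\<lambda>s. S s - S t) \<longlongrightarrow> 0) (at t within U)"
    by (intro Lim_null_comparison[of "\<lambda>s. S s - S t"]) auto
  thus "(S \<longlongrightarrow> S t) (at t within U)" by (rule LIM_zero_cancel)
qed

lemma cscalar_eq: "cscalar z = Re z *\<^sub>R cscalar 1 + Im z *\<^sub>R cscalar \<i>"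
  by (rule blinfun_eqI) (auto simp: cscalar.rep_eq cscale_def blinfun.add_left blinfun.scaleR_left)

lemma continuous_on_cscalar [continuous_intros]:
  "continuous_on U g \<Longrightarrow> continuous_on U (\<lambda>t. cscalar (g t))"
  by (subst cscalar_eq) (intro continuous_intros)

lemma cscale_mult: "cscale z (cscale w p) = cscale (z * w) p"
  by (auto simp: cscale_def algebra_simps)

text \<open>The operator \<open>S\<close> is the constant term of the Laurent expansion of the resolvent at
  the simple eigenvalue \<open>1\<close>, that is, \<open>(1 / 2 \<pi> i) \<integral> (z -
  T)\<^sup>-\<^sup>1 (z - 1)\<^sup>-\<^sup>1 dz\<close>. Integrating \<open>(1 - T) (z -
  T)\<^sup>-\<^sup>1 = 1 - (z - 1) (z - T)\<^sup>-\<^sup>1\<close> shows that \<open>(1 - T)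
  S\<close> is the complement of the spectral projection. The latter has rank one, fixes
  \<open>e\<close> and preserves \<open>q\<close>; therefore it is \<open>u \<mapsto> q u
  e\<close>.\<close>

lemma reduced_resolvent:
  fixes T :: "'b::banach \<Rightarrow>\<^sub>L 'b" and q :: "'b \<Rightarrow>\<^sub>L real"
  assumes simple: "simple_isolated_eigenvalue T 1"
    and Te: "T e = e" and qT: "\<And>u. q (T u) = q u" and qe: "q e = 1"
  obtains S :: "'b \<Rightarrow>\<^sub>L 'b" where "\<And>u. S u - T (S u) = u - q u *\<^sub>R e"
proof -
  define TC where "TC = complexification T"
  have TC: "TC p = (T (fst p), T (snd p))" for p by (simp add: TC_def complexification.rep_eq)
  obtain r e' where r: "r > 0" and spec: "spectrum_op T \<inter> cball 1 r = {1}"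
    and rng: "range (blinfun_apply (spectral_projection T 1 r)) = range (\<lambda>z. cscale z e')"
    using simple unfolding simple_isolated_eigenvalue_def by blast
  define \<rho> where "\<rho> t = of_real r * cis (2 * pi * t)" for t
  have \<rho>0: "\<rho> t \<noteq> 0" for t using r by (simp add: \<rho>_def)
  define Rz where "Rz t = resolvent_op T (1 + \<rho> t)" for t
  have inv: "is_inverse_op (cscalar (1 + \<rho> t) - TC) (Rz t)" for t
  proof -
    have "1 + \<rho> t \<in> cball 1 r" using r by (auto simp: \<rho>_def dist_norm norm_mult)
    moreover have "1 + \<rho> t \<noteq> 1" using \<rho>0 by simp
    ultimately have "1 + \<rho> t \<notin> spectrum_op T" using spec by blast
    then obtain S where S: "is_inverse_op (cscalar (1 + \<rho> t) - TC) S"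
      by (auto simp: spectrum_op_def TC_def)
    show ?thesis unfolding Rz_def resolvent_op_def TC_def[symmetric]
      by (rule theI[of _ S]) (use S is_inverse_op_unique in auto)
  qed
  have inv1: "Rz t (cscale (1 + \<rho> t) p - TC p) = p"
    and inv2: "cscale (1 + \<rho> t) (Rz t p) - TC (Rz t p) = p" for t p
  proof -
    have "(Rz t o\<^sub>L (cscalar (1 + \<rho> t) - TC)) p = p" "((cscalar (1 + \<rho> t) - TC) o\<^sub>L Rz t) p = p"
      using inv[of t] by (auto simp: is_inverse_op_def)
    thus "Rz t (cscale (1 + \<rho> t) p - TC p) = p" "cscale (1 + \<rho> t) (Rz t p) - TC (Rz t p) = p"
      by (simp_all add: blinfun.diff_left cscalar.rep_eq)
  qed
  define G where "G t = cscalar (\<rho> t) o\<^sub>L Rz t" for t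
  have c\<rho>: "continuous_on {0..1} \<rho>" unfolding \<rho>_def by (intro continuous_intros)
  have cR: "continuous_on {0..1} Rz"
    by (rule continuous_on_inverse_op[OF _ inv]) (intro continuous_intros c\<rho>)
  have cG: "continuous_on {0..1} G"
    unfolding G_def
    by (rule bounded_bilinear.continuous_on[OF bounded_bilinear_blinfun_compose])
       (intro continuous_intros c\<rho> cR)+
  define P where "P = spectral_projection T 1 r"
  have P: "(G has_integral P) {0..1}"
    using integrable_integral[OF integrable_continuous_real[OF cG]]
    by (simp add: P_def spectral_projection_def G_def[abs_def] \<rho>_def Rz_def)
  \<comment> \<open>The parametrisation turns \<open>dz / (2 \<pi> i (z - 1))\<close> into
    \<open>dt\<close>.\<close>
  define SC where "SC = integral {0..1} Rz"
  have SC: "(Rz has_integral SC) {0..1}"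
    unfolding SC_def by (rule integrable_integral[OF integrable_continuous_real[OF cR]])
  have Gp: "((\<lambda>t. G t p) has_integral P p) {0..1}" for p
    using has_integral_linear[OF P, of "\<lambda>X. blinfun_apply X p"]
    by (simp add: o_def blinfun.bounded_linear_left)
  have Rp: "((\<lambda>t. Rz t p) has_integral SC p) {0..1}" for p
    using has_integral_linear[OF SC, of "\<lambda>X. blinfun_apply X p"]
    by (simp add: o_def blinfun.bounded_linear_left)
  have Gapply: "G t p = cscale (\<rho> t) (Rz t p)" for t p
    by (simp add: G_def cscalar.rep_eq)
  have main: "SC p - TC (SC p) = p - P p" for p
  proof -
    have "((\<lambda>t. (Rz t p) - TC (Rz t p)) has_integral SC p - TC (SC p)) {0..1}"
      using has_integral_linear[OF Rp blinfun.bounded_linear_right[of TC], of p]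
      by (intro has_integral_diff Rp) (simp add: o_def)
    moreover have "Rz t p - TC (Rz t p) = p - G t p" for t
      using inv2[of t p] by (auto simp: Gapply cscale_def algebra_simps prod_eq_iff)
    moreover have "((\<lambda>t. p - G t p) has_integral p - P p) {0..1}"
      using has_integral_const_real[of p 0 1] by (intro has_integral_diff Gp) simp
    ultimately show ?thesis by (simp add: has_integral_unique)
  qed
  have Pe: "P (e, 0) = (e, 0)"
  proof -
    have "G t (e, 0) = (e, 0)" for t
    proof -
      define x where "x = cscale (1 / \<rho> t) (e, 0)"
      have "TC x = x" by (simp add: x_def TC cscale_def blinfun.scaleR_right Te)
      hence "cscale (1 + \<rho> t) x - TC x = cscale (\<rho> t) x"
        by (auto simp: cscale_def algebra_simps prod_eq_iff)
      also have "\<dots> = (e, 0)" using \<rho>0[of t] by (simp add: x_def cscale_mult) (simp add: cscale_def)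
      finally have "Rz t (e, 0) = x" using inv1[of t x] by simp
      thus ?thesis using \<open>cscale (\<rho> t) x = (e, 0)\<close> by (simp add: Gapply)
    qed
    hence "((\<lambda>t::real. (e, 0::'b)) has_integral P (e, 0)) {0..1}" using Gp[of "(e, 0)"] by simp
    moreover have "((\<lambda>t::real. (e, 0::'b)) has_integral (e, 0)) {0..1}"
      using has_integral_const_real[of "(e, 0::'b)" 0 1] by simp
    ultimately show ?thesis by (rule has_integral_unique)
  qed
  \<comment> \<open>The complexification of \<open>q\<close>, which identifies the multiple of
    \<open>e\<close> in the range of \<open>P\<close>.\<close>
  define qc where "qc p = complex_of_real (q (fst p)) + \<i> * complex_of_real (q (snd p))" for p
  have blq: "bounded_linear qc"
    unfolding qc_def
    by (intro bounded_linear_add bounded_linear_mult_right[THEN bounded_linear_compose]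
        bounded_linear_of_real[THEN bounded_linear_compose]
        blinfun.bounded_linear_right[THEN bounded_linear_compose] bounded_linear_fst bounded_linear_snd)
  have qcs: "qc (cscale z p) = z * qc p" for z p
    by (simp add: qc_def cscale_def blinfun.diff_right blinfun.add_right blinfun.scaleR_right complex_eq_iff)
  have qP: "qc (P p) = qc p" for p
  proof -
    have "qc (G t p) = qc p" for t
    proof -
      have "qc p = qc (cscale (1 + \<rho> t) (Rz t p)) - qc (TC (Rz t p))"
        using inv2[of t p] by (metis blq linear_simps(2))
      also have "qc (TC (Rz t p)) = qc (Rz t p)" by (simp add: qc_def TC qT)
      finally show ?thesis by (simp add: Gapply qcs algebra_simps)
    qed
    hence "((\<lambda>t::real. qc p) has_integral qc (P p)) {0..1}"
      using has_integral_linear[OF Gp blq, of p] by (simp add: o_def)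
    moreover have "((\<lambda>t::real. qc p) has_integral qc p) {0..1}"
      using has_integral_const_real[of "qc p" 0 1] by simp
    ultimately show ?thesis by (rule has_integral_unique)
  qed
  have Pu: "P (u, 0) = (q u *\<^sub>R e, 0)" for u
  proof -
    have "(e, 0) \<in> range (\<lambda>z. cscale z e')" using rng Pe by (metis P_def rangeI)
    then obtain z0 where z0: "(e, 0) = cscale z0 e'" by blast
    have "z0 \<noteq> 0"
    proof
      assume "z0 = 0"
      hence "e = 0" using z0 by (simp add: cscale_def)
      thus False using qe by (simp add: blinfun.zero_right)
    qed
    have "P (u, 0) \<in> range (\<lambda>z. cscale z e')" unfolding rng[symmetric] P_def by (rule rangeI)
    then obtain z1 where "P (u, 0) = cscale z1 e'" by blast
    hence Pz: "P (u, 0) = cscale (z1 / z0) (e, 0)" using \<open>z0 \<noteq> 0\<close> by (simp add: z0 cscale_mult)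
    have "qc (u, 0) = z1 / z0 * qc (e, 0)" using qP[of "(u, 0)"] by (simp add: Pz qcs)
    hence "z1 / z0 = of_real (q u)" by (simp add: qc_def qe blinfun.zero_right)
    thus ?thesis by (simp add: Pz cscale_def)
  qed
  have bl: "bounded_linear (\<lambda>u. fst (SC (u, 0)))"
    by (intro bounded_linear_fst[THEN bounded_linear_compose]
          blinfun.bounded_linear_right[THEN bounded_linear_compose] bounded_linear_Pair
          bounded_linear_ident bounded_linear_zero)
  show ?thesis
  proof (rule that[of "Blinfun (\<lambda>u. fst (SC (u, 0)))"])
    fix u
    have "fst (SC (u, 0) - TC (SC (u, 0))) = fst ((u, 0) - P (u, 0))" by (simp add: main)
    thus "Blinfun (\<lambda>u. fst (SC (u, 0))) u - T (Blinfun (\<lambda>u. fst (SC (u, 0))) u) = u - q u *\<^sub>R e"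
      by (simp add: bounded_linear_Blinfun_apply[OF bl] TC Pu)
  qed
qed

text \<open>The vector \<open>h\<close> is the fixed point of the contraction \<open>h \<mapsto> e - S (D
  h)\<close>. Applying \<open>1 - T\<close> removes \<open>S\<close> up to a multiple of
  \<open>e\<close>, which is the right-hand side.\<close>

lemma perturbed_eigenvector:
  fixes T S D :: "'b::banach \<Rightarrow>\<^sub>L 'b" and q :: "'b \<Rightarrow>\<^sub>L real"
  assumes S: "\<And>u. S u - T (S u) = u - q u *\<^sub>R e" and Te: "T e = e"
    and small: "norm S * norm D \<le> 1/2"
  obtains h where "h - T h + D h = q (D h) *\<^sub>R e" "norm (h - e) \<le> 2 * norm S * norm D * norm e"
proof -
  have SD: "norm (S (D x)) \<le> norm S * norm D * norm x" for x
    by (rule order.trans[OF norm_blinfun])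
       (auto simp: mult.assoc intro!: mult_left_mono norm_blinfun)
  have "\<exists>!h. h \<in> UNIV \<and> e - S (D h) = h"
  proof (rule Banach_fix[of UNIV "1/2"])
    show "complete (UNIV :: 'b set)" by (simp add: complete_UNIV)
    fix x y :: 'b
    have "dist (e - S (D x)) (e - S (D y)) = norm (S (D (y - x)))"
      by (simp add: dist_norm blinfun.diff_right)
    also have "\<dots> \<le> norm S * norm D * norm (y - x)" by (rule SD)
    also have "\<dots> \<le> 1/2 * norm (y - x)" by (intro mult_right_mono small) auto
    finally show "dist (e - S (D x)) (e - S (D y)) \<le> 1/2 * dist x y"
      by (simp add: dist_norm norm_minus_commute)
  qed auto
  then obtain h where h: "e - S (D h) = h" by blast
  show ?thesis
  proof (rule that[of h])
    have "h - T h = (e - T e) - (S (D h) - T (S (D h)))"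
      by (subst (1 2) h[symmetric]) (simp add: blinfun.diff_right)
    also have "\<dots> = - (D h - q (D h) *\<^sub>R e)" by (simp only: S Te) simp
    finally show "h - T h + D h = q (D h) *\<^sub>R e" by simp
    have "norm (h - e) = norm (S (D h))" by (metis h diff_diff_eq2 norm_minus_commute add_diff_cancel_left' diff_add_cancel)
    also have "\<dots> \<le> norm S * norm D * norm h" by (rule SD)
    also have "\<dots> \<le> norm S * norm D * (norm (h - e) + norm e)"
      using norm_triangle_sub[of h e] by (intro mult_left_mono) (auto simp: add.commute)
    finally have "norm (h - e) \<le> norm S * norm D * norm (h - e) + norm S * norm D * norm e"
      by (simp add: algebra_simps)
    also have "norm S * norm D * norm (h - e) \<le> 1/2 * norm (h - e)"
      by (intro mult_right_mono small) auto
    finally show "norm (h - e) \<le> 2 * norm S * norm D * norm e" by simp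
  qed
qed

section \<open>Transfer operators\<close>

text \<open>Since versions of \<open>L v\<close> are determined by duality alone, every relation between
  them is obtained by testing against indicators.\<close>

lemma AE_le_of_integrals:
  fixes u v :: "'a \<Rightarrow> real"
  assumes u: "integrable M u" and v: "integrable M v"
    and le: "\<And>A. A \<in> sets M \<Longrightarrow> (\<integral>x. u x * indicator A x \<partial>M) \<le> (\<integral>x. v x * indicator A x \<partial>M)"
  shows "AE x in M. u x \<le> v x"
proof -
  have [measurable]: "u \<in> borel_measurable M" "v \<in> borel_measurable M" using u v by auto
  define A where "A = {x \<in> space M. v x < u x}"
  have A: "A \<in> sets M" unfolding A_def by measurable
  have i: "integrable M (\<lambda>x. u x * indicator A x)" "integrable M (\<lambda>x. v x * indicator A x)"
    using u v A by (auto intro: integrable_real_mult_indicator)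
  have nn: "AE x in M. 0 \<le> u x * indicator A x - v x * indicator A x"
    by (auto simp: A_def indicator_def)
  have "(\<integral>x. u x * indicator A x - v x * indicator A x \<partial>M) \<le> 0"
    using le[OF A] i by simp
  moreover have "0 \<le> (\<integral>x. u x * indicator A x - v x * indicator A x \<partial>M)"
    using nn by (rule integral_nonneg_AE)
  ultimately have "(\<integral>x. u x * indicator A x - v x * indicator A x \<partial>M) = 0" by linarith
  hence "AE x in M. u x * indicator A x - v x * indicator A x = 0"
    using integral_nonneg_eq_0_iff_AE[OF Bochner_Integration.integrable_diff[OF i] nn] by simp
  thus ?thesis using AE_space by eventually_elim (auto simp: A_def indicator_def split: if_splits)
qed

lemma AE_eq_of_integrals:
  fixes u v :: "'a \<Rightarrow> real"
  assumes "integrable M u" "integrable M v"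
    and "\<And>A. A \<in> sets M \<Longrightarrow> (\<integral>x. u x * indicator A x \<partial>M) = (\<integral>x. v x * indicator A x \<partial>M)"
  shows "AE x in M. u x = v x"
proof -
  have "AE x in M. u x \<le> v x" "AE x in M. v x \<le> u x"
    using assms by (auto intro!: AE_le_of_integrals)
  thus ?thesis by eventually_elim simp
qed

locale transfer =
  fixes M :: "'a measure" and f :: "'a \<Rightarrow> 'a" and L :: "('a \<Rightarrow> real) \<Rightarrow> 'a \<Rightarrow> real"
  assumes mp: "measure_preserving_map M f" and tr: "transfer_operator M f L"
begin

lemma f_meas [measurable]: "f \<in> measurable M M" and distr_f: "distr M M f = M"
  using mp by (auto simp: measure_preserving_map_def)

lemma f_space: "x \<in> space M \<Longrightarrow> f x \<in> space M"
  using f_meas by (rule measurable_space)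

lemma emeasure_vimage: "A \<in> sets M \<Longrightarrow> emeasure M (f -` A \<inter> space M) = emeasure M A"
  using emeasure_distr[OF f_meas, of A] by (simp add: distr_f)

lemma integral_comp: "w \<in> borel_measurable M \<Longrightarrow> (\<integral>x. w (f x) \<partial>M) = (\<integral>x. w x \<partial>M)" for w :: "'a \<Rightarrow> real"
  using integral_distr[OF f_meas, of w] by (simp add: distr_f)

lemma integrable_comp: "integrable M w \<Longrightarrow> integrable M (\<lambda>x. w (f x))" for w :: "'a \<Rightarrow> real"
  using integrable_distr[OF f_meas, of w] by (simp add: distr_f)

lemma integrable_L: "integrable M v \<Longrightarrow> integrable M (L v)"
  using tr by (simp add: transfer_operator_def)

lemma dual:
  assumes "integrable M v" "w \<in> borel_measurable M" "\<And>x. x \<in> space M \<Longrightarrow> \<bar>w x\<bar> \<le> K"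
  shows "(\<integral>x. L v x * w x \<partial>M) = (\<integral>x. v x * w (f x) \<partial>M)"
  using tr assms unfolding transfer_operator_def by blast

lemma dual_indicator:
  assumes "integrable M v" "A \<in> sets M"
  shows "(\<integral>x. L v x * indicator A x \<partial>M) = (\<integral>x. v x * indicator A (f x) \<partial>M)"
  using assms by (intro dual[where K = 1]) (auto simp: indicator_def)

lemma integral_L: "integrable M v \<Longrightarrow> (\<integral>x. L v x \<partial>M) = (\<integral>x. v x \<partial>M)"
  using dual[of v "\<lambda>_. 1" 1] by simp

lemma integrable_mult_comp_indicator:
  "integrable M v \<Longrightarrow> A \<in> sets M \<Longrightarrow> integrable M (\<lambda>x. v x * indicator A (f x))" for v :: "'a \<Rightarrow> real"
proof (rule Bochner_Integration.integrable_bound)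
  assume [measurable]: "integrable M v" "A \<in> sets M"
  show "(\<lambda>x. v x * indicator A (f x)) \<in> borel_measurable M" by measurable
qed (auto simp: indicator_def)

lemma L_mono:
  assumes "integrable M u" "integrable M v" "AE x in M. u x \<le> v x"
  shows "AE x in M. L u x \<le> L v x"
proof (intro AE_le_of_integrals integrable_L assms(1,2))
  fix A assume A: "A \<in> sets M"
  have "(\<integral>x. u x * indicator A (f x) \<partial>M) \<le> (\<integral>x. v x * indicator A (f x) \<partial>M)"
  proof (intro integral_mono_AE integrable_mult_comp_indicator assms(1,2) A)
    show "AE x in M. u x * indicator A (f x) \<le> v x * indicator A (f x)"
      using assms(3) by eventually_elim (simp add: indicator_def)
  qed
  thus "(\<integral>x. L u x * indicator A x \<partial>M) \<le> (\<integral>x. L v x * indicator A x \<partial>M)"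
    using assms A by (simp add: dual_indicator)
qed

lemma L_linear:
  assumes u: "integrable M u" and v: "integrable M v"
  shows "AE x in M. L (\<lambda>x. a * u x + b * v x) x = a * L u x + b * L v x"
proof (rule AE_eq_of_integrals)
  show i: "integrable M (L (\<lambda>x. a * u x + b * v x))" "integrable M (\<lambda>x. a * L u x + b * L v x)"
    using u v by (auto intro!: integrable_L)
  fix A assume A: "A \<in> sets M"
  have iL: "integrable M (\<lambda>x. L u x * indicator A x)" "integrable M (\<lambda>x. L v x * indicator A x)"
    using u v A by (auto intro!: integrable_real_mult_indicator integrable_L)
  have "(\<integral>x. L (\<lambda>x. a * u x + b * v x) x * indicator A x \<partial>M) = (\<integral>x. a * (u x * indicator A (f x)) + b * (v x * indicator A (f x)) \<partial>M)"
    using u v A by (subst dual_indicator) (auto simp: algebra_simps)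
  also have "\<dots> = a * (\<integral>x. u x * indicator A (f x) \<partial>M) + b * (\<integral>x. v x * indicator A (f x) \<partial>M)"
    using integrable_mult_comp_indicator[OF u A] integrable_mult_comp_indicator[OF v A] by simp
  also have "\<dots> = a * (\<integral>x. L u x * indicator A x \<partial>M) + b * (\<integral>x. L v x * indicator A x \<partial>M)"
    using u v A by (simp add: dual_indicator)
  also have "\<dots> = (\<integral>x. a * (L u x * indicator A x) + b * (L v x * indicator A x) \<partial>M)"
    using iL by simp
  finally show "(\<integral>x. L (\<lambda>x. a * u x + b * v x) x * indicator A x \<partial>M) = (\<integral>x. (a * L u x + b * L v x) * indicator A x \<partial>M)"
    by (simp add: algebra_simps)
qed

lemma L_add: "integrable M u \<Longrightarrow> integrable M v \<Longrightarrow> AE x in M. L (\<lambda>x. u x + v x) x = L u x + L v x"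
  using L_linear[of u v 1 1] by simp

lemma L_scale: "integrable M u \<Longrightarrow> AE x in M. L (\<lambda>x. a * u x) x = a * L u x"
  using L_linear[of u u a 0] by simp

lemma L_zero: "AE x in M. L (\<lambda>_. 0) x = 0"
  using L_linear[of "\<lambda>_. 0" "\<lambda>_. 0" 0 0] by simp

lemma L_nonneg:
  assumes "integrable M v" "AE x in M. 0 \<le> v x" shows "AE x in M. 0 \<le> L v x"
proof -
  have "AE x in M. L (\<lambda>_. 0) x \<le> L v x" using assms by (intro L_mono) auto
  thus ?thesis using L_zero by eventually_elim simp
qed

lemma L_abs: "integrable M v \<Longrightarrow> AE x in M. \<bar>L v x\<bar> \<le> L (\<lambda>x. \<bar>v x\<bar>) x"
proof -
  assume v: "integrable M v"
  have "AE x in M. L v x \<le> L (\<lambda>x. \<bar>v x\<bar>) x" "AE x in M. L (\<lambda>x. (-1) * v x) x \<le> L (\<lambda>x. \<bar>v x\<bar>) x"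
    using v by (auto intro!: L_mono)
  thus ?thesis using L_scale[OF v, of "-1"] by eventually_elim auto
qed

text \<open>A measure preserving map has \<open>L 1 = 1\<close>. The constant \<open>1\<close> need not be
  integrable, so the bound is tested on the set where \<open>L u\<close> exceeds \<open>K\<close>,
  which has finite measure because \<open>L u\<close> is integrable.\<close>

lemma L_le_const:
  assumes u: "integrable M u" and K: "K > 0" and le: "AE x in M. u x \<le> K"
  shows "AE x in M. L u x \<le> K"
proof -
  have Lu: "integrable M (L u)" using u by (rule integrable_L)
  define A where "A = {x \<in> space M. L u x > K}"
  have A [measurable]: "A \<in> sets M" unfolding A_def using Lu by measurable
  have iA: "integrable M (indicator A :: 'a \<Rightarrow> real)"
  proof (rule Bochner_Integration.integrable_bound)
    show "integrable M (\<lambda>x. L u x / K)" using Lu by simp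
    show "AE x in M. norm (indicator A x :: real) \<le> norm (L u x / K)"
      using K by (intro AE_I2) (auto simp: A_def indicator_def)
  qed auto
  have "(\<integral>x. L u x * indicator A x \<partial>M) = (\<integral>x. u x * indicator A (f x) \<partial>M)"
    by (rule dual_indicator[OF u A])
  also have "\<dots> \<le> (\<integral>x. K * indicator A (f x) \<partial>M)"
  proof (rule integral_mono_AE)
    show "integrable M (\<lambda>x. u x * indicator A (f x))" by (rule integrable_mult_comp_indicator[OF u A])
    show "integrable M (\<lambda>x. K * indicator A (f x))"
      by (rule integrable_mult_right[OF integrable_comp[OF iA]])
    show "AE x in M. u x * indicator A (f x) \<le> K * indicator A (f x)"
      using le by eventually_elim (simp add: indicator_def)
  qed
  also have "\<dots> = (\<integral>x. K * indicator A x \<partial>M)" by (rule integral_comp) auto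
  finally have "(\<integral>x. L u x * indicator A x - K * indicator A x \<partial>M) \<le> 0"
    using integrable_real_mult_indicator[OF A Lu] iA by simp
  moreover have nn: "AE x in M. 0 \<le> L u x * indicator A x - K * indicator A x"
    by (auto simp: A_def indicator_def)
  moreover have i: "integrable M (\<lambda>x. L u x * indicator A x - K * indicator A x)"
    using integrable_real_mult_indicator[OF A Lu] iA by simp
  ultimately have "(\<integral>x. L u x * indicator A x - K * indicator A x \<partial>M) = 0"
    using integral_nonneg_AE[OF nn] by linarith
  hence "AE x in M. L u x * indicator A x - K * indicator A x = 0"
    using integral_nonneg_eq_0_iff_AE[OF i nn] by simp
  thus ?thesis using AE_space by eventually_elim (auto simp: A_def indicator_def split: if_splits)
qed

lemma L_abs_le_const:
  assumes u: "integrable M u" and K: "K > 0" and le: "AE x in M. \<bar>u x\<bar> \<le> K"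
  shows "AE x in M. \<bar>L u x\<bar> \<le> K"
proof -
  have "AE x in M. L (\<lambda>x. \<bar>u x\<bar>) x \<le> K" using u by (intro L_le_const K le) auto
  with L_abs[OF u] show ?thesis by eventually_elim linarith
qed

text \<open>This makes every statement about \<open>L\<close> available for \<open>L\<^sup>n\<close>.\<close>

lemma transfer_funpow: "transfer M (f ^^ n) (L ^^ n)"
proof (induction n)
  case 0
  have "distr M M id = M" using distr_id[of M] by (simp add: id_def)
  thus ?case by unfold_locales (auto simp: measure_preserving_map_def transfer_operator_def)
next
  case (Suc n)
  interpret T: transfer M "f ^^ n" "L ^^ n" by fact
  show ?case
  proof
    show "measure_preserving_map M (f ^^ Suc n)"
      using distr_distr[OF f_meas T.f_meas] by (simp add: measure_preserving_map_def measurable_comp distr_f T.distr_f o_def)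
    show "transfer_operator M (f ^^ Suc n) (L ^^ Suc n)"
      unfolding transfer_operator_def
    proof (intro allI impI conjI)
      fix v :: "'a \<Rightarrow> real" and w :: "'a \<Rightarrow> real" assume v: "integrable M v"
      show "integrable M ((L ^^ Suc n) v)" using v by (simp add: integrable_L T.integrable_L)
      assume "w \<in> borel_measurable M \<and> (\<exists>K. \<forall>x\<in>space M. \<bar>w x\<bar> \<le> K)"
      then obtain K where w [measurable]: "w \<in> borel_measurable M" and K: "\<And>x. x \<in> space M \<Longrightarrow> \<bar>w x\<bar> \<le> K" by blast
      have "(\<integral>x. L ((L ^^ n) v) x * w x \<partial>M) = (\<integral>x. (L ^^ n) v x * w (f x) \<partial>M)"
        by (rule dual[OF T.integrable_L[OF v] w K])
      also have "\<dots> = (\<integral>x. v x * w (f ((f ^^ n) x)) \<partial>M)"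
        by (rule T.dual[OF v, where K = K]) (auto intro: K f_space)
      finally show "(\<integral>x. (L ^^ Suc n) v x * w x \<partial>M) = (\<integral>x. v x * w ((f ^^ Suc n) x) \<partial>M)" by simp
    qed
  qed
qed

text \<open>The sums include the term \<open>j = 0\<close> and exclude \<open>j = n\<close>; sums over
  \<open>1, \<dots>, n\<close> are those of \<open>L v\<close>.\<close>

definition S :: "nat \<Rightarrow> ('a \<Rightarrow> real) \<Rightarrow> 'a \<Rightarrow> real" where
  "S n v x = (\<Sum>j<n. (L ^^ j) v x)"

lemma integrable_Lpow: "integrable M v \<Longrightarrow> integrable M ((L ^^ n) v)"
  using transfer.integrable_L[OF transfer_funpow] .

lemma integrable_S: "integrable M v \<Longrightarrow> integrable M (S n v)"
  unfolding S_def[abs_def] by (intro Bochner_Integration.integrable_sum integrable_Lpow)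

lemma S_0 [simp]: "S 0 v x = 0" by (simp add: S_def)

lemma S_linear:
  assumes "integrable M u" "integrable M v"
  shows "AE x in M. \<forall>n. S n (\<lambda>x. a * u x + b * v x) x = a * S n u x + b * S n v x"
proof -
  have "AE x in M. \<forall>j. (L ^^ j) (\<lambda>x. a * u x + b * v x) x = a * (L ^^ j) u x + b * (L ^^ j) v x"
    unfolding AE_all_countable by (intro allI transfer.L_linear[OF transfer_funpow] assms)
  thus ?thesis
    by eventually_elim (simp add: S_def sum.distrib sum_distrib_left)
qed

lemma S_mono:
  assumes "integrable M u" "integrable M v" "AE x in M. u x \<le> v x"
  shows "AE x in M. \<forall>n. S n u x \<le> S n v x"
proof -
  have "AE x in M. \<forall>j. (L ^^ j) u x \<le> (L ^^ j) v x"
    unfolding AE_all_countable by (intro allI transfer.L_mono[OF transfer_funpow] assms)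
  thus ?thesis by eventually_elim (auto simp: S_def intro: sum_mono)
qed

lemma S_abs:
  assumes "integrable M v"
  shows "AE x in M. \<forall>n. \<bar>S n v x\<bar> \<le> S n (\<lambda>x. \<bar>v x\<bar>) x"
proof -
  have "AE x in M. \<forall>j. \<bar>(L ^^ j) v x\<bar> \<le> (L ^^ j) (\<lambda>x. \<bar>v x\<bar>) x"
    unfolding AE_all_countable by (intro allI transfer.L_abs[OF transfer_funpow] assms)
  thus ?thesis by eventually_elim (auto simp: S_def intro!: order.trans[OF sum_abs] sum_mono)
qed

lemma L_S:
  assumes "integrable M v"
  shows "AE x in M. \<forall>n. S (Suc n) v x = v x + L (S n v) x"
  unfolding AE_all_countable
proof
  fix n
  show "AE x in M. S (Suc n) v x = v x + L (S n v) x"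
  proof (induction n)
    case 0
    show ?case using L_zero by (simp add: S_def)
  next
    case (Suc n)
    have "S (Suc n) v = (\<lambda>x. S n v x + (L ^^ n) v x)" by (auto simp: S_def)
    hence add: "AE x in M. L (S (Suc n) v) x = L (S n v) x + L ((L ^^ n) v) x"
      using L_add[OF integrable_S integrable_Lpow] assms by simp
    have step: "S (Suc (Suc n)) v x = S (Suc n) v x + L ((L ^^ n) v) x" for x by (simp add: S_def)
    from add Suc show ?case by eventually_elim (simp add: step)
  qed
qed

end

section \<open>The maximal inequality\<close>

primrec running_max :: "(nat \<Rightarrow> 'a \<Rightarrow> real) \<Rightarrow> nat \<Rightarrow> 'a \<Rightarrow> real" where
  "running_max s 0 = s 0"
| "running_max s (Suc n) = (\<lambda>x. max (running_max s n x) (s (Suc n) x))"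

lemma running_max_upper: "k \<le> n \<Longrightarrow> s k x \<le> running_max s n x"
  by (induction n) (auto simp: le_Suc_eq)

lemma running_max_attained: "\<exists>k\<le>n. running_max s n x = s k x"
proof (induction n)
  case (Suc n)
  then obtain k where "k \<le> n" "running_max s n x = s k x" by blast
  thus ?case by (cases "running_max s n x \<le> s (Suc n) x") (auto simp: max_def intro: exI[of _ k])
qed simp

lemma running_max_mono: "m \<le> n \<Longrightarrow> running_max s m x \<le> running_max s n x"
  by (induction n) (auto simp: le_Suc_eq)

lemma integrable_running_max:
  "(\<And>k. integrable M (s k)) \<Longrightarrow> integrable M (running_max s n)"
  by (induction n) auto

context transfer
begin

text \<open>Hopf's lemma: where the maximum \<open>m\<close> of the sums is positive it is at most \<open>v
  + L m\<close>, and \<open>L\<close> preserves integrals.\<close>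

lemma hopf_maximal:
  assumes v: "integrable M v"
  shows "0 \<le> (\<integral>x. v x * indicator {x \<in> space M. 0 < running_max (\<lambda>k. S k v) n x} x \<partial>M)"
proof -
  define m where "m = running_max (\<lambda>k. S k v) n"
  have m: "integrable M m" unfolding m_def by (intro integrable_running_max integrable_S v)
  hence [measurable]: "m \<in> borel_measurable M" by auto
  define E where "E = {x \<in> space M. m x > 0}"
  have E [measurable]: "E \<in> sets M" unfolding E_def by measurable
  have m0: "m x \<ge> 0" for x using running_max_upper[of 0 n "\<lambda>k. S k v" x] by (simp add: m_def)
  have Lm: "integrable M (L m)" using m by (rule integrable_L)
  have Lm0: "AE x in M. 0 \<le> L m x" using m m0 by (intro L_nonneg) auto
  have "AE x in M. \<forall>k. k \<le> n \<longrightarrow> L (S k v) x \<le> L m x"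
    unfolding AE_all_countable
  proof (intro allI)
    fix k
    show "AE x in M. k \<le> n \<longrightarrow> L (S k v) x \<le> L m x"
    proof (cases "k \<le> n")
      case True
      have "AE x in M. L (S k v) x \<le> L m x"
        by (intro L_mono m integrable_S v AE_I2) (simp add: m_def True running_max_upper[of k n "\<lambda>k. S k v"])
      thus ?thesis by simp
    qed simp
  qed
  with L_S[OF v] Lm0 AE_space have "AE x in M. m x \<le> v x * indicator E x + L m x"
  proof eventually_elim
    case (elim x)
    show ?case
    proof (cases "m x > 0")
      case True
      obtain k where k: "k \<le> n" "m x = S k v x"
        using running_max_attained[of n "\<lambda>k. S k v" x] by (auto simp: m_def)
      with True obtain j where j: "k = Suc j" by (cases k) auto
      have "m x = v x + L (S j v) x" using elim k j by simp
      moreover have "L (S j v) x \<le> L m x" using elim k j by simp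
      ultimately show ?thesis using True elim by (simp add: E_def)
    next
      case False
      hence "m x = 0" using m0[of x] by simp
      thus ?thesis using elim by (simp add: E_def)
    qed
  qed
  hence "(\<integral>x. m x \<partial>M) \<le> (\<integral>x. v x * indicator E x + L m x \<partial>M)"
    using integrable_real_mult_indicator[OF E v] Lm by (intro integral_mono_AE m) auto
  also have "\<dots> = (\<integral>x. v x * indicator E x \<partial>M) + (\<integral>x. m x \<partial>M)"
    using integrable_real_mult_indicator[OF E v] Lm integral_L[OF m] by simp
  finally show ?thesis by (simp add: E_def m_def)
qed

text \<open>Hopf's lemma for \<open>v - c 1\<^sub>A\<close>. Comparing with sums of an indicator, rather
  than with \<open>n\<close>, is what an infinite measure requires.\<close>

lemma maximal_inequality:
  assumes v: "integrable M v" and A: "A \<in> sets M" "emeasure M A < \<infinity>" and c: "c > 0"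
  shows "c * measure M {x \<in> A. \<exists>n. S n v x > c * S n (indicator A) x} \<le> (\<integral>x. \<bar>v x\<bar> \<partial>M)"
proof -
  have iA: "integrable M (indicator A :: 'a \<Rightarrow> real)" using A by simp
  define u where "u x = 1 * v x + (-c) * indicator A x" for x
  have u: "integrable M u" unfolding u_def[abs_def] using v iA by simp
  define E where "E n = {x \<in> space M. running_max (\<lambda>k. S k u) n x > 0}" for n
  have [measurable]: "running_max (\<lambda>k. S k u) n \<in> borel_measurable M" for n
    using integrable_running_max[of M "\<lambda>k. S k u" n] integrable_S[OF u] by auto
  have E [measurable]: "E n \<in> sets M" for n unfolding E_def by measurable
  have [measurable]: "A \<in> sets M" by fact
  have bound: "c * measure M (A \<inter> E n) \<le> (\<integral>x. \<bar>v x\<bar> \<partial>M)" for n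
  proof -
    have iAE: "integrable M (indicator (A \<inter> E n) :: 'a \<Rightarrow> real)"
      by (rule Bochner_Integration.integrable_bound[OF iA]) (auto simp: indicator_def)
    have "0 \<le> (\<integral>x. u x * indicator (E n) x \<partial>M)" using hopf_maximal[OF u] by (simp add: E_def)
    also have "\<dots> = (\<integral>x. v x * indicator (E n) x - c * indicator (A \<inter> E n) x \<partial>M)"
      by (intro Bochner_Integration.integral_cong) (auto simp: u_def indicator_def)
    also have "\<dots> = (\<integral>x. v x * indicator (E n) x \<partial>M) - c * measure M (A \<inter> E n)"
      using integrable_real_mult_indicator[OF E v] iAE by (simp add: Int_commute)
    finally have "c * measure M (A \<inter> E n) \<le> (\<integral>x. v x * indicator (E n) x \<partial>M)" by simp
    also have "\<dots> \<le> (\<integral>x. \<bar>v x\<bar> \<partial>M)"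
      using integrable_real_mult_indicator[OF E v] v by (intro integral_mono) (auto simp: indicator_def)
    finally show ?thesis .
  qed
  have "(\<lambda>n. measure M (A \<inter> E n)) \<longlonglongrightarrow> measure M (\<Union>n. A \<inter> E n)"
  proof (rule Lim_measure_incseq)
    show "incseq (\<lambda>n. A \<inter> E n)"
      by (auto simp: incseq_def E_def intro: less_le_trans running_max_mono)
    have "emeasure M (\<Union>n. A \<inter> E n) \<le> emeasure M A" by (intro emeasure_mono) auto
    thus "emeasure M (\<Union>n. A \<inter> E n) \<noteq> \<infinity>" using A(2) by (auto simp: top_unique)
  qed auto
  hence "(\<lambda>n. c * measure M (A \<inter> E n)) \<longlonglongrightarrow> c * measure M (\<Union>n. A \<inter> E n)" by (intro tendsto_intros)
  hence lim: "c * measure M (\<Union>n. A \<inter> E n) \<le> (\<integral>x. \<bar>v x\<bar> \<partial>M)"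
    by (rule LIMSEQ_le_const2) (use bound in auto)
  have [measurable]: "S n v \<in> borel_measurable M" "S n (indicator A) \<in> borel_measurable M" for n
    using integrable_S[OF v] integrable_S[OF iA] by auto
  have eq: "{x \<in> A. \<exists>n. S n v x > c * S n (indicator A) x} = {x \<in> space M. x \<in> A \<and> (\<exists>n. S n v x > c * S n (indicator A) x)}"
    using sets.sets_into_space[OF A(1)] by auto
  have "measure M {x \<in> A. \<exists>n. S n v x > c * S n (indicator A) x} = measure M (\<Union>n. A \<inter> E n)"
  proof (rule measure_eq_AE)
    have "AE x in M. \<forall>n. S n u x = 1 * S n v x + (-c) * S n (indicator A) x"
      unfolding u_def[abs_def] by (rule S_linear[OF v iA])
    thus "AE x in M. (x \<in> {x \<in> A. \<exists>n. S n v x > c * S n (indicator A) x}) = (x \<in> (\<Union>n. A \<inter> E n))"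
      using AE_space
    proof eventually_elim
      case (elim x)
      have "(\<exists>n. S n v x > c * S n (indicator A) x) \<longleftrightarrow> (\<exists>n. S n u x > 0)" using elim by simp
      also have "\<dots> \<longleftrightarrow> (\<exists>n. running_max (\<lambda>k. S k u) n x > 0)"
      proof
        assume "\<exists>n. S n u x > 0"
        then obtain n where "S n u x > 0" by blast
        thus "\<exists>n. running_max (\<lambda>k. S k u) n x > 0"
          using running_max_upper[of n n "\<lambda>k. S k u" x] by (intro exI[of _ n]) simp
      next
        assume "\<exists>n. running_max (\<lambda>k. S k u) n x > 0"
        then obtain n where "running_max (\<lambda>k. S k u) n x > 0" by blast
        thus "\<exists>n. S n u x > 0" using running_max_attained[of n "\<lambda>k. S k u" x] by auto
      qed
      finally show ?case using elim by (auto simp: E_def)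
    qed
    show "{x \<in> A. \<exists>n. S n v x > c * S n (indicator A) x} \<in> sets M" unfolding eq by measurable
  qed auto
  with lim show ?thesis by simp
qed

end

section \<open>Averages of functions with zero integral\<close>

text \<open>A substitute for weak compactness. Elements of almost minimal \<open>L\<^sup>2\<close> norm in
  the decreasing sets \<open>C n\<close> form a Cauchy sequence by the parallelogram law; if they
  approach the minimum fast enough, they converge almost everywhere.\<close>

lemma (in finite_measure) convex_sets_AE_convergent:
  fixes C :: "nat \<Rightarrow> ('a \<Rightarrow> real) set"
  assumes meas: "\<And>n p. p \<in> C n \<Longrightarrow> p \<in> borel_measurable M"
    and bdd: "\<And>n p x. p \<in> C n \<Longrightarrow> x \<in> space M \<Longrightarrow> \<bar>p x\<bar> \<le> 1"
    and mid: "\<And>n p q. p \<in> C n \<Longrightarrow> q \<in> C n \<Longrightarrow> (\<lambda>x. (p x + q x) / 2) \<in> C n"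
    and dec: "\<And>n. C (Suc n) \<subseteq> C n" and ne: "\<And>n. C n \<noteq> {}"
  obtains p m where "\<And>i. p i \<in> C (m i)" "\<And>i::nat. i \<le> m i" "AE x in M. convergent (\<lambda>i. p i x)"
proof -
  define I where "I p = (\<integral>x. (p x)\<^sup>2 \<partial>M)" for p :: "'a \<Rightarrow> real"
  have int: "integrable M p" "integrable M (\<lambda>x. (p x)\<^sup>2)" if "p \<in> C n" for p n
  proof -
    have [measurable]: "p \<in> borel_measurable M" using meas that .
    show "integrable M p" using bdd[OF that] by (intro integrable_const_bound[of _ 1]) auto
    show "integrable M (\<lambda>x. (p x)\<^sup>2)"
    proof (rule integrable_const_bound[of _ 1])
      show "AE x in M. norm ((p x)\<^sup>2) \<le> 1"
        using bdd[OF that] by (intro AE_I2) (simp add: abs_square_le_1)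
    qed measurable
  qed
  have int2: "integrable M (\<lambda>x. p x * q x)" if "p \<in> C n" "q \<in> C n" for p q n
  proof (rule integrable_const_bound[of _ 1])
    have [measurable]: "p \<in> borel_measurable M" "q \<in> borel_measurable M" using meas that by auto
    show "(\<lambda>x. p x * q x) \<in> borel_measurable M" by measurable
    show "AE x in M. norm (p x * q x) \<le> 1"
      using bdd[OF that(1)] bdd[OF that(2)] by (intro AE_I2) (simp add: abs_mult mult_le_one)
  qed
  define d where "d n = Inf (I ` C n)" for n
  have bb: "bdd_below (I ` C n)" for n by (rule bdd_belowI[of _ 0]) (auto simp: I_def)
  have dI: "d n \<le> I p" if "p \<in> C n" for n p
    unfolding d_def using that by (intro cInf_lower bb) auto
  have IK: "I p \<le> measure M (space M)" if "p \<in> C n" for p n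
  proof -
    have "I p \<le> (\<integral>x. 1 \<partial>M)"
      unfolding I_def using bdd[OF that] by (intro integral_mono int(2)[OF that]) (auto simp: abs_square_le_1)
    thus ?thesis by simp
  qed
  have Cmono: "C n' \<subseteq> C n" if "n \<le> n'" for n n'
    using lift_Suc_antimono_le[of C n n'] dec that by blast
  have "incseq d"
    unfolding incseq_Suc_iff d_def using ne dec by (intro allI cInf_superset_mono bb image_mono) auto
  moreover have "\<forall>n. d n \<le> measure M (space M)"
  proof
    fix n obtain p where "p \<in> C n" using ne by blast
    from dI[OF this] IK[OF this] show "d n \<le> measure M (space M)" by linarith
  qed
  ultimately obtain D where D: "d \<longlonglongrightarrow> D" "\<forall>n. d n \<le> D" by (rule incseq_convergent)
  have "\<forall>i. \<exists>N. \<forall>n\<ge>N. d n > D - (1/8) ^ i"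
  proof
    fix i :: nat
    have "\<forall>\<^sub>F n in sequentially. d n > D - (1/8) ^ i" by (rule order_tendstoD(1)[OF D(1)]) simp
    thus "\<exists>N. \<forall>n\<ge>N. d n > D - (1/8) ^ i" by (simp add: eventually_sequentially)
  qed
  then obtain N where N: "\<And>i n. n \<ge> N i \<Longrightarrow> d n > D - (1/8) ^ i" by metis
  define m where "m i = i + (\<Sum>j\<le>i. N j)" for i
  have mN: "m i \<ge> N i" for i
    using member_le_sum[of i "{..i}" N] by (simp add: m_def)
  have mS: "m i \<le> m (Suc i)" for i by (simp add: m_def)
  have "\<forall>i. \<exists>p. p \<in> C (m i) \<and> I p < d (m i) + (1/8) ^ i"
  proof
    fix i
    have "Inf (I ` C (m i)) < d (m i) + (1/8) ^ i" by (simp add: d_def)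
    from cInf_lessD[OF _ this] ne[of "m i"] show "\<exists>p. p \<in> C (m i) \<and> I p < d (m i) + (1/8) ^ i" by auto
  qed
  then obtain p where p: "\<And>i. p i \<in> C (m i)" "\<And>i. I (p i) < d (m i) + (1/8) ^ i" by metis
  have [measurable]: "p i \<in> borel_measurable M" for i using meas p(1) .
  have Ip: "I (p i) \<le> D + (1/8) ^ i" for i using p(2)[of i] D(2) by (meson add_mono less_imp_le order.trans order_refl)
  define K where "K = measure M (space M)"
  have L1: "(\<integral>x. \<bar>p (Suc i) x - p i x\<bar> \<partial>M) \<le> (8 + K) * (1/2) ^ i"
    and iL1: "integrable M (\<lambda>x. \<bar>p (Suc i) x - p i x\<bar>)" for i
  proof -
    have pi: "p i \<in> C (m i)" "p (Suc i) \<in> C (m i)" using p(1) Cmono[OF mS] by blast+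
    note i1 = int[OF pi(1)] and i2 = int[OF pi(2)] and i12 = int2[OF pi]
    show iL1: "integrable M (\<lambda>x. \<bar>p (Suc i) x - p i x\<bar>)" using i1 i2 by auto
    define q where "q x = (p i x + p (Suc i) x) / 2" for x
    have q: "q \<in> C (m i)" unfolding q_def[abs_def] by (rule mid[OF pi])
    have "I q > D - (1/8) ^ i" using dI[OF q] N[OF mN[of i]] by linarith
    moreover have "I (p i) \<le> D + (1/8) ^ i" by (rule Ip)
    moreover have "I (p (Suc i)) \<le> D + (1/8) ^ i"
      using Ip[of "Suc i"] by (simp add: field_simps)
    moreover have "I q = (I (p i) + I (p (Suc i)) + 2 * (\<integral>x. p i x * p (Suc i) x \<partial>M)) / 4"
    proof -
      have "I q = (\<integral>x. ((p i x)\<^sup>2 + (p (Suc i) x)\<^sup>2 + 2 * (p i x * p (Suc i) x)) / 4 \<partial>M)"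
        unfolding I_def q_def by (intro Bochner_Integration.integral_cong) (auto simp: power2_eq_square field_simps)
      thus ?thesis using i1 i2 i12 by (simp add: I_def)
    qed
    moreover have sq: "(\<integral>x. (p (Suc i) x - p i x)\<^sup>2 \<partial>M) = I (p i) + I (p (Suc i)) - 2 * (\<integral>x. p i x * p (Suc i) x \<partial>M)"
    proof -
      have "(\<integral>x. (p (Suc i) x - p i x)\<^sup>2 \<partial>M) = (\<integral>x. (p i x)\<^sup>2 + (p (Suc i) x)\<^sup>2 - 2 * (p i x * p (Suc i) x) \<partial>M)"
        by (intro Bochner_Integration.integral_cong) (auto simp: power2_eq_square field_simps)
      thus ?thesis using i1 i2 i12 by (simp add: I_def)
    qed
    \<comment> \<open>The midpoint \<open>q\<close> lies in \<open>C (m i)\<close> as well, so its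
      norm is almost minimal too.\<close>
    ultimately have dsq: "(\<integral>x. (p (Suc i) x - p i x)\<^sup>2 \<partial>M) \<le> 8 * (1/8) ^ i" by argo
    have isq: "integrable M (\<lambda>x. (p (Suc i) x - p i x)\<^sup>2)"
      using i1 i2 i12 by (simp add: power2_diff mult.commute mult.left_commute)
    have "(\<integral>x. \<bar>p (Suc i) x - p i x\<bar> \<partial>M) \<le> (\<integral>x. 2 ^ i * (p (Suc i) x - p i x)\<^sup>2 + (1/2) ^ i \<partial>M)"
    proof (rule integral_mono[OF iL1])
      \<comment> \<open>From \<open>y \<le> 2\<^sup>i y\<^sup>2 + 2\<^sup>-\<^sup>i\<close> for
        \<open>y \<ge> 0\<close>, to pass from \<open>L\<^sup>2\<close> to
        \<open>L\<^sup>1\<close>.\<close>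
      show "integrable M (\<lambda>x. 2 ^ i * (p (Suc i) x - p i x)\<^sup>2 + (1/2) ^ i)" using isq by simp
      fix x
      define y where "y = \<bar>p (Suc i) x - p i x\<bar>"
      have "y \<le> 2 ^ i * y\<^sup>2 + (1/2) ^ i"
      proof (cases "y \<le> (1/2) ^ i")
        case False
        have "y = 2 ^ i * (1/2) ^ i * y" by (simp add: power_mult_distrib[symmetric])
        also have "\<dots> \<le> 2 ^ i * y * y" using False by (intro mult_right_mono mult_left_mono) (auto simp: y_def)
        finally show ?thesis by (simp add: power2_eq_square mult.assoc add_increasing2)
      qed (simp add: add_increasing)
      thus "\<bar>p (Suc i) x - p i x\<bar> \<le> 2 ^ i * (p (Suc i) x - p i x)\<^sup>2 + (1/2) ^ i"
        by (simp add: y_def)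
    qed
    also have "\<dots> = 2 ^ i * (\<integral>x. (p (Suc i) x - p i x)\<^sup>2 \<partial>M) + (1/2) ^ i * K"
      using isq by (simp add: K_def)
    also have "\<dots> \<le> 2 ^ i * (8 * (1/8) ^ i) + (1/2) ^ i * K"
      using dsq by (intro add_mono mult_left_mono) auto
    also have "2 ^ i * (8 * (1/8) ^ i) = 8 * (1/4::real) ^ i"
      by (simp add: power_mult_distrib[symmetric] mult.left_commute)
    also have "\<dots> \<le> 8 * (1/2) ^ i" by (intro mult_left_mono power_mono) auto
    finally show "(\<integral>x. \<bar>p (Suc i) x - p i x\<bar> \<partial>M) \<le> (8 + K) * (1/2) ^ i" by (simp add: algebra_simps)
  qed
  have K0: "K \<ge> 0" by (simp add: K_def)
  have "(\<integral>\<^sup>+x. (\<Sum>i. ennreal \<bar>p (Suc i) x - p i x\<bar>) \<partial>M) = (\<Sum>i. (\<integral>\<^sup>+x. ennreal \<bar>p (Suc i) x - p i x\<bar> \<partial>M))"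
    by (intro nn_integral_suminf) measurable
  also have "\<dots> = (\<Sum>i. ennreal (\<integral>x. \<bar>p (Suc i) x - p i x\<bar> \<partial>M))"
    by (intro suminf_cong nn_integral_eq_integral iL1) simp
  also have "\<dots> \<le> (\<Sum>i. ennreal ((8 + K) * (1/2) ^ i))"
    by (intro suminf_le ennreal_leI L1) auto
  also have "\<dots> = ennreal (\<Sum>i. (8 + K) * (1/2) ^ i)"
    using K0 by (intro suminf_ennreal2 summable_mult summable_geometric) auto
  finally have "(\<integral>\<^sup>+x. (\<Sum>i. ennreal \<bar>p (Suc i) x - p i x\<bar>) \<partial>M) \<noteq> \<infinity>"
    by (auto simp: top_unique)
  hence "AE x in M. (\<Sum>i. ennreal \<bar>p (Suc i) x - p i x\<bar>) \<noteq> \<infinity>"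
    by (intro nn_integral_PInf_AE) auto
  hence "AE x in M. convergent (\<lambda>i. p i x)"
  proof eventually_elim
    case (elim x)
    have "summable (\<lambda>i. \<bar>p (Suc i) x - p i x\<bar>)"
      using elim by (intro summable_suminf_not_top) auto
    hence "summable (\<lambda>i. p (Suc i) x - p i x)" by (rule summable_rabs_cancel)
    hence "convergent (\<lambda>n. p n x - p 0 x)"
      by (simp add: summable_iff_convergent sum_lessThan_telescope[of "\<lambda>i. p i x"])
    from convergent_add[OF this convergent_const[of "p 0 x"]] show ?case by simp
  qed
  with p(1) show ?thesis by (intro that[of p m]) (auto simp: m_def)
qed

context transfer
begin

text \<open>The constant is the infimum of all \<open>q\<close> for which \<open>w > q\<close> holds only on
  a null set.\<close>

lemma ergodic_AE_const:
  assumes erg: "ergodic_map M f" and ne: "emeasure M (space M) \<noteq> 0"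
    and w [measurable]: "w \<in> borel_measurable M"
    and inv: "\<And>x. x \<in> space M \<Longrightarrow> w (f x) = w x" and bd: "AE x in M. \<bar>w x\<bar> \<le> (K::real)"
  obtains c where "AE x in M. w x = c"
proof -
  define E where "E q = {x \<in> space M. w x > q}" for q
  have E [measurable]: "E q \<in> sets M" for q unfolding E_def by measurable
  have erg': "emeasure M (E q) = 0 \<or> emeasure M (space M - E q) = 0" for q
  proof -
    have "f -` E q \<inter> space M = E q" using inv f_space by (auto simp: E_def)
    thus ?thesis using erg E[of q] unfolding ergodic_map_def by blast
  qed
  have notAE: "\<not> (AE x in M. False)" using ne by (subst AE_iff_measurable[of "space M"]) auto
  define Q where "Q = {q. emeasure M (E q) = 0}"
  have QAE: "AE x in M. w x \<le> q" if "q \<in> Q" for q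
  proof -
    have "AE x in M. x \<notin> E q" using that by (intro AE_not_in) (auto simp: Q_def null_sets_def)
    thus ?thesis using AE_space by eventually_elim (auto simp: E_def)
  qed
  have nQAE: "AE x in M. w x > q" if "q \<notin> Q" for q
  proof -
    have "emeasure M (space M - E q) = 0" using that erg'[of q] by (auto simp: Q_def)
    hence "AE x in M. x \<notin> space M - E q" by (intro AE_not_in) (auto simp: null_sets_def)
    thus ?thesis using AE_space by eventually_elim (auto simp: E_def)
  qed
  have lowQ: "- K \<le> q" if "q \<in> Q" for q
  proof (rule ccontr)
    assume "\<not> - K \<le> q"
    have "AE x in M. False" using QAE[OF that] bd by eventually_elim (use \<open>\<not> - K \<le> q\<close> in linarith)
    thus False using notAE by simp
  qed
  have bbQ: "bdd_below Q" by (rule bdd_belowI[of _ "-K"]) (rule lowQ)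
  have KQ: "K \<in> Q"
  proof (rule ccontr)
    assume "K \<notin> Q"
    have "AE x in M. False" using nQAE[OF \<open>K \<notin> Q\<close>] bd by eventually_elim linarith
    thus False using notAE by simp
  qed
  define c where "c = Inf Q"
  have "AE x in M. \<forall>n::nat. w x \<le> c + 1 / real (Suc n) \<and> w x > c - 1 / real (Suc n)"
    unfolding AE_all_countable
  proof
    fix n :: nat
    have "Inf Q < c + 1 / real (Suc n)" by (simp add: c_def)
    then obtain q where q: "q \<in> Q" "q < c + 1 / real (Suc n)"
      using cInf_lessD[of Q] KQ by blast
    have "c - 1 / real (Suc n) \<notin> Q"
    proof
      assume "c - 1 / real (Suc n) \<in> Q"
      from cInf_lower[OF this bbQ] show False by (simp add: c_def)
    qed
    from QAE[OF q(1)] nQAE[OF this] show "AE x in M. w x \<le> c + 1 / real (Suc n) \<and> w x > c - 1 / real (Suc n)"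
      by eventually_elim (use q(2) in auto)
  qed
  hence "AE x in M. w x = c"
  proof eventually_elim
    case (elim x)
    have l: "(\<lambda>n. c + 1 / real (Suc n)) \<longlonglongrightarrow> c" "(\<lambda>n. c - 1 / real (Suc n)) \<longlonglongrightarrow> c"
      using LIMSEQ_Suc[OF lim_1_over_n] tendsto_add[OF tendsto_const] tendsto_diff[OF tendsto_const] by fastforce+
    have "w x \<le> c" by (rule LIMSEQ_le_const[OF l(1)]) (use elim in auto)
    moreover have "c \<le> w x" by (rule LIMSEQ_le_const2[OF l(2)]) (use elim in \<open>auto intro: less_imp_le\<close>)
    ultimately show ?case by simp
  qed
  thus ?thesis by (rule that)
qed

lemma S_dual:
  assumes v: "integrable M v" and s [measurable]: "s \<in> borel_measurable M" and s1: "\<And>x. \<bar>s x\<bar> \<le> 1"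
  shows "(\<integral>x. S n v x * s x \<partial>M) = (\<integral>x. v x * (\<Sum>k<n. s ((f ^^ k) x)) \<partial>M)"
proof -
  have [measurable]: "f ^^ k \<in> measurable M M" for k using transfer.f_meas[OF transfer_funpow] .
  have i1: "integrable M (\<lambda>x. g x * h x)" if g: "integrable M g" and h: "h \<in> borel_measurable M" "\<And>x. \<bar>h x\<bar> \<le> 1" for g h :: "'a \<Rightarrow> real"
  proof (rule Bochner_Integration.integrable_bound[OF g])
    show "(\<lambda>x. g x * h x) \<in> borel_measurable M" using g h by measurable
    show "AE x in M. norm (g x * h x) \<le> norm (g x)" using h(2) by (auto simp: abs_mult intro!: mult_left_le)
  qed
  have "(\<integral>x. S n v x * s x \<partial>M) = (\<Sum>k<n. (\<integral>x. (L ^^ k) v x * s x \<partial>M))"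
    unfolding S_def sum_distrib_right
    by (intro Bochner_Integration.integral_sum i1 integrable_Lpow v s s1)
  also have "\<dots> = (\<Sum>k<n. (\<integral>x. v x * s ((f ^^ k) x) \<partial>M))"
    by (intro sum.cong transfer.dual[OF transfer_funpow v s, where K = 1] s1 refl)
  also have "\<dots> = (\<integral>x. v x * (\<Sum>k<n. s ((f ^^ k) x)) \<partial>M)"
    unfolding sum_distrib_left by (intro Bochner_Integration.integral_sum[symmetric] i1 v s1) measurable
  finally show ?thesis .
qed

text \<open>Suppose that the \<open>L\<^sup>1\<close> norms of the averages of \<open>v\<close> stay above
  \<open>\<delta>\<close>. Pairing with the signs of the averages gives functions \<open>p\<close>
  bounded by \<open>1\<close>, almost invariant, with \<open>\<integral>v p \<ge>
  \<delta>\<close>. These conditions define convex sets, so there is an almost everywhere limit of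
  such functions. It is invariant, hence constant, and contradicts \<open>\<integral>v =
  0\<close>.\<close>

lemma ergodic_cesaro_L1:
  assumes sf: "sigma_finite_measure M" and erg: "ergodic_map M f" and ne: "emeasure M (space M) \<noteq> 0"
    and v: "integrable M v" and v0: "(\<integral>x. v x \<partial>M) = 0" and \<delta>: "\<delta> > 0"
  shows "\<exists>n\<ge>1. (\<integral>x. \<bar>S n v x\<bar> \<partial>M) < \<delta> * real n"
proof (rule ccontr)
  assume "\<not> ?thesis"
  hence big: "\<And>n. n \<ge> 1 \<Longrightarrow> (\<integral>x. \<bar>S n v x\<bar> \<partial>M) \<ge> \<delta> * real n" by (auto simp: not_less)
  have [measurable]: "v \<in> borel_measurable M" using v by auto
  have fk [measurable]: "f ^^ k \<in> measurable M M" for k using transfer.f_meas[OF transfer_funpow] .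
  have ivp: "integrable M (\<lambda>x. v x * p x)" if p: "p \<in> borel_measurable M" "\<And>x. x \<in> space M \<Longrightarrow> \<bar>p x\<bar> \<le> 1" for p
  proof (rule Bochner_Integration.integrable_bound[OF v])
    show "(\<lambda>x. v x * p x) \<in> borel_measurable M" using p by measurable
    show "AE x in M. norm (v x * p x) \<le> norm (v x)" using p(2) by (intro AE_I2) (auto simp: abs_mult intro!: mult_left_le)
  qed
  define C where "C n = {p \<in> borel_measurable M. (\<forall>x\<in>space M. \<bar>p x\<bar> \<le> 1) \<and> (\<integral>x. v x * p x \<partial>M) \<ge> \<delta> \<and>
      (\<forall>x\<in>space M. \<bar>p (f x) - p x\<bar> \<le> 2 / real (Suc n))}" for n
  have ne_C: "C n \<noteq> {}" for n
  proof -
    define N where "N = Suc n"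
    define s where "s x = sgn (S N v x)" for x
    have [measurable]: "S N v \<in> borel_measurable M" using integrable_S[OF v] by auto
    have s [measurable]: "s \<in> borel_measurable M" unfolding s_def[abs_def] by measurable
    have s1: "\<bar>s x\<bar> \<le> 1" for x by (simp add: s_def sgn_real_def)
    define p where "p x = (\<Sum>k<N. s ((f ^^ k) x)) / real N" for x
    have "p \<in> borel_measurable M" unfolding p_def[abs_def] by measurable
    moreover have "\<bar>p x\<bar> \<le> 1" for x
    proof -
      have "\<bar>\<Sum>k<N. s ((f ^^ k) x)\<bar> \<le> (\<Sum>k<N. 1)" by (intro order.trans[OF sum_abs] sum_mono s1)
      thus ?thesis by (simp add: p_def N_def)
    qed
    moreover have "(\<integral>x. v x * p x \<partial>M) \<ge> \<delta>"
    proof -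
      have "(\<integral>x. v x * p x \<partial>M) = (\<integral>x. v x * (\<Sum>k<N. s ((f ^^ k) x)) \<partial>M) / real N"
        by (simp add: p_def)
      also have "(\<integral>x. v x * (\<Sum>k<N. s ((f ^^ k) x)) \<partial>M) = (\<integral>x. S N v x * s x \<partial>M)"
        by (rule S_dual[OF v s s1, symmetric])
      also have "\<dots> = (\<integral>x. \<bar>S N v x\<bar> \<partial>M)"
        by (intro Bochner_Integration.integral_cong) (auto simp: s_def abs_sgn)
      finally show ?thesis using big[of N] by (simp add: N_def pos_le_divide_eq del: of_nat_Suc)
    qed
    moreover have "\<bar>p (f x) - p x\<bar> \<le> 2 / real (Suc n)" for x
    proof -
      have "p (f x) - p x = ((\<Sum>k<N. s ((f ^^ Suc k) x)) - (\<Sum>k<N. s ((f ^^ k) x))) / real N"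
        by (simp add: p_def diff_divide_distrib funpow_swap1)
      also have "(\<Sum>k<N. s ((f ^^ Suc k) x)) - (\<Sum>k<N. s ((f ^^ k) x)) = s ((f ^^ N) x) - s x"
        by (subst sum_subtractf[symmetric]) (simp add: sum_lessThan_telescope[of "\<lambda>k. s ((f ^^ k) x)"] del: funpow.simps(2))
      finally have "\<bar>p (f x) - p x\<bar> = \<bar>s ((f ^^ N) x) - s x\<bar> / real N" by simp
      also have "\<dots> \<le> 2 / real N" using s1[of "(f ^^ N) x"] s1[of x] by (intro divide_right_mono) auto
      finally show ?thesis by (simp add: N_def)
    qed
    ultimately have "p \<in> C n" by (simp add: C_def)
    thus ?thesis by blast
  qed
  \<comment> \<open>An equivalent finite measure, so that bounded functions are square integrable.\<close>
  obtain \<rho> :: "'a \<Rightarrow> real" where \<rho> [measurable]: "\<rho> \<in> borel_measurable M" and \<rho>0: "\<And>x. \<rho> x > 0" and i\<rho>: "integrable M \<rho>"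
    using sigma_finite_measure.obtain_positive_integrable_function[OF sf] by metis
  define N where "N = density M (\<lambda>x. ennreal (\<rho> x))"
  have sN: "space N = space M" "sets N = sets M" by (auto simp: N_def)
  have "emeasure N (space N) = ennreal (\<integral>x. \<rho> x \<partial>M)"
    using i\<rho> less_imp_le[OF \<rho>0] unfolding N_def
    by (simp add: emeasure_density nn_integral_eq_integral[symmetric] cong: nn_integral_cong)
  hence "finite_measure N" by (intro finite_measureI) simp
  then interpret N: finite_measure N .
  have AEN: "(AE x in N. P x) \<longleftrightarrow> (AE x in M. P x)" for P
    unfolding N_def using \<rho>0 by (simp add: AE_density)
  have mN: "borel_measurable N = (borel_measurable M :: ('a \<Rightarrow> real) set)"
    by (intro measurable_cong_sets sN) simp
  obtain p m where p: "\<And>i. p i \<in> C (m i)" and m: "\<And>i::nat. i \<le> m i" and conv: "AE x in N. convergent (\<lambda>i. p i x)"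
  proof (rule N.convex_sets_AE_convergent[of C])
    show "p \<in> borel_measurable N" if "p \<in> C n" for n p using that by (simp add: C_def mN)
    show "\<bar>p x\<bar> \<le> 1" if "p \<in> C n" "x \<in> space N" for n p x using that by (simp add: C_def sN)
    show "C (Suc n) \<subseteq> C n" for n
    proof -
      have "2 / real (Suc (Suc n)) \<le> 2 / real (Suc n)" by (intro divide_left_mono) auto
      thus ?thesis unfolding C_def by force
    qed
    show "C n \<noteq> {}" for n by (rule ne_C)
    show "(\<lambda>x. (p x + q x) / 2) \<in> C n" if p: "p \<in> C n" and q: "q \<in> C n" for n p q
    proof -
      have [measurable]: "p \<in> borel_measurable M" "q \<in> borel_measurable M" using p q by (auto simp: C_def)
      have "(\<integral>x. v x * ((p x + q x) / 2) \<partial>M) = (\<integral>x. (v x * p x + v x * q x) / 2 \<partial>M)"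
        by (intro Bochner_Integration.integral_cong) (auto simp: algebra_simps)
      also have "\<dots> = ((\<integral>x. v x * p x \<partial>M) + (\<integral>x. v x * q x \<partial>M)) / 2"
        using ivp[of p] ivp[of q] p q by (simp add: C_def)
      also have "\<dots> \<ge> \<delta>" using p q by (simp add: C_def)
      finally have 1: "(\<integral>x. v x * ((p x + q x) / 2) \<partial>M) \<ge> \<delta>" .
      have 2: "\<bar>(p x + q x) / 2\<bar> \<le> 1" if "x \<in> space M" for x
      proof -
        have "\<bar>p x\<bar> \<le> 1" "\<bar>q x\<bar> \<le> 1" using p q that by (auto simp: C_def)
        hence "\<bar>p x + q x\<bar> \<le> 2" by linarith
        thus ?thesis by simp
      qed
      have 3: "\<bar>(p (f x) + q (f x)) / 2 - (p x + q x) / 2\<bar> \<le> 2 / real (Suc n)" if "x \<in> space M" for x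
      proof -
        have "\<bar>p (f x) - p x\<bar> \<le> 2 / real (Suc n)" "\<bar>q (f x) - q x\<bar> \<le> 2 / real (Suc n)"
          using p q that by (auto simp: C_def)
        hence "\<bar>(p (f x) - p x) + (q (f x) - q x)\<bar> \<le> 2 * (2 / real (Suc n))" by linarith
        hence "\<bar>((p (f x) - p x) + (q (f x) - q x)) / 2\<bar> \<le> 2 / real (Suc n)" by simp
        also have "((p (f x) - p x) + (q (f x) - q x)) / 2 = (p (f x) + q (f x)) / 2 - (p x + q x) / 2"
          by (simp add: field_simps)
        finally show ?thesis .
      qed
      have 4: "(\<lambda>x. (p x + q x) / 2) \<in> borel_measurable M" by measurable
      show ?thesis unfolding C_def using 1 2 3 4 by blast
    qed
  qed blast
  have pm [measurable]: "p i \<in> borel_measurable M" and p1: "x \<in> space M \<Longrightarrow> \<bar>p i x\<bar> \<le> 1"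
    and pd: "(\<integral>x. v x * p i x \<partial>M) \<ge> \<delta>" and pf: "x \<in> space M \<Longrightarrow> \<bar>p i (f x) - p i x\<bar> \<le> 2 / real (Suc (m i))" for i x
    using p[of i] by (auto simp: C_def)
  \<comment> \<open>As \<open>p i (f x) - p i x\<close> tends to \<open>0\<close> at every point,
    \<open>w\<close> is invariant everywhere, also where the limit does not exist and
    \<open>lim\<close> returns the same default at \<open>x\<close> and \<open>f
    x\<close>.\<close>
  define w where "w x = lim (\<lambda>i. p i x)" for x
  have w [measurable]: "w \<in> borel_measurable M" unfolding w_def[abs_def] by (rule borel_measurable_lim_metric) (rule pm)
  have conv': "AE x in M. (\<lambda>i. p i x) \<longlonglongrightarrow> w x"
    using conv unfolding AEN w_def by (simp add: convergent_LIMSEQ_iff)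
  have inv: "w (f x) = w x" if x: "x \<in> space M" for x
  proof -
    have "(\<lambda>i. p i (f x) - p i x) \<longlonglongrightarrow> 0"
    proof (rule Lim_null_comparison)
      show "\<forall>\<^sub>F i in sequentially. norm (p i (f x) - p i x) \<le> 2 / real (Suc i)"
      proof (intro always_eventually allI)
        fix i
        have "2 / real (Suc (m i)) \<le> 2 / real (Suc i)" using m[of i] by (intro divide_left_mono) auto
        thus "norm (p i (f x) - p i x) \<le> 2 / real (Suc i)" using pf[OF x, of i] by simp
      qed
      show "(\<lambda>i. 2 / real (Suc i)) \<longlonglongrightarrow> 0" using tendsto_mult_right_zero[OF LIMSEQ_Suc[OF lim_1_over_n], of 2] by simp
    qed
    hence "(\<lambda>i. p i (f x)) \<longlonglongrightarrow> l \<longleftrightarrow> (\<lambda>i. p i x) \<longlonglongrightarrow> l" for l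
      by (rule Lim_transform_eq)
    thus ?thesis by (simp add: w_def lim_def)
  qed
  have w1: "AE x in M. \<bar>w x\<bar> \<le> 1"
    using conv' AE_space
  proof eventually_elim
    case (elim x)
    show ?case by (rule LIMSEQ_le_const2[OF tendsto_rabs[OF elim(1)]]) (use p1 elim in auto)
  qed
  obtain c where c: "AE x in M. w x = c" by (rule ergodic_AE_const[OF erg ne w inv w1])
  have "(\<lambda>i. (\<integral>x. v x * p i x \<partial>M)) \<longlonglongrightarrow> (\<integral>x. v x * w x \<partial>M)"
  proof (rule integral_dominated_convergence[where w = "\<lambda>x. \<bar>v x\<bar>"])
    show "integrable M (\<lambda>x. \<bar>v x\<bar>)" using v by simp
    show "AE x in M. (\<lambda>i. v x * p i x) \<longlonglongrightarrow> v x * w x"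
      using conv' by eventually_elim (intro tendsto_intros)
    show "AE x in M. norm (v x * p i x) \<le> \<bar>v x\<bar>" for i
      using p1[of _ i] by (intro AE_I2) (auto simp: abs_mult intro!: mult_left_le)
  qed measurable
  hence "\<delta> \<le> (\<integral>x. v x * w x \<partial>M)" by (rule LIMSEQ_le_const) (use pd in auto)
  also have "(\<integral>x. v x * w x \<partial>M) = (\<integral>x. v x * c \<partial>M)"
  proof (rule integral_cong_AE)
    show "AE x in M. v x * w x = v x * c" using c by eventually_elim simp
  qed measurable
  also have "\<dots> = 0" using v0 by simp
  finally show False using \<delta> by simp
qed

end

section \<open>Pointwise dual ergodicity\<close>

context transfer
begin

abbreviation averages_to :: "(nat \<Rightarrow> real) \<Rightarrow> real \<Rightarrow> ('a \<Rightarrow> real) \<Rightarrow> bool" where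
  "averages_to b c v \<equiv> AE x in M. (\<lambda>n. b n * S n v x) \<longlonglongrightarrow> c * (\<integral>x. v x \<partial>M)"

text \<open>The set of good \<open>v\<close> is closed in \<open>L\<^sup>1\<close>. Where no sum of
  \<open>|v - v'|\<close> exceeds \<open>\<eta>\<close> times the sum of \<open>1\<^sub>A\<close>,
  the normalised sums of \<open>v\<close> and \<open>v'\<close> eventually differ by at most
  \<open>\<eta> K\<close>. The maximal inequality makes the exceptional part of \<open>A\<close>
  small.\<close>

lemma convergence_closed:
  assumes v: "integrable M v" and A: "A \<in> sets M" "emeasure M A < \<infinity>" and b: "\<And>n. b n \<ge> 0"
    and bound: "AE x in M. x \<in> A \<longrightarrow> (\<forall>\<^sub>F n in sequentially. b n * S n (indicator A) x \<le> K)"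
    and approx: "\<And>\<epsilon>. \<epsilon> > 0 \<Longrightarrow> \<exists>v'. integrable M v' \<and> (\<integral>x. \<bar>v x - v' x\<bar> \<partial>M) < \<epsilon> \<and>
       averages_to b c v'"
  shows "AE x in M. x \<in> A \<longrightarrow> (\<lambda>n. b n * S n v x) \<longlonglongrightarrow> c * (\<integral>x. v x \<partial>M)"
proof -
  define \<eta> where "\<eta> k = 1 / real (Suc k)" for k
  have \<eta>: "\<eta> k > 0" for k by (simp add: \<eta>_def)
  define P where "P k i v' \<longleftrightarrow> integrable M v' \<and> (\<integral>x. \<bar>v x - v' x\<bar> \<partial>M) < \<eta> k * \<eta> i \<and>
       averages_to b c v'" for k i v'
  define u where "u k i = (SOME v'. P k i v')" for k i
  have Pu: "P k i (u k i)" for k i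
  proof -
    have "\<exists>v'. P k i v'" unfolding P_def by (rule approx) (simp add: \<eta>)
    thus ?thesis unfolding u_def by (rule someI_ex)
  qed
  have u: "integrable M (u k i)" and uv: "(\<integral>x. \<bar>v x - u k i x\<bar> \<partial>M) < \<eta> k * \<eta> i"
    and ul: "averages_to b c (u k i)" for k i
    using Pu[of k i] by (auto simp: P_def)
  define D where "D k i x = \<bar>v x - u k i x\<bar>" for k i x
  have D: "integrable M (D k i)" for k i unfolding D_def[abs_def] using v u by auto
  \<comment> \<open>For each \<open>k\<close> the approximations \<open>u k i\<close> improve with
    \<open>i\<close>, so that almost every point avoids one of the sets \<open>E k
    i\<close>.\<close>
  define E where "E k i = {x \<in> A. \<exists>n. S n (D k i) x > \<eta> k * S n (indicator A) x}" for k i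
  have iA: "integrable M (indicator A :: 'a \<Rightarrow> real)" using A by simp
  have [measurable]: "A \<in> sets M" by fact
  have [measurable]: "S n (D k i) \<in> borel_measurable M" "S n (indicator A) \<in> borel_measurable M" for n k i
    using integrable_S[OF D] integrable_S[OF iA] by auto
  have Em [measurable]: "E k i \<in> sets M" for k i
  proof -
    have "E k i = {x \<in> space M. x \<in> A \<and> (\<exists>n. S n (D k i) x > \<eta> k * S n (indicator A) x)}"
      using sets.sets_into_space[OF A(1)] by (auto simp: E_def)
    also have "\<dots> \<in> sets M" by measurable
    finally show ?thesis .
  qed
  have Ef: "emeasure M (E k i) \<noteq> \<infinity>" for k i
  proof -
    have "emeasure M (E k i) \<le> emeasure M A" by (intro emeasure_mono A) (auto simp: E_def)
    thus ?thesis using A(2) by (auto simp: top_unique)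
  qed
  have Eb: "measure M (E k i) \<le> \<eta> i" for k i
  proof -
    have "\<eta> k * measure M (E k i) \<le> (\<integral>x. \<bar>D k i x\<bar> \<partial>M)"
      unfolding E_def by (rule maximal_inequality[OF D A \<eta>])
    also have "\<dots> < \<eta> k * \<eta> i" using uv[of k i] by (simp add: D_def)
    finally show ?thesis using \<eta>[of k] by simp
  qed
  have "AE x in M. x \<notin> (\<Inter>i. E k i)" for k
  proof -
    have "measure M (\<Inter>i. E k i) \<le> \<eta> j" for j
    proof -
      have "measure M (\<Inter>i. E k i) \<le> measure M (E k j)"
        using Ef[of k j] by (intro measure_mono_fmeasurable) (auto intro!: fmeasurableI simp: less_top)
      thus ?thesis using Eb[of k j] by linarith
    qed
    moreover have "\<eta> \<longlonglongrightarrow> 0" unfolding \<eta>_def[abs_def] by (rule LIMSEQ_Suc[OF lim_1_over_n])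
    ultimately have "measure M (\<Inter>i. E k i) \<le> 0" by (intro LIMSEQ_le_const) auto
    hence "measure M (\<Inter>i. E k i) = 0" using measure_nonneg[of M "\<Inter>i. E k i"] by linarith
    moreover have "emeasure M (\<Inter>i. E k i) \<noteq> \<infinity>"
    proof -
      have "emeasure M (\<Inter>i. E k i) \<le> emeasure M (E k 0)" by (intro emeasure_mono) auto
      thus ?thesis using Ef[of k 0] by (auto simp: top_unique)
    qed
    ultimately have "emeasure M (\<Inter>i. E k i) = 0" by (simp add: emeasure_eq_ennreal_measure)
    thus ?thesis by (intro AE_not_in) (auto simp: null_sets_def)
  qed
  hence a1: "AE x in M. \<forall>k. x \<notin> (\<Inter>i. E k i)" by (simp add: AE_all_countable)
  have a2: "AE x in M. \<forall>k i. (\<lambda>n. b n * S n (u k i) x) \<longlonglongrightarrow> c * (\<integral>x. u k i x \<partial>M)"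
    using ul by (simp add: AE_all_countable)
  have a3: "AE x in M. \<forall>k i n. \<bar>S n v x - S n (u k i) x\<bar> \<le> S n (D k i) x"
    unfolding AE_all_countable
  proof (intro allI)
    fix k i n
    have "AE x in M. \<forall>n. S n (\<lambda>x. 1 * v x + (-1) * u k i x) x = 1 * S n v x + (-1) * S n (u k i) x"
      by (rule S_linear[OF v u])
    moreover have "AE x in M. \<forall>n. \<bar>S n (\<lambda>x. 1 * v x + (-1) * u k i x) x\<bar> \<le> S n (\<lambda>x. \<bar>1 * v x + (-1) * u k i x\<bar>) x"
      by (rule S_abs) (use v u in auto)
    ultimately show "AE x in M. \<bar>S n v x - S n (u k i) x\<bar> \<le> S n (D k i) x"
    proof eventually_elim
      case (elim x)
      have "S n (\<lambda>x. \<bar>1 * v x + (-1) * u k i x\<bar>) = S n (D k i)" by (simp add: D_def[abs_def])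
      thus ?case using elim(1)[rule_format, of n] elim(2)[rule_format, of n] by simp
    qed
  qed
  show ?thesis
    using a1 a2 a3 bound
  proof eventually_elim
    case (elim x)
    note Sdiff = elim(3)
    show ?case
    proof (intro impI)
      assume xA: "x \<in> A"
      hence ev: "\<forall>\<^sub>F n in sequentially. b n * S n (indicator A) x \<le> K" using elim by blast
      show "(\<lambda>n. b n * S n v x) \<longlonglongrightarrow> c * (\<integral>x. v x \<partial>M)"
      proof (rule LIMSEQ_I)
        fix r :: real assume r: "r > 0"
        have l: "(\<lambda>k. \<eta> k * (\<bar>K\<bar> + \<bar>c\<bar> + 1)) \<longlonglongrightarrow> 0 * (\<bar>K\<bar> + \<bar>c\<bar> + 1)"
          unfolding \<eta>_def by (intro tendsto_mult tendsto_const LIMSEQ_Suc[OF lim_1_over_n])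
        have "\<forall>\<^sub>F k in sequentially. \<eta> k * (\<bar>K\<bar> + \<bar>c\<bar> + 1) < r"
          by (rule order_tendstoD(2)[OF l]) (use r in simp)
        then obtain k where k: "\<eta> k * (\<bar>K\<bar> + \<bar>c\<bar> + 1) < r" by (auto simp: eventually_sequentially)
        obtain i where i: "x \<notin> E k i" using elim(1) by blast
        have Sb: "S n (D k i) x \<le> \<eta> k * S n (indicator A) x" for n
          using i xA by (auto simp: E_def not_less)
        have lim: "\<forall>\<^sub>F n in sequentially. \<bar>b n * S n (u k i) x - c * (\<integral>x. u k i x \<partial>M)\<bar> < \<eta> k"
          using elim(2) \<eta>[of k] by (auto simp: tendsto_iff dist_real_def)
        have cint: "\<bar>c * (\<integral>x. u k i x \<partial>M) - c * (\<integral>x. v x \<partial>M)\<bar> \<le> \<bar>c\<bar> * \<eta> k"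
        proof -
          have "c * (\<integral>x. u k i x \<partial>M) - c * (\<integral>x. v x \<partial>M) = - c * (\<integral>x. v x - u k i x \<partial>M)"
            using u v by (simp add: algebra_simps)
          also have "\<bar>\<dots>\<bar> = \<bar>c\<bar> * \<bar>\<integral>x. v x - u k i x \<partial>M\<bar>" by (simp add: abs_mult)
          also have "\<dots> \<le> \<bar>c\<bar> * (\<eta> k * \<eta> i)"
            by (rule mult_left_mono[OF order.trans[OF integral_abs_bound less_imp_le[OF uv]]]) simp
          also have "\<dots> \<le> \<bar>c\<bar> * (\<eta> k * 1)"
            using \<eta>[of k] by (intro mult_left_mono) (auto simp: \<eta>_def)
          finally show ?thesis by simp
        qed
        have "\<forall>\<^sub>F n in sequentially. norm (b n * S n v x - c * (\<integral>x. v x \<partial>M)) < r"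
          using ev lim
        proof eventually_elim
          case (elim n)
          have "\<bar>b n * S n v x - b n * S n (u k i) x\<bar> = b n * \<bar>S n v x - S n (u k i) x\<bar>"
            using b[of n] by (simp add: right_diff_distrib[symmetric] abs_mult)
          also have "\<dots> \<le> b n * (\<eta> k * S n (indicator A) x)"
            by (intro mult_left_mono b order.trans[OF Sdiff[rule_format] Sb])
          also have "\<dots> = \<eta> k * (b n * S n (indicator A) x)" by simp
          also have "\<dots> \<le> \<eta> k * \<bar>K\<bar>" using elim \<eta>[of k] by (intro mult_left_mono) auto
          finally have "\<bar>b n * S n v x - b n * S n (u k i) x\<bar> \<le> \<eta> k * \<bar>K\<bar>" .
          hence "\<bar>b n * S n v x - c * (\<integral>x. v x \<partial>M)\<bar> < \<eta> k * \<bar>K\<bar> + \<eta> k + \<bar>c\<bar> * \<eta> k"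
            using elim cint by linarith
          thus ?case using k by (simp add: algebra_simps)
        qed
        thus "\<exists>no. \<forall>n\<ge>no. norm (b n * S n v x - c * (\<integral>x. v x \<partial>M)) < r"
          by (simp add: eventually_sequentially)
      qed
    qed
  qed
qed

text \<open>Telescoping: shifting the window by \<open>k\<close> changes the first \<open>k\<close> and the
  last \<open>k\<close> terms.\<close>

lemma S_diff_iterate:
  "S m v x - S m ((L ^^ k) v) x = S k v x - (\<Sum>j<k. (L ^^ (m + j)) v x)"
proof (induction k)
  case 0
  show ?case by (simp add: S_def)
next
  case (Suc k)
  have s: "S m ((L ^^ k) v) x = (\<Sum>j<m. (L ^^ (j + k)) v x)" for k
    by (simp add: S_def funpow_add)
  have "S m ((L ^^ Suc k) v) x - S m ((L ^^ k) v) x = (\<Sum>j<m. (L ^^ (Suc j + k)) v x - (L ^^ (j + k)) v x)"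
    unfolding s sum_subtractf by simp
  also have "\<dots> = (L ^^ (m + k)) v x - (L ^^ (0 + k)) v x"
    by (rule sum_lessThan_telescope[of "\<lambda>j. (L ^^ (j + k)) v x"])
  finally show ?case using Suc by (simp add: S_def)
qed

lemma S_S:
  assumes v: "integrable M v"
  shows "AE x in M. \<forall>m. S m (S n v) x = (\<Sum>k<n. S m ((L ^^ k) v) x)"
proof (induction n)
  case 0
  have "AE x in M. \<forall>m. S m (\<lambda>x. 0 * v x + 0 * v x) x = 0 * S m v x + 0 * S m v x" by (rule S_linear[OF v v])
  moreover have "S 0 v = (\<lambda>x. 0 * v x + 0 * v x)" by auto
  ultimately show ?case by simp
next
  case (Suc n)
  have "AE x in M. \<forall>m. S m (\<lambda>x. 1 * S n v x + 1 * (L ^^ n) v x) x = 1 * S m (S n v) x + 1 * S m ((L ^^ n) v) x"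
    by (rule S_linear[OF integrable_S[OF v] integrable_Lpow[OF v]])
  moreover have "S (Suc n) v = (\<lambda>x. 1 * S n v x + 1 * (L ^^ n) v x)" by (auto simp: S_def)
  ultimately have "AE x in M. \<forall>m. S m (S (Suc n) v) x = S m (S n v) x + S m ((L ^^ n) v) x" by simp
  with Suc show ?case by eventually_elim simp
qed

lemma Lpow_abs_le_const:
  assumes v: "integrable M v" and K: "K > 0" and le: "AE x in M. \<bar>v x\<bar> \<le> K"
  shows "AE x in M. \<forall>j. \<bar>(L ^^ j) v x\<bar> \<le> K"
  unfolding AE_all_countable by (intro allI transfer.L_abs_le_const[OF transfer_funpow v K le])

text \<open>A bounded function minus one of its averages is a coboundary of a bounded function, so that its
  sums stay bounded.\<close>

lemma S_minus_average_bounded: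
  assumes v: "integrable M v" and K: "K > 0" and le: "AE x in M. \<bar>v x\<bar> \<le> K" and n: "n \<ge> 1"
  shows "AE x in M. \<forall>m. \<bar>S m (\<lambda>x. v x - S n v x / real n) x\<bar> \<le> 2 * real n * K"
proof -
  have "AE x in M. \<forall>m. S m (\<lambda>x. 1 * v x + (- 1 / real n) * S n v x) x = 1 * S m v x + (- 1 / real n) * S m (S n v) x"
    by (rule S_linear[OF v integrable_S[OF v]])
  hence lin: "AE x in M. \<forall>m. S m (\<lambda>x. v x - S n v x / real n) x = S m v x - S m (S n v) x / real n" by simp
  show ?thesis
    using lin S_S[OF v, of n] Lpow_abs_le_const[OF v K le]
  proof eventually_elim
    case (elim x)
    show ?case
    proof
      fix m
      have "real n * S m (\<lambda>x. v x - S n v x / real n) x = real n * S m v x - S m (S n v) x"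
        using elim(1)[rule_format, of m] n by (simp add: field_simps)
      also have "\<dots> = (\<Sum>k<n. S m v x - S m ((L ^^ k) v) x)"
        using elim(2) by (simp add: sum_subtractf)
      also have "\<dots> = (\<Sum>k<n. S k v x - (\<Sum>j<k. (L ^^ (m + j)) v x))" by (simp add: S_diff_iterate)
      finally have "real n * \<bar>S m (\<lambda>x. v x - S n v x / real n) x\<bar> = \<bar>\<Sum>k<n. S k v x - (\<Sum>j<k. (L ^^ (m + j)) v x)\<bar>"
        by (metis abs_mult abs_of_nat)
      also have "\<dots> \<le> (\<Sum>k<n. 2 * real n * K)"
      proof (intro order.trans[OF sum_abs] sum_mono)
        fix k assume k: "k \<in> {..<n}"
        have "\<bar>S k v x\<bar> \<le> (\<Sum>j<k. K)" unfolding S_def using elim(3) by (intro order.trans[OF sum_abs] sum_mono) blast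
        moreover have "\<bar>\<Sum>j<k. (L ^^ (m + j)) v x\<bar> \<le> (\<Sum>j<k. K)" using elim(3) by (intro order.trans[OF sum_abs] sum_mono) blast
        moreover have "real k * K \<le> real n * K" using k K by (intro mult_right_mono) auto
        ultimately show "\<bar>S k v x - (\<Sum>j<k. (L ^^ (m + j)) v x)\<bar> \<le> 2 * real n * K" by simp
      qed
      also have "\<dots> = real n * (2 * real n * K)" by simp
      finally show "\<bar>S m (\<lambda>x. v x - S n v x / real n) x\<bar> \<le> 2 * real n * K"
        using n by (simp add: mult_le_cancel_left)
    qed
  qed
qed

lemma integral_S: "integrable M v \<Longrightarrow> (\<integral>x. S n v x \<partial>M) = real n * (\<integral>x. v x \<partial>M)"
  unfolding S_def
  by (subst Bochner_Integration.integral_sum)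
     (auto simp: integrable_Lpow transfer.integral_L[OF transfer_funpow])

text \<open>Convergence for \<open>1\<^sub>Y\<close> implies convergence for all integrable
  \<open>v\<close>. The sets \<open>B k\<close> take the place of \<open>A\<close> in the
  closedness lemma; the hypothesis on their sums supplies the bound required there, also at points
  outside \<open>Y\<close>.\<close>

theorem pointwise_dual_ergodic:
  assumes sf: "sigma_finite_measure M" and erg: "ergodic_map M f" and ne: "emeasure M (space M) \<noteq> 0"
    and Y: "Y \<in> sets M" "emeasure M Y = 1"
    and b: "\<And>n. b n \<ge> 0" "b \<longlonglongrightarrow> 0"
    and conv: "AE x in M. (\<lambda>n. b n * S n (indicator Y) x) \<longlonglongrightarrow> c"
    and B: "\<And>k. B k \<in> sets M" "\<And>k. emeasure M (B k) < \<infinity>" "AE x in M. \<exists>k::nat. x \<in> B k"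
    and SB: "\<And>k. AE x in M. \<forall>n. S n (indicator (B k)) x \<le> real k + S n (indicator Y) x"
    and v: "integrable M v"
  shows "averages_to b c v"
proof -
  have iY: "integrable M (indicator Y :: 'a \<Rightarrow> real)" using Y by simp
  have intY: "(\<integral>x. indicator Y x \<partial>M) = (1::real)" using Y by (simp add: measure_def)
  \<comment> \<open>The class of good functions is enlarged in steps: bounded with zero integral,
    bounded, arbitrary.\<close>
  have closed: "averages_to b c v"
    if v: "integrable M v" and approx: "\<And>\<epsilon>. \<epsilon> > 0 \<Longrightarrow> \<exists>v'. integrable M v' \<and> (\<integral>x. \<bar>v x - v' x\<bar> \<partial>M) < \<epsilon> \<and>
       averages_to b c v'" for v
  proof -
    have "AE x in M. x \<in> B k \<longrightarrow> (\<lambda>n. b n * S n v x) \<longlonglongrightarrow> c * (\<integral>x. v x \<partial>M)" for k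
    proof (rule convergence_closed[OF v B(1,2) b(1) _ approx])
      show "AE x in M. x \<in> B k \<longrightarrow> (\<forall>\<^sub>F n in sequentially. b n * S n (indicator (B k)) x \<le> c + 1)"
        using SB[of k] conv
      proof eventually_elim
        case (elim x)
        note SBx = elim(1)
        have "(\<lambda>n. b n * real k + b n * S n (indicator Y) x) \<longlonglongrightarrow> 0 * real k + c"
          by (intro tendsto_intros b elim)
        hence "\<forall>\<^sub>F n in sequentially. b n * real k + b n * S n (indicator Y) x < c + 1"
          by (rule order_tendstoD(2)) simp
        hence "\<forall>\<^sub>F n in sequentially. b n * S n (indicator (B k)) x \<le> c + 1"
        proof eventually_elim
          case (elim n)
          have "b n * S n (indicator (B k)) x \<le> b n * (real k + S n (indicator Y) x)"
            by (intro mult_left_mono b SBx[rule_format])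
          thus ?case using elim by (simp add: algebra_simps)
        qed
        thus ?case by simp
      qed
    qed auto
    hence "AE x in M. \<forall>k. x \<in> B k \<longrightarrow> (\<lambda>n. b n * S n v x) \<longlonglongrightarrow> c * (\<integral>x. v x \<partial>M)"
      unfolding AE_all_countable by blast
    with B(3) show ?thesis by eventually_elim blast
  qed
  have centered: "averages_to b c v"
    if v: "integrable M v" and K: "K > 0" "AE x in M. \<bar>v x\<bar> \<le> K" and v0: "(\<integral>x. v x \<partial>M) = 0" for v K
  proof (rule closed[OF v])
    fix \<epsilon> :: real assume "\<epsilon> > 0"
    then obtain n where n: "n \<ge> 1" "(\<integral>x. \<bar>S n v x\<bar> \<partial>M) < \<epsilon> * real n"
      using ergodic_cesaro_L1[OF sf erg ne v v0] by blast
    define v' where "v' x = v x - S n v x / real n" for x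
    have "integrable M v'" unfolding v'_def[abs_def] using v integrable_S[OF v] by simp
    moreover have "(\<integral>x. \<bar>v x - v' x\<bar> \<partial>M) < \<epsilon>" using n by (simp add: v'_def pos_divide_less_eq)
    moreover have "(\<integral>x. v' x \<partial>M) = 0"
      unfolding v'_def using v integrable_S[OF v] by (simp add: integral_S v0)
    moreover have "AE x in M. (\<lambda>m. b m * S m v' x) \<longlonglongrightarrow> 0"
      using S_minus_average_bounded[OF v K n(1)]
    proof eventually_elim
      case (elim x)
      have l: "(\<lambda>m. b m * (2 * real n * K)) \<longlonglongrightarrow> 0 * (2 * real n * K)" by (intro tendsto_intros b)
      have "norm (b m * S m v' x) \<le> b m * (2 * real n * K)" for m
        using elim b(1)[of m] unfolding v'_def by (auto simp: abs_mult intro!: mult_left_mono)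
      hence "\<forall>\<^sub>F m in sequentially. norm (b m * S m v' x) \<le> b m * (2 * real n * K)" by simp
      thus ?case by (rule Lim_null_comparison) (use l in simp)
    qed
    ultimately show "\<exists>v'. integrable M v' \<and> (\<integral>x. \<bar>v x - v' x\<bar> \<partial>M) < \<epsilon> \<and>
       averages_to b c v'" by (intro exI[of _ v']) simp
  qed
  have bounded: "averages_to b c v"
    if v: "integrable M v" and K: "AE x in M. \<bar>v x\<bar> \<le> K" for v K
  proof -
    define a where "a = (\<integral>x. v x \<partial>M)"
    define v' where "v' x = 1 * v x + (- a) * indicator Y x" for x
    have v': "integrable M v'" unfolding v'_def[abs_def] using v iY by simp
    have "averages_to b c v'"
    proof (rule centered[OF v', of "\<bar>K\<bar> + \<bar>a\<bar> + 1"])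
      show "AE x in M. \<bar>v' x\<bar> \<le> \<bar>K\<bar> + \<bar>a\<bar> + 1"
        using K by eventually_elim (auto simp: v'_def indicator_def)
      show "(\<integral>x. v' x \<partial>M) = 0" unfolding v'_def using v iY intY by (simp add: a_def)
    qed auto
    moreover have "AE x in M. \<forall>n. S n v' x = 1 * S n v x + (- a) * S n (indicator Y) x"
      unfolding v'_def[abs_def] by (rule S_linear[OF v iY])
    ultimately show ?thesis using conv
    proof eventually_elim
      case (elim x)
      have i0: "(\<integral>x. v' x \<partial>M) = 0" unfolding v'_def using v iY intY by (simp add: a_def)
      have "(\<lambda>n. b n * S n v' x + a * (b n * S n (indicator Y) x)) \<longlonglongrightarrow> c * 0 + a * c"
        using tendsto_add[OF elim(1)[unfolded i0] tendsto_mult[OF tendsto_const elim(3)]] .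
      thus ?case using elim(2) by (simp add: a_def algebra_simps)
    qed
  qed
  show ?thesis
  proof (rule closed[OF v])
    fix \<epsilon> :: real assume \<epsilon>: "\<epsilon> > 0"
    define vn where "vn n x = max (- real n) (min (real n) (v x))" for n :: nat and x
    have [measurable]: "v \<in> borel_measurable M" using v by auto
    have vnm [measurable]: "vn n \<in> borel_measurable M" for n unfolding vn_def[abs_def] by measurable
    have vnv: "\<bar>vn n x\<bar> \<le> \<bar>v x\<bar>" "\<bar>vn n x\<bar> \<le> real n" for n x by (auto simp: vn_def)
    have ivn: "integrable M (vn n)" for n
      by (rule Bochner_Integration.integrable_bound[OF v vnm]) (use vnv in auto)
    have "(\<lambda>n. (\<integral>x. \<bar>v x - vn n x\<bar> \<partial>M)) \<longlonglongrightarrow> (\<integral>x. 0 \<partial>M)"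
    proof (rule integral_dominated_convergence[where w = "\<lambda>x. 2 * \<bar>v x\<bar>"])
      show "AE x in M. (\<lambda>n. \<bar>v x - vn n x\<bar>) \<longlonglongrightarrow> 0"
      proof (intro AE_I2 tendsto_eventually)
        fix x
        obtain N where "\<bar>v x\<bar> \<le> real N" using real_arch_simple by blast
        hence "v x - vn n x = 0" if "n \<ge> N" for n using that by (auto simp: vn_def)
        thus "\<forall>\<^sub>F n in sequentially. \<bar>v x - vn n x\<bar> = 0" by (auto simp: eventually_sequentially)
      qed
      show "AE x in M. norm \<bar>v x - vn n x\<bar> \<le> 2 * \<bar>v x\<bar>" for n
      proof (intro AE_I2)
        fix x show "norm \<bar>v x - vn n x\<bar> \<le> 2 * \<bar>v x\<bar>" using vnv(1)[of n x] by simp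
      qed
    qed (use v in auto)
    hence "\<forall>\<^sub>F n in sequentially. (\<integral>x. \<bar>v x - vn n x\<bar> \<partial>M) < \<epsilon>"
      using \<epsilon> by (auto dest: order_tendstoD(2))
    then obtain n where n: "(\<integral>x. \<bar>v x - vn n x\<bar> \<partial>M) < \<epsilon>" by (auto simp: eventually_sequentially)
    show "\<exists>v'. integrable M v' \<and> (\<integral>x. \<bar>v x - v' x\<bar> \<partial>M) < \<epsilon> \<and>
       averages_to b c v'"
      using n ivn bounded[OF ivn[of n], of "real n"] vnv(2) by (intro exI[of _ "vn n"]) auto
  qed
qed

end

section \<open>First returns\<close>

text \<open>For points that never return, the return time is the infimum of the empty set. The
  characterisation is restricted to returning points, which makes that value irrelevant.\<close>

lemma return_time_eq:
  assumes n: "n \<ge> 1" and ex: "\<exists>m\<ge>1. (f ^^ m) y \<in> Y"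
  shows "return_time f Y y = n \<longleftrightarrow> (f ^^ n) y \<in> Y \<and> (\<forall>i\<in>{1..<n}. (f ^^ i) y \<notin> Y)"
proof -
  define Q where "Q = {n. n \<ge> 1 \<and> (f ^^ n) y \<in> Y}"
  have r: "return_time f Y y = Inf Q" by (simp add: return_time_def Q_def)
  have Q: "Q \<noteq> {}" using ex by (auto simp: Q_def)
  have IQ: "Inf Q \<in> Q" using Q by (rule Inf_nat_def1)
  have low: "Inf Q \<le> i" if "i \<in> Q" for i using that by (intro cInf_lower) auto
  show ?thesis
  proof
    assume "return_time f Y y = n"
    hence "n \<in> Q" "\<And>i. i < n \<Longrightarrow> i \<notin> Q" using IQ low by (auto simp: r not_le[symmetric])
    thus "(f ^^ n) y \<in> Y \<and> (\<forall>i\<in>{1..<n}. (f ^^ i) y \<notin> Y)" by (auto simp: Q_def)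
  next
    assume a: "(f ^^ n) y \<in> Y \<and> (\<forall>i\<in>{1..<n}. (f ^^ i) y \<notin> Y)"
    have "n \<in> Q" using a n by (simp add: Q_def)
    hence "Inf Q \<le> n" by (rule low)
    moreover have "\<not> Inf Q < n" using IQ a by (auto simp: Q_def)
    ultimately show "return_time f Y y = n" by (simp add: r)
  qed
qed

lemma return_time_ge_1:
  assumes "\<exists>m\<ge>1. (f ^^ m) y \<in> Y" shows "return_time f Y y \<ge> 1"
proof -
  have "{n. n \<ge> 1 \<and> (f ^^ n) y \<in> Y} \<noteq> {}" using assms by auto
  from Inf_nat_def1[OF this] show ?thesis by (simp add: return_time_def)
qed

locale first_return = transfer +
  fixes Y :: "'a set"
  assumes Y [measurable]: "Y \<in> sets M" and Y1: "emeasure M Y = 1"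
    and cons: "conservative_map M f" and sweep: "AE x in M. \<exists>k. (f ^^ k) x \<in> Y"
begin

abbreviation \<phi> :: "'a \<Rightarrow> nat" where "\<phi> \<equiv> return_time f Y"
abbreviation F :: "'a \<Rightarrow> 'a" where "F \<equiv> first_return_map f Y"

abbreviation LY :: "nat \<Rightarrow> 'a \<Rightarrow> real" where "LY n \<equiv> (L ^^ n) (indicator Y)"
abbreviation SY :: "nat \<Rightarrow> 'a \<Rightarrow> real" where "SY n \<equiv> S n (indicator Y)"
abbreviation green :: "real \<Rightarrow> 'a \<Rightarrow> real" where
  "green u y \<equiv> (\<Sum>n. exp (- (u * real n)) * LY n y)"

definition hit :: "nat \<Rightarrow> 'a set \<Rightarrow> 'a set" where
  "hit n A = {x \<in> space M. (\<forall>i\<in>{..<n}. (f ^^ i) x \<notin> Y) \<and> (f ^^ n) x \<in> A}"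

text \<open>Formulated with iterates, not with the return time, whose value carries no information at points
  that never return.\<close>

definition ret :: "nat \<Rightarrow> 'a set \<Rightarrow> 'a set" where
  "ret n A = {x \<in> space M. x \<in> Y \<and> (\<forall>i\<in>{1..<n}. (f ^^ i) x \<notin> Y) \<and> (f ^^ n) x \<in> A}"

lemma Y_space: "y \<in> Y \<Longrightarrow> y \<in> space M" using sets.sets_into_space[OF Y] by auto

lemma measure_Y: "measure M Y = 1" using Y1 by (simp add: measure_def)

lemma fpow_meas [measurable]: "f ^^ k \<in> measurable M M" using transfer.f_meas[OF transfer_funpow] .

lemma return_time_meas [measurable]: "\<phi> \<in> measurable M (count_space UNIV)"
  unfolding measurable_count_space_eq2_countable
proof safe
  fix n :: nat
  have "\<phi> -` {n} \<inter> space M = {x \<in> space M. (\<forall>m\<in>{1..}. (f ^^ m) x \<notin> Y) \<and> n = Inf {}}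
     \<union> {x \<in> space M. (\<exists>m\<in>{1..}. (f ^^ m) x \<in> Y) \<and> 1 \<le> n \<and> (f ^^ n) x \<in> Y \<and> (\<forall>i\<in>{1..<n}. (f ^^ i) x \<notin> Y)}"
    (is "_ = ?A \<union> ?B")
  proof (rule set_eqI)
    fix x
    show "x \<in> \<phi> -` {n} \<inter> space M \<longleftrightarrow> x \<in> ?A \<union> ?B"
    proof (cases "\<exists>m\<ge>1. (f ^^ m) x \<in> Y")
      case True
      have "\<phi> x = n \<longleftrightarrow> 1 \<le> n \<and> (f ^^ n) x \<in> Y \<and> (\<forall>i\<in>{1..<n}. (f ^^ i) x \<notin> Y)"
        using return_time_eq[OF _ True, of n] return_time_ge_1[OF True] by blast
      thus ?thesis using True by auto
    next
      case False
      hence "{n. n \<ge> 1 \<and> (f ^^ n) x \<in> Y} = {}" by blast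
      hence "\<phi> x = Inf {}" unfolding return_time_def by (rule arg_cong)
      thus ?thesis using False by auto
    qed
  qed
  also have "\<dots> \<in> sets M" by measurable
  finally show "\<phi> -` {n} \<inter> space M \<in> sets M" .
qed auto

lemma F_meas [measurable]: "F \<in> measurable M M"
  unfolding first_return_map_def[abs_def]
  by (rule measurable_compose_countable[of "\<lambda>n x. (f ^^ n) x"]) measurable

lemma hit_meas [measurable]:
  assumes [measurable]: "A \<in> sets M" shows "hit n A \<in> sets M"
  unfolding hit_def by measurable

lemma ret_meas [measurable]:
  assumes [measurable]: "A \<in> sets M" shows "ret n A \<in> sets M"
  unfolding ret_def by measurable

lemma ret_Y: "ret n A \<subseteq> Y" by (auto simp: ret_def)

text \<open>A point whose image first hits \<open>Y\<close> at time \<open>n\<close> either lies outside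
  \<open>Y\<close>, and hits at time \<open>n + 1\<close>, or lies in \<open>Y\<close>, and
  returns at time \<open>n + 1\<close>. As \<open>f\<close> preserves the measure, this identity
  yields the invariance of the first return map, Kac's formula and the flow of mass used to pass
  from \<open>Y\<close> to the whole space.\<close>

lemma vimage_hit:
  assumes "A \<subseteq> Y"
  shows "f -` hit n A \<inter> space M = hit (Suc n) A \<union> ret (Suc n) A"
proof (rule set_eqI)
  fix x
  have a: "x \<in> f -` hit n A \<inter> space M \<longleftrightarrow> x \<in> space M \<and> (\<forall>i<n. (f ^^ Suc i) x \<notin> Y) \<and> (f ^^ Suc n) x \<in> A"
    using f_space by (auto simp: hit_def funpow_swap1)
  have b: "x \<in> hit (Suc n) A \<longleftrightarrow> x \<in> space M \<and> x \<notin> Y \<and> (\<forall>i<n. (f ^^ Suc i) x \<notin> Y) \<and> (f ^^ Suc n) x \<in> A"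
    unfolding hit_def lessThan_Suc_eq_insert_0 by (auto simp del: funpow.simps(2))
  have c: "x \<in> ret (Suc n) A \<longleftrightarrow> x \<in> space M \<and> x \<in> Y \<and> (\<forall>i<n. (f ^^ Suc i) x \<notin> Y) \<and> (f ^^ Suc n) x \<in> A"
  proof -
    have "{1..<Suc n} = Suc ` {..<n}" by (auto simp: image_iff gr0_conv_Suc Suc_le_eq)
    hence "(\<forall>i\<in>{1..<Suc n}. (f ^^ i) x \<notin> Y) \<longleftrightarrow> (\<forall>i<n. (f ^^ Suc i) x \<notin> Y)" by auto
    thus ?thesis by (simp add: ret_def del: funpow.simps(2))
  qed
  show "x \<in> f -` hit n A \<inter> space M \<longleftrightarrow> x \<in> hit (Suc n) A \<union> ret (Suc n) A"
    using a b c by blast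
qed

lemma hit_ret_disjoint: "hit (Suc n) A \<inter> ret (Suc n) A' = {}"
  unfolding hit_def ret_def lessThan_Suc_eq_insert_0 by auto

lemma ret_disjoint:
  assumes "A \<subseteq> Y" shows "disjoint_family (\<lambda>n. ret (Suc n) A)"
proof -
  have "m = n" if "x \<in> ret (Suc m) A" "x \<in> ret (Suc n) A" for m n x
  proof (rule ccontr)
    assume "m \<noteq> n"
    hence "Suc m \<in> {1..<Suc n} \<or> Suc n \<in> {1..<Suc m}" by auto
    thus False using that assms unfolding ret_def by blast
  qed
  thus ?thesis by (auto simp: disjoint_family_on_def)
qed

lemma emeasure_hit_Suc:
  assumes A: "A \<in> sets M" "A \<subseteq> Y"
  shows "emeasure M (hit n A) = emeasure M (hit (Suc n) A) + emeasure M (ret (Suc n) A)"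
proof -
  have "emeasure M (hit n A) = emeasure M (f -` hit n A \<inter> space M)"
    using A by (intro emeasure_vimage[symmetric] hit_meas)
  also have "\<dots> = emeasure M (hit (Suc n) A) + emeasure M (ret (Suc n) A)"
    unfolding vimage_hit[OF A(2)] using A hit_ret_disjoint by (intro plus_emeasure[symmetric] hit_meas ret_meas) auto
  finally show ?thesis .
qed

lemma hit_0: "A \<in> sets M \<Longrightarrow> hit 0 A = A"
  using sets.sets_into_space by (auto simp: hit_def)

lemma emeasure_hit_le:
  assumes A: "A \<in> sets M" "A \<subseteq> Y" shows "emeasure M (hit n A) \<le> 1"
proof (induction n)
  case 0
  have "emeasure M A \<le> emeasure M Y" by (intro emeasure_mono A Y)
  thus ?case using A Y1 by (simp add: hit_0)
next
  case (Suc n)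
  have "emeasure M (hit (Suc n) A) \<le> emeasure M (hit n A)" using emeasure_hit_Suc[OF A, of n] by simp
  with Suc show ?case by (rule order.trans[rotated])
qed

lemma emeasure_hit_fin: "A \<in> sets M \<Longrightarrow> A \<subseteq> Y \<Longrightarrow> emeasure M (hit n A) < \<infinity>"
  using emeasure_hit_le[of A n] by (simp add: le_less_trans)

lemma emeasure_subset_Y_fin: "A \<subseteq> Y \<Longrightarrow> emeasure M A < \<infinity>"
proof -
  assume "A \<subseteq> Y"
  hence "emeasure M A \<le> emeasure M Y" by (intro emeasure_mono Y)
  thus ?thesis using Y1 by (simp add: le_less_trans)
qed

lemma measure_hit_Suc:
  assumes A: "A \<in> sets M" "A \<subseteq> Y"
  shows "measure M (hit n A) = measure M (hit (Suc n) A) + measure M (ret (Suc n) A)"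
proof -
  have "emeasure M (ret (Suc n) A) < \<infinity>" using ret_Y by (rule emeasure_subset_Y_fin)
  thus ?thesis using emeasure_hit_Suc[OF A, of n] emeasure_hit_fin[OF A, of "Suc n"]
    unfolding measure_def by (simp add: enn2real_plus)
qed

lemma measure_hit_sum:
  assumes A: "A \<in> sets M" "A \<subseteq> Y"
  shows "measure M A = measure M (hit n A) + (\<Sum>j<n. measure M (ret (Suc j) A))"
proof (induction n)
  case 0 show ?case using A by (simp add: hit_0)
next
  case (Suc n) thus ?case using measure_hit_Suc[OF A, of n] by simp
qed

text \<open>The points of \<open>Y\<close> that never return form a wandering set.\<close>

lemma AE_returns: "AE y in M. y \<in> Y \<longrightarrow> (\<exists>m\<ge>1. (f ^^ m) y \<in> Y)"
proof -
  define W where "W = {y \<in> space M. y \<in> Y \<and> (\<forall>m\<in>{1..}. (f ^^ m) y \<notin> Y)}"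
  have W [measurable]: "W \<in> sets M" unfolding W_def by measurable
  have no: False if "i < j" "(f ^^ i) x \<in> W" "(f ^^ j) x \<in> W" for i j x
  proof -
    have "(f ^^ j) x = (f ^^ (j - i)) ((f ^^ i) x)" using that(1) by (metis funpow_add comp_apply le_add_diff_inverse2 less_imp_le)
    moreover have "j - i \<in> {1..}" using that by auto
    ultimately show False using that(2,3) unfolding W_def by auto
  qed
  have "disjoint_family (\<lambda>n. (f ^^ n) -` W \<inter> space M)"
    unfolding disjoint_family_on_def
  proof (intro ballI impI)
    fix i j :: nat assume "i \<noteq> j"
    thus "((f ^^ i) -` W \<inter> space M) \<inter> ((f ^^ j) -` W \<inter> space M) = {}"
      using no[of i j] no[of j i] by (auto simp: neq_iff)
  qed
  hence "emeasure M W = 0" using cons W unfolding conservative_map_def wandering_set_def by blast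
  hence "AE x in M. x \<notin> W" by (intro AE_not_in) (auto simp: null_sets_def)
  thus ?thesis using AE_space by eventually_elim (auto simp: W_def)
qed

lemma AE_ret: "AE y in M. y \<in> Y \<longrightarrow> (\<forall>n A. A \<subseteq> Y \<longrightarrow> (y \<in> ret (Suc n) A \<longleftrightarrow> \<phi> y = Suc n \<and> F y \<in> A))"
  using AE_returns AE_space
proof eventually_elim
  case (elim y)
  show ?case
  proof (intro impI allI)
    fix n A assume y: "y \<in> Y" and A: "A \<subseteq> Y"
    have "\<phi> y = Suc n \<longleftrightarrow> (f ^^ Suc n) y \<in> Y \<and> (\<forall>i\<in>{1..<Suc n}. (f ^^ i) y \<notin> Y)"
      using elim y by (intro return_time_eq) auto
    thus "y \<in> ret (Suc n) A \<longleftrightarrow> \<phi> y = Suc n \<and> F y \<in> A"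
      using elim y A unfolding ret_def first_return_map_def by auto
  qed
qed

lemma AE_F_Y: "AE y in M. y \<in> Y \<longrightarrow> \<phi> y \<ge> 1 \<and> F y \<in> Y \<and> (\<forall>i\<in>{1..<\<phi> y}. (f ^^ i) y \<notin> Y)"
  using AE_returns
proof eventually_elim
  case (elim y)
  show ?case
  proof
    assume "y \<in> Y"
    hence ex: "\<exists>m\<ge>1. (f ^^ m) y \<in> Y" using elim by blast
    from return_time_ge_1[OF this] return_time_eq[OF return_time_ge_1[OF this] this]
    show "\<phi> y \<ge> 1 \<and> F y \<in> Y \<and> (\<forall>i\<in>{1..<\<phi> y}. (f ^^ i) y \<notin> Y)"
      by (simp add: first_return_map_def)
  qed
qed

lemma measure_F:
  assumes A: "A \<in> sets M" "A \<subseteq> Y"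
  shows "(\<lambda>n. \<Sum>j<n. measure M (ret (Suc j) A)) \<longlonglongrightarrow> measure M {y \<in> Y. F y \<in> A}"
proof -
  have [measurable]: "A \<in> sets M" by fact
  have "(\<lambda>j. measure M (ret (Suc j) A)) sums measure M (\<Union>j. ret (Suc j) A)"
    using emeasure_subset_Y_fin[of "\<Union>j. ret (Suc j) A"] ret_Y
    by (intro measure_UNION ret_disjoint A) (auto simp: less_top)
  moreover have "measure M (\<Union>j. ret (Suc j) A) = measure M {y \<in> Y. F y \<in> A}"
  proof (rule measure_eq_AE)
    show "AE y in M. (y \<in> (\<Union>j. ret (Suc j) A)) = (y \<in> {y \<in> Y. F y \<in> A})"
      using AE_ret AE_F_Y
    proof eventually_elim
      case (elim y)
      show ?case
      proof (cases "y \<in> Y")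
        case True
        then obtain n where "\<phi> y = Suc n" using elim(2) by (cases "\<phi> y") auto
        thus ?thesis using elim(1) True A(2) by auto
      next
        case False
        thus ?thesis using ret_Y by blast
      qed
    qed
    have "{y \<in> Y. F y \<in> A} = {y \<in> space M. y \<in> Y \<and> F y \<in> A}" using Y_space by auto
    thus "{y \<in> Y. F y \<in> A} \<in> sets M" by simp
  qed auto
  ultimately show ?thesis by (simp add: sums_def)
qed

lemma hit_tendsto_0: "(\<lambda>n. measure M (hit n Y)) \<longlonglongrightarrow> 0"
proof -
  have "measure M {y \<in> Y. F y \<in> Y} = measure M Y"
  proof (rule measure_eq_AE)
    show "AE y in M. (y \<in> {y \<in> Y. F y \<in> Y}) = (y \<in> Y)" using AE_F_Y by eventually_elim auto
    have "{y \<in> Y. F y \<in> Y} = {y \<in> space M. y \<in> Y \<and> F y \<in> Y}" using Y_space by auto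
    thus "{y \<in> Y. F y \<in> Y} \<in> sets M" by simp
  qed (rule Y)
  hence "(\<lambda>n. measure M Y - (\<Sum>j<n. measure M (ret (Suc j) Y))) \<longlonglongrightarrow> measure M Y - measure M Y"
    using measure_F[OF Y] by (intro tendsto_intros) auto
  moreover have "measure M Y - (\<Sum>j<n. measure M (ret (Suc j) Y)) = measure M (hit n Y)" for n
    using measure_hit_sum[OF Y, of n] by simp
  ultimately show ?thesis by simp
qed

text \<open>The first return map preserves the measure on \<open>Y\<close>: the mass of \<open>A\<close> is
  the mass returning to \<open>A\<close> within \<open>n\<close> steps plus that of \<open>hit n
  A\<close>, which tends to \<open>0\<close>.\<close>

lemma measure_first_return:
  assumes A: "A \<in> sets M" "A \<subseteq> Y"
  shows "measure M {y \<in> Y. F y \<in> A} = measure M A"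
proof -
  have le: "measure M (hit n A) \<le> measure M (hit n Y)" for n
    using A emeasure_hit_fin[OF Y, of n] by (intro measure_mono_fmeasurable) (auto simp: hit_def fmeasurable_def)
  have "(\<lambda>n. measure M (hit n A)) \<longlonglongrightarrow> 0"
    by (rule tendsto_sandwich[OF _ _ tendsto_const hit_tendsto_0]) (auto intro: always_eventually le)
  hence "(\<lambda>n. measure M (hit n A) + (\<Sum>j<n. measure M (ret (Suc j) A))) \<longlonglongrightarrow> 0 + measure M {y \<in> Y. F y \<in> A}"
    by (intro tendsto_add measure_F A)
  moreover have "measure M (hit n A) + (\<Sum>j<n. measure M (ret (Suc j) A)) = measure M A" for n
    using measure_hit_sum[OF A, of n] by simp
  ultimately have "(\<lambda>n::nat. measure M A) \<longlonglongrightarrow> 0 + measure M {y \<in> Y. F y \<in> A}" by (simp only:)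
  from LIMSEQ_unique[OF this tendsto_const] show ?thesis by simp
qed

definition tail :: "nat \<Rightarrow> real" where "tail n = measure M {y \<in> Y. \<phi> y > n}"

lemma AE_ret_eq: "AE y in M. y \<in> ret (Suc n) Y \<longleftrightarrow> y \<in> Y \<and> \<phi> y = Suc n"
  using AE_ret AE_F_Y
proof eventually_elim
  case (elim y)
  thus ?case using ret_Y[of "Suc n" Y] by blast
qed

lemma ret_eq_level: "measure M (ret (Suc n) Y) = measure M {y \<in> Y. \<phi> y = Suc n}"
proof (rule measure_eq_AE)
  show "AE y in M. (y \<in> ret (Suc n) Y) = (y \<in> {y \<in> Y. \<phi> y = Suc n})"
    using AE_ret_eq[of n] by eventually_elim auto
  have "{y \<in> Y. \<phi> y = Suc n} = {y \<in> space M. y \<in> Y \<and> \<phi> y = Suc n}" using Y_space by auto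
  thus "{y \<in> Y. \<phi> y = Suc n} \<in> sets M" by simp
qed auto

text \<open>Both sides are the part of the mass \<open>1\<close> of \<open>Y\<close> that is not exhausted
  by the returns up to time \<open>n\<close>.\<close>

lemma measure_hit_eq_tail: "measure M (hit n Y) = tail n"
proof -
  have [measurable]: "{y \<in> Y. \<phi> y \<in> B} \<in> sets M" for B
  proof -
    have "{y \<in> Y. \<phi> y \<in> B} = {y \<in> space M. y \<in> Y \<and> \<phi> y \<in> B}" using Y_space by auto
    thus ?thesis by simp
  qed
  have "measure M Y = measure M {y \<in> Y. \<phi> y \<in> {n<..} \<union> {1..n}}"
    using AE_F_Y by (intro measure_eq_AE) (auto elim!: eventually_mono)
  also have "{y \<in> Y. \<phi> y \<in> {n<..} \<union> {1..n}} = {y \<in> Y. \<phi> y \<in> {n<..}} \<union> (\<Union>j\<in>{..<n}. {y \<in> Y. \<phi> y \<in> {Suc j}})"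
  proof -
    have "{1..n} = (\<Union>j\<in>{..<n}. {Suc j})" by (auto simp: image_iff gr0_conv_Suc Suc_le_eq)
    thus ?thesis by auto
  qed
  also have "measure M \<dots> = measure M {y \<in> Y. \<phi> y \<in> {n<..}} + measure M (\<Union>j\<in>{..<n}. {y \<in> Y. \<phi> y \<in> {Suc j}})"
    using emeasure_subset_Y_fin[of "{y \<in> Y. \<phi> y \<in> {n<..}}"] emeasure_subset_Y_fin[of "\<Union>j\<in>{..<n}. {y \<in> Y. \<phi> y \<in> {Suc j}}"]
    by (intro measure_Union) (auto simp: less_top)
  also have "measure M (\<Union>j\<in>{..<n}. {y \<in> Y. \<phi> y \<in> {Suc j}}) = (\<Sum>j<n. measure M {y \<in> Y. \<phi> y \<in> {Suc j}})"
  proof (rule measure_finite_Union)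
    show "emeasure M {y \<in> Y. \<phi> y \<in> {Suc j}} \<noteq> \<infinity>" for j
      using emeasure_subset_Y_fin[of "{y \<in> Y. \<phi> y \<in> {Suc j}}"] by (auto simp: less_top)
  qed (auto simp: disjoint_family_on_def)
  finally have "measure M Y = tail n + (\<Sum>j<n. measure M (ret (Suc j) Y))"
    by (simp add: tail_def ret_eq_level greaterThan_def)
  thus ?thesis using measure_hit_sum[OF Y, of n] by simp
qed

lemma tail_tendsto_0: "tail \<longlonglongrightarrow> 0"
  using hit_tendsto_0 by (simp add: measure_hit_eq_tail)

lemma tail_0: "tail 0 = 1"
  using measure_hit_eq_tail[of 0] measure_Y by (simp add: hit_0)

lemma level_eq_tail_diff: "measure M {y \<in> Y. \<phi> y = Suc n} = tail n - tail (Suc n)"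
  using measure_hit_Suc[OF Y order_refl, of n] by (simp add: measure_hit_eq_tail ret_eq_level)

lemma tail_decseq: "decseq tail"
  unfolding decseq_Suc_iff using level_eq_tail_diff measure_nonneg[of M] by (smt (verit, best))

lemma AE_hit: "AE x in M. \<exists>k. x \<in> hit k Y"
  using sweep AE_space
proof eventually_elim
  case (elim x)
  define k where "k = (LEAST k. (f ^^ k) x \<in> Y)"
  have "(f ^^ k) x \<in> Y" unfolding k_def using elim(1) by (rule LeastI_ex)
  moreover have "(f ^^ i) x \<notin> Y" if "i < k" for i using that unfolding k_def by (rule not_less_Least)
  ultimately show ?case using elim by (auto simp: hit_def)
qed

text \<open>Kac's formula: the sets \<open>hit k Y\<close> cover the space up to a null set, so its measure
  is at most the sum of the tail.\<close>

lemma kac: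
  assumes inf: "emeasure M (space M) = \<infinity>"
  shows "\<not> summable tail"
proof
  assume sm: "summable tail"
  have t0: "tail n \<ge> 0" for n by (simp add: tail_def)
  have "emeasure M (space M) = emeasure M (\<Union>k. hit k Y)"
    using AE_hit AE_space by (intro emeasure_eq_AE) (auto elim!: eventually_elim2 simp: hit_def)
  also have "\<dots> \<le> (\<Sum>k. emeasure M (hit k Y))" by (rule emeasure_subadditive_countably) auto
  also have "\<dots> = (\<Sum>k. ennreal (tail k))"
    using emeasure_hit_fin[OF Y order_refl]
    by (intro suminf_cong) (simp add: measure_hit_eq_tail[symmetric] emeasure_eq_ennreal_measure less_top)
  also have "\<dots> = ennreal (\<Sum>k. tail k)" by (rule suminf_ennreal2[OF t0 sm])
  finally have "emeasure M (space M) \<le> ennreal (\<Sum>k. tail k)" .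
  also have "\<dots> < \<infinity>" by simp
  finally show False using inf by simp
qed

end

section \<open>From the reference set to the whole space\<close>

context first_return begin

lemma integrable_indicator_Y: "integrable M (indicator Y :: 'a \<Rightarrow> real)"
  using Y1 by simp

lemma Lpow_indicator_Y: "AE x in M. \<forall>n. 0 \<le> LY n x \<and> LY n x \<le> 1"
  unfolding AE_all_countable
proof
  fix n
  have "AE x in M. 0 \<le> LY n x"
    by (intro transfer.L_nonneg[OF transfer_funpow] integrable_indicator_Y) auto
  moreover have "AE x in M. LY n x \<le> 1"
    by (intro transfer.L_le_const[OF transfer_funpow] integrable_indicator_Y) (auto simp: indicator_def)
  ultimately show "AE x in M. 0 \<le> LY n x \<and> LY n x \<le> 1"
    by eventually_elim simp
qed

text \<open>The function \<open>L\<^sup>k\<close> of the indicator of \<open>hit k Y\<close> is carried by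
  \<open>Y\<close> because \<open>f\<^sup>k\<close> maps \<open>hit k Y\<close> into
  \<open>Y\<close>.\<close>

lemma Lpow_hit_le: "AE x in M. (L ^^ k) (indicator (hit k Y)) x \<le> indicator Y x"
proof (rule AE_le_of_integrals)
  have ih: "integrable M (indicator (hit k Y) :: 'a \<Rightarrow> real)"
    using emeasure_hit_fin[OF Y order_refl, of k] by simp
  show "integrable M ((L ^^ k) (indicator (hit k Y)))" by (rule integrable_Lpow[OF ih])
  show "integrable M (indicator Y :: 'a \<Rightarrow> real)" by (rule integrable_indicator_Y)
  fix A assume [measurable]: "A \<in> sets M"
  have iYA: "integrable M (indicator (Y \<inter> A) :: 'a \<Rightarrow> real)"
    using emeasure_subset_Y_fin[of "Y \<inter> A"] by simp
  have "(\<integral>x. (L ^^ k) (indicator (hit k Y)) x * indicator A x \<partial>M) = (\<integral>x. indicator (hit k Y) x * indicator A ((f ^^ k) x) \<partial>M)"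
    by (rule transfer.dual_indicator[OF transfer_funpow ih]) measurable
  also have "\<dots> \<le> (\<integral>x. indicator (Y \<inter> A) ((f ^^ k) x) \<partial>M)"
  proof (rule integral_mono)
    show "integrable M (\<lambda>x. indicator (hit k Y) x * indicator A ((f ^^ k) x) :: real)"
      by (rule transfer.integrable_mult_comp_indicator[OF transfer_funpow ih]) measurable
    show "integrable M (\<lambda>x. indicator (Y \<inter> A) ((f ^^ k) x) :: real)"
      by (rule transfer.integrable_comp[OF transfer_funpow iYA])
    show "indicator (hit k Y) x * indicator A ((f ^^ k) x) \<le> (indicator (Y \<inter> A) ((f ^^ k) x) :: real)" for x
      by (auto simp: indicator_def hit_def)
  qed
  also have "\<dots> = (\<integral>x. indicator (Y \<inter> A) x \<partial>M)"
    by (rule transfer.integral_comp[OF transfer_funpow]) measurable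
  also have "\<dots> = (\<integral>x. indicator Y x * indicator A x \<partial>M)"
    by (simp add: indicator_inter_arith)
  finally show "(\<integral>x. (L ^^ k) (indicator (hit k Y)) x * indicator A x \<partial>M) \<le> (\<integral>x. indicator Y x * indicator A x \<partial>M)" .
qed

lemma S_hit_le: "AE x in M. \<forall>n. S n (indicator (hit k Y)) x \<le> real k + SY n x"
proof -
  have ih: "integrable M (indicator (hit k Y) :: 'a \<Rightarrow> real)"
    using emeasure_hit_fin[OF Y order_refl, of k] by simp
  have "AE x in M. \<forall>n. S n ((L ^^ k) (indicator (hit k Y))) x \<le> SY n x"
    by (rule S_mono[OF integrable_Lpow[OF ih] integrable_indicator_Y Lpow_hit_le])
  moreover have "AE x in M. \<forall>j. \<bar>(L ^^ j) (indicator (hit k Y)) x\<bar> \<le> 1"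
    by (rule Lpow_abs_le_const[OF ih]) (auto simp: indicator_def)
  moreover have "AE x in M. \<forall>j. 0 \<le> (L ^^ j) (indicator (hit k Y)) x"
    unfolding AE_all_countable by (intro allI transfer.L_nonneg[OF transfer_funpow] ih) auto
  ultimately show ?thesis
  proof eventually_elim
    case (elim x)
    show ?case
    proof
      fix n
      have "S k (indicator (hit k Y)) x \<le> (\<Sum>j<k. 1)"
        unfolding S_def using elim(2) by (intro sum_mono) (metis abs_le_D1)
      moreover have "0 \<le> (\<Sum>j<k. (L ^^ (n + j)) (indicator (hit k Y)) x)"
        using elim(3) by (intro sum_nonneg) blast
      ultimately show "S n (indicator (hit k Y)) x \<le> real k + SY n x"
        using S_diff_iterate[of n "indicator (hit k Y)" x k] elim(1)[rule_format, of n] by simp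
    qed
  qed
qed

text \<open>A maximum principle. Outside \<open>Y\<close> one has \<open>S\<^sub>m\<^sub>+\<^sub>1 = L
  S\<^sub>m\<close>, so a bound for \<open>S\<^sub>m\<close> propagates to
  \<open>S\<^sub>m\<^sub>+\<^sub>1\<close>; on \<open>Y\<close> the bound is assumed, since the
  sums increase.\<close>

lemma S_indicator_max_principle:
  assumes K: "K > 0" and le: "AE x in M. x \<in> Y \<longrightarrow> SY n x \<le> K"
  shows "AE x in M. SY n x \<le> K"
proof -
  have "AE x in M. SY m x \<le> K" if "m \<le> n" for m
    using that
  proof (induction m)
    case 0
    show ?case using K by simp
  next
    case (Suc m)
    have "AE x in M. L (SY m) x \<le> K"
      using Suc by (intro L_le_const integrable_S integrable_indicator_Y K) auto
    with L_S[OF integrable_indicator_Y] le Lpow_indicator_Y show ?case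
    proof eventually_elim
      case (elim x)
      show ?case
      proof (cases "x \<in> Y")
        case True
        have "SY (Suc m) x \<le> SY n x"
          unfolding S_def using elim(3) Suc.prems by (intro sum_mono2) auto
        thus ?thesis using elim(2) True by linarith
      next
        case False
        thus ?thesis using elim(1)[rule_format, of m] elim(4) by simp
      qed
    qed
  qed
  thus ?thesis by simp
qed

text \<open>The normalised sums \<open>g\<^sub>m\<close> satisfy \<open>L g\<^sub>m = g\<^sub>m +
  O(b\<^sub>m)\<close>. It follows that the supremum \<open>D\<^sub>n\<close> of \<open>|g\<^sub>m
  - c|\<close> over \<open>m \<ge> n\<close> is almost subharmonic: its integral over
  \<open>E\<close> is at most the one over the preimage of \<open>E\<close>, up to a small
  multiple of the measure of \<open>E\<close>. Applied \<open>J\<close> times, starting with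
  \<open>hit k Y\<close>, this moves the mass to \<open>hit (k + J) Y\<close>, which has small
  measure, and to \<open>Y\<close>, where \<open>D\<^sub>n\<close> tends to \<open>0\<close>.\<close>

theorem convergence_extends:
  assumes b: "\<And>n. b n \<ge> 0" "b \<longlonglongrightarrow> 0"
    and bd: "AE x in M. x \<in> Y \<longrightarrow> (\<forall>n. b n * SY n x \<le> K)"
    and lim: "AE x in M. x \<in> Y \<longrightarrow> (\<lambda>n. b n * SY n x) \<longlonglongrightarrow> c"
  shows "AE x in M. (\<lambda>n. b n * SY n x) \<longlonglongrightarrow> c"
proof -
  define K1 where "K1 = \<bar>K\<bar> + 1"
  define K2 where "K2 = K1 + \<bar>c\<bar>"
  have K1: "K1 > 0" and K2: "K2 > 0" by (auto simp: K1_def K2_def)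
  define g where "g m x = b m * SY m x" for m x
  have ig: "integrable M (g m)" for m
    unfolding g_def[abs_def] by (intro integrable_mult_right integrable_S integrable_indicator_Y)
  have bdX: "AE x in M. \<forall>m. 0 \<le> g m x \<and> g m x \<le> K1"
    unfolding AE_all_countable
  proof
    fix m
    have nn: "AE x in M. 0 \<le> g m x"
      using Lpow_indicator_Y by eventually_elim (auto simp: g_def S_def b intro!: mult_nonneg_nonneg sum_nonneg)
    have "AE x in M. g m x \<le> K1"
    proof (cases "b m = 0")
      case False
      hence bm: "b m > 0" using b(1)[of m] by simp
      have "AE x in M. SY m x \<le> K1 / b m"
      proof (rule S_indicator_max_principle)
        show "K1 / b m > 0" using K1 bm by simp
        show "AE x in M. x \<in> Y \<longrightarrow> SY m x \<le> K1 / b m"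
          using bd
        proof eventually_elim
          case (elim x)
          show ?case
          proof
            assume "x \<in> Y"
            hence "b m * SY m x \<le> K" using elim by blast
            also have "K \<le> K1" by (simp add: K1_def)
            finally show "SY m x \<le> K1 / b m" using bm by (simp add: pos_le_divide_eq mult.commute)
          qed
        qed
      qed
      thus ?thesis by eventually_elim (use bm in \<open>simp add: g_def pos_le_divide_eq mult.commute\<close>)
    qed (use K1 in \<open>simp add: g_def\<close>)
    with nn show "AE x in M. 0 \<le> g m x \<and> g m x \<le> K1" by eventually_elim simp
  qed
  \<comment> \<open>Truncation makes the bounds of \<open>g\<close> hold everywhere, so that the
    suprema below exist at every point.\<close>
  define g' where "g' m x = max 0 (min K1 (g m x))" for m x
  have gm [measurable]: "g m \<in> borel_measurable M" for m using ig by auto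
  have g'm [measurable]: "g' m \<in> borel_measurable M" for m unfolding g'_def[abs_def] by measurable
  have gg': "AE x in M. \<forall>m. g' m x = g m x" using bdX by eventually_elim (simp add: g'_def)
  define h where "h m x = \<bar>g' m x - c\<bar>" for m x
  have hm [measurable]: "h m \<in> borel_measurable M" for m unfolding h_def[abs_def] by measurable
  have h0: "0 \<le> h m x" and hK: "h m x \<le> K2" for m x
    using K1 by (auto simp: h_def g'_def K2_def max_def min_def)
  define R where "R n = running_max (\<lambda>i. h (n + i))" for n
  have Rm [measurable]: "R n j \<in> borel_measurable M" for n j
    unfolding R_def by (induction j) auto
  have R0: "0 \<le> R n j x" and RK: "R n j x \<le> K2" for n j x
    using running_max_attained[of j "\<lambda>i. h (n + i)" x] h0 hK unfolding R_def by metis+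
  define D where "D n x = (SUP j. R n j x)" for n x
  have bdR: "bdd_above (range (\<lambda>j. R n j x))" for n x by (rule bdd_aboveI[of _ K2]) (use RK in auto)
  have RD: "(\<lambda>j. R n j x) \<longlonglongrightarrow> D n x" for n x
    unfolding D_def by (rule LIMSEQ_incseq_SUP[OF bdR]) (auto simp: incseq_def R_def intro: running_max_mono)
  have Dm [measurable]: "D n \<in> borel_measurable M" for n
    by (rule borel_measurable_LIMSEQ_real[OF RD Rm])
  have RleD: "R n j x \<le> D n x" for n j x unfolding D_def by (rule cSUP_upper[OF _ bdR]) simp
  have D0: "0 \<le> D n x" for n x using order.trans[OF R0 RleD] .
  have DK: "D n x \<le> K2" for n x unfolding D_def by (rule cSUP_least) (use RK in auto)
  have hD: "h m x \<le> D n x" if "n \<le> m" for m n x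
  proof -
    have "h (n + (m - n)) x \<le> R n (m - n) x" unfolding R_def by (rule running_max_upper) simp
    thus ?thesis using RleD[of n "m - n" x] that by simp
  qed
  have Dle: "D n x \<le> z" if "\<And>m. n \<le> m \<Longrightarrow> h m x \<le> z" for n x z
    unfolding D_def
  proof (rule cSUP_least)
    fix j
    obtain i where "R n j x = h (n + i) x"
      using running_max_attained[of j "\<lambda>i. h (n + i)" x] unfolding R_def by blast
    thus "R n j x \<le> z" using that by simp
  qed simp
  have Ddec: "decseq (\<lambda>n. D n x)" for x
    unfolding decseq_def by (intro allI impI Dle hD) simp
  have intb: "integrable M (\<lambda>x. q x * indicator E x)"
    if q: "q \<in> borel_measurable M" "\<And>x. \<bar>q x\<bar> \<le> K2" and E: "E \<in> sets M" "emeasure M E < \<infinity>" for q E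
  proof (rule Bochner_Integration.integrable_bound)
    show "integrable M (\<lambda>x. K2 * indicator E x)" using E by simp
    show "(\<lambda>x. q x * indicator E x) \<in> borel_measurable M" using q E by measurable
    show "AE x in M. norm (q x * indicator E x) \<le> norm (K2 * indicator E x)"
      using q(2) K2 by (intro AE_I2) (auto simp: indicator_def)
  qed
  have intbf: "integrable M (\<lambda>x. q x * indicator E (f x))"
    if q: "q \<in> borel_measurable M" "\<And>x. \<bar>q x\<bar> \<le> K2" and E: "E \<in> sets M" "emeasure M E < \<infinity>" for q E
  proof (rule Bochner_Integration.integrable_bound)
    have "integrable M (\<lambda>x. indicator E (f x) :: real)" using E by (intro integrable_comp) simp
    thus "integrable M (\<lambda>x. K2 * indicator E (f x))" by simp
    show "(\<lambda>x. q x * indicator E (f x)) \<in> borel_measurable M" using q E by measurable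
    show "AE x in M. norm (q x * indicator E (f x)) \<le> norm (K2 * indicator E (f x))"
      using q(2) K2 by (intro AE_I2) (auto simp: indicator_def)
  qed
  \<comment> \<open>The property that is stable under maxima, because \<open>E\<close> can be split
    according to which function is larger.\<close>
  define sub where "sub n \<delta> q \<longleftrightarrow> (\<forall>E\<in>sets M. emeasure M E < \<infinity> \<longrightarrow>
     (\<integral>x. q x * indicator E x \<partial>M) \<le> (\<integral>x. D n x * indicator E (f x) \<partial>M) + \<delta> * measure M E)"
    for n \<delta> and q :: "'a \<Rightarrow> real"
  have D1: "\<bar>D n x\<bar> \<le> K2" for n x using D0[of n x] DK[of n x] by simp
  \<comment> \<open>For a single \<open>m\<close> and either sign the estimate is duality together
    with \<open>L g\<^sub>m = g\<^sub>m + b\<^sub>m r\<close>, where \<open>|r| \<le>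
    1\<close>.\<close>
  have sub1: "sub n \<delta> (\<lambda>x. \<sigma> * (g' m x - c))" if \<sigma>: "\<bar>\<sigma>\<bar> = 1" and m: "n \<le> m" and \<delta>: "b m \<le> \<delta>" for n \<delta> \<sigma> m
    unfolding sub_def
  proof (intro ballI impI)
    fix E assume E [measurable]: "E \<in> sets M" and Ef: "emeasure M E < \<infinity>"
    have iE: "integrable M (indicator E :: 'a \<Rightarrow> real)" using Ef by simp
    have iEf: "integrable M (\<lambda>x. indicator E (f x) :: real)" using iE by (rule integrable_comp)
    define r where "r x = LY m x - indicator Y x" for x
    have ir: "integrable M r" unfolding r_def[abs_def] by (intro Bochner_Integration.integrable_diff integrable_Lpow integrable_indicator_Y)
    have irE: "integrable M (\<lambda>x. r x * indicator E x)" by (rule integrable_real_mult_indicator[OF E ir])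
    have Lg: "AE x in M. L (g m) x = g m x + b m * r x"
      using L_scale[OF integrable_S[OF integrable_indicator_Y], of "b m" m] L_S[OF integrable_indicator_Y]
      unfolding g_def[abs_def]
    proof eventually_elim
      case (elim x)
      have "SY (Suc m) x = SY m x + LY m x" by (simp add: S_def)
      hence "L (SY m) x = r x + SY m x"
        using elim(2)[rule_format, of m] by (simp add: r_def)
      thus ?case using elim(1) by (simp add: algebra_simps)
    qed
    have igE: "integrable M (\<lambda>x. g m x * indicator E x)" by (rule integrable_real_mult_indicator[OF E ig])
    have igEf: "integrable M (\<lambda>x. g m x * indicator E (f x))" by (rule integrable_mult_comp_indicator[OF ig E])
    have "(\<integral>x. g m x * indicator E (f x) \<partial>M) = (\<integral>x. L (g m) x * indicator E x \<partial>M)"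
      by (rule dual_indicator[OF ig E, symmetric])
    also have "\<dots> = (\<integral>x. g m x * indicator E x + b m * (r x * indicator E x) \<partial>M)"
    proof (rule integral_cong_AE)
      show "(\<lambda>x. L (g m) x * indicator E x) \<in> borel_measurable M" using integrable_L[OF ig, of m] by measurable
      show "(\<lambda>x. g m x * indicator E x + b m * (r x * indicator E x)) \<in> borel_measurable M" using ir by measurable
      show "AE x in M. L (g m) x * indicator E x = g m x * indicator E x + b m * (r x * indicator E x)"
        using Lg by eventually_elim (simp add: algebra_simps)
    qed
    also have "\<dots> = (\<integral>x. g m x * indicator E x \<partial>M) + b m * (\<integral>x. r x * indicator E x \<partial>M)"
      using igE irE by simp
    finally have e1: "(\<integral>x. g m x * indicator E x \<partial>M) = (\<integral>x. g m x * indicator E (f x) \<partial>M) - b m * (\<integral>x. r x * indicator E x \<partial>M)"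
      by simp
    have "\<bar>\<integral>x. r x * indicator E x \<partial>M\<bar> \<le> (\<integral>x. \<bar>r x * indicator E x\<bar> \<partial>M)" by (rule integral_abs_bound)
    also have "\<dots> \<le> (\<integral>x. indicator E x \<partial>M)"
    proof (rule integral_mono_AE)
      show "integrable M (\<lambda>x. \<bar>r x * indicator E x\<bar>)" using irE by simp
      show "AE x in M. \<bar>r x * indicator E x\<bar> \<le> indicator E x"
        using Lpow_indicator_Y
      proof eventually_elim
        case (elim x)
        have "\<bar>r x\<bar> \<le> 1" using elim[rule_format, of m] by (auto simp: r_def indicator_def)
        thus ?case by (simp add: indicator_def)
      qed
    qed (rule iE)
    finally have e2: "\<bar>\<integral>x. r x * indicator E x \<partial>M\<bar> \<le> measure M E" by simp
    have e3: "(\<integral>x. indicator E (f x) \<partial>M) = measure M E"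
      using integral_comp[of "indicator E :: 'a \<Rightarrow> real"] by simp
    have "(\<integral>x. \<sigma> * (g' m x - c) * indicator E x \<partial>M) = (\<integral>x. \<sigma> * (g m x * indicator E x) - \<sigma> * c * indicator E x \<partial>M)"
    proof (rule integral_cong_AE)
      show "AE x in M. \<sigma> * (g' m x - c) * indicator E x = \<sigma> * (g m x * indicator E x) - \<sigma> * c * indicator E x"
        using gg' by eventually_elim (simp add: algebra_simps)
    qed measurable
    also have "\<dots> = \<sigma> * (\<integral>x. g m x * indicator E x \<partial>M) - \<sigma> * c * measure M E"
      using igE iE by simp
    also have "\<dots> = (\<sigma> * (\<integral>x. g m x * indicator E (f x) \<partial>M) - \<sigma> * c * measure M E) - \<sigma> * b m * (\<integral>x. r x * indicator E x \<partial>M)"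
      unfolding e1 by (simp add: algebra_simps)
    also have "\<sigma> * (\<integral>x. g m x * indicator E (f x) \<partial>M) - \<sigma> * c * measure M E = (\<integral>x. \<sigma> * (g m x * indicator E (f x)) - \<sigma> * c * indicator E (f x) \<partial>M)"
      using igEf iEf e3 by simp
    also have "\<dots> \<le> (\<integral>x. D n x * indicator E (f x) \<partial>M)"
    proof (rule integral_mono_AE)
      show "integrable M (\<lambda>x. \<sigma> * (g m x * indicator E (f x)) - \<sigma> * c * indicator E (f x))" using igEf iEf by simp
      show "integrable M (\<lambda>x. D n x * indicator E (f x))" by (rule intbf[OF Dm D1 E Ef])
      show "AE x in M. \<sigma> * (g m x * indicator E (f x)) - \<sigma> * c * indicator E (f x) \<le> D n x * indicator E (f x)"
        using gg'
      proof eventually_elim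
        case (elim x)
        have "\<sigma> * (g m x - c) \<le> \<bar>\<sigma> * (g m x - c)\<bar>" by simp
        also have "\<dots> = h m x" using elim \<sigma> by (simp add: h_def abs_mult)
        also have "\<dots> \<le> D n x" by (rule hD[OF m])
        finally show ?case by (simp add: indicator_def algebra_simps)
      qed
    qed
    finally have main: "(\<integral>x. \<sigma> * (g' m x - c) * indicator E x \<partial>M) \<le> (\<integral>x. D n x * indicator E (f x) \<partial>M) - \<sigma> * b m * (\<integral>x. r x * indicator E x \<partial>M)"
      by simp
    have "- (\<sigma> * b m * (\<integral>x. r x * indicator E x \<partial>M)) \<le> \<delta> * measure M E"
    proof -
      have "- (\<sigma> * b m * (\<integral>x. r x * indicator E x \<partial>M)) \<le> \<bar>\<sigma> * b m * (\<integral>x. r x * indicator E x \<partial>M)\<bar>" by simp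
      also have "\<dots> = b m * \<bar>\<integral>x. r x * indicator E x \<partial>M\<bar>" using \<sigma> b(1)[of m] by (simp add: abs_mult)
      also have "\<dots> \<le> \<delta> * measure M E" using e2 \<delta> b(1)[of m] by (intro mult_mono) auto
      finally show ?thesis .
    qed
    with main show "(\<integral>x. \<sigma> * (g' m x - c) * indicator E x \<partial>M) \<le> (\<integral>x. D n x * indicator E (f x) \<partial>M) + \<delta> * measure M E"
      by linarith
  qed
  have sub_max: "sub n \<delta> (\<lambda>x. max (p x) (q x))"
    if p: "sub n \<delta> p" "p \<in> borel_measurable M" "\<And>x. \<bar>p x\<bar> \<le> K2"
      and q: "sub n \<delta> q" "q \<in> borel_measurable M" "\<And>x. \<bar>q x\<bar> \<le> K2" for n \<delta> p q
    unfolding sub_def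
  proof (intro ballI impI)
    fix E assume E [measurable]: "E \<in> sets M" and Ef: "emeasure M E < \<infinity>"
    note [measurable] = p(2) q(2)
    define E1 E2 where "E1 = {x \<in> space M. x \<in> E \<and> q x \<le> p x}" and "E2 = {x \<in> space M. x \<in> E \<and> \<not> q x \<le> p x}"
    have E12 [measurable]: "E1 \<in> sets M" "E2 \<in> sets M" unfolding E1_def E2_def by measurable
    have sb: "E1 \<subseteq> E" "E2 \<subseteq> E" by (auto simp: E1_def E2_def)
    have f12: "emeasure M E1 < \<infinity>" "emeasure M E2 < \<infinity>"
      using emeasure_mono[OF sb(1) E] emeasure_mono[OF sb(2) E] Ef by (auto intro: le_less_trans)
    have spl: "indicator E y = (indicator E1 y + indicator E2 y :: real)" if "y \<in> space M" for y
      using that by (auto simp: E1_def E2_def indicator_def)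
    have "(\<integral>x. max (p x) (q x) * indicator E x \<partial>M) = (\<integral>x. p x * indicator E1 x + q x * indicator E2 x \<partial>M)"
      by (intro Bochner_Integration.integral_cong) (auto simp: E1_def E2_def indicator_def)
    also have "\<dots> = (\<integral>x. p x * indicator E1 x \<partial>M) + (\<integral>x. q x * indicator E2 x \<partial>M)"
      using intb[OF p(2,3) E12(1) f12(1)] intb[OF q(2,3) E12(2) f12(2)] by simp
    also have "\<dots> \<le> ((\<integral>x. D n x * indicator E1 (f x) \<partial>M) + \<delta> * measure M E1) + ((\<integral>x. D n x * indicator E2 (f x) \<partial>M) + \<delta> * measure M E2)"
      using p(1) q(1) E12 f12 unfolding sub_def by (intro add_mono) blast+
    also have "\<dots> = ((\<integral>x. D n x * indicator E1 (f x) \<partial>M) + (\<integral>x. D n x * indicator E2 (f x) \<partial>M)) + \<delta> * (measure M E1 + measure M E2)"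
      by (simp add: algebra_simps)
    also have "measure M E1 + measure M E2 = measure M E"
    proof -
      have "measure M (E1 \<union> E2) = measure M E1 + measure M E2"
        using f12 by (intro measure_Union E12) (auto simp: E1_def E2_def less_top)
      moreover have "E1 \<union> E2 = E" using sets.sets_into_space[OF E] by (auto simp: E1_def E2_def)
      ultimately show ?thesis by simp
    qed
    also have "(\<integral>x. D n x * indicator E1 (f x) \<partial>M) + (\<integral>x. D n x * indicator E2 (f x) \<partial>M) = (\<integral>x. D n x * indicator E1 (f x) + D n x * indicator E2 (f x) \<partial>M)"
      using intbf[OF Dm D1 E12(1) f12(1)] intbf[OF Dm D1 E12(2) f12(2)] by simp
    also have "\<dots> = (\<integral>x. D n x * indicator E (f x) \<partial>M)"
      by (intro Bochner_Integration.integral_cong) (auto simp: spl f_space algebra_simps)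
    finally show "(\<integral>x. max (p x) (q x) * indicator E x \<partial>M) \<le> (\<integral>x. D n x * indicator E (f x) \<partial>M) + \<delta> * measure M E" .
  qed
  have sub_h: "sub n \<delta> (h m)" if "n \<le> m" "b m \<le> \<delta>" for n m \<delta>
  proof -
    have eq: "h m = (\<lambda>x. max (1 * (g' m x - c)) ((-1) * (g' m x - c)))" by (auto simp: h_def)
    have bd: "\<bar>\<sigma> * (g' m x - c)\<bar> \<le> K2" if "\<bar>\<sigma>\<bar> = 1" for \<sigma> x
      using hK[of m x] that by (simp add: h_def abs_mult)
    show ?thesis
      unfolding eq
    proof (rule sub_max)
      show "sub n \<delta> (\<lambda>x. 1 * (g' m x - c))" by (rule sub1) (use that in auto)
      show "sub n \<delta> (\<lambda>x. (-1) * (g' m x - c))" by (rule sub1) (use that in auto)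
      show "\<bar>1 * (g' m x - c)\<bar> \<le> K2" "\<bar>(-1) * (g' m x - c)\<bar> \<le> K2" for x
        by (rule bd, simp)+
    qed measurable
  qed
  have sub_R: "sub n \<delta> (R n j)" if "\<And>m. n \<le> m \<Longrightarrow> b m \<le> \<delta>" for n \<delta> j
  proof (induction j)
    case 0
    show ?case unfolding R_def using sub_h[of n n \<delta>] that by simp
  next
    case (Suc j)
    have "R n (Suc j) = (\<lambda>x. max (R n j x) (h (n + Suc j) x))" by (simp add: R_def)
    moreover have "\<bar>R n j x\<bar> \<le> K2" "\<bar>h m x\<bar> \<le> K2" for x m using R0 RK h0 hK by (simp_all add: abs_le_iff order.trans[of _ 0])
    ultimately show ?case using Suc sub_h[of n "n + Suc j" \<delta>] that by (auto intro!: sub_max)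
  qed
  have sub_D: "sub n \<delta> (D n)" if \<delta>: "\<And>m. n \<le> m \<Longrightarrow> b m \<le> \<delta>" for n \<delta>
    unfolding sub_def
  proof (intro ballI impI)
    fix E assume E [measurable]: "E \<in> sets M" and Ef: "emeasure M E < \<infinity>"
    have "(\<lambda>j. (\<integral>x. R n j x * indicator E x \<partial>M)) \<longlonglongrightarrow> (\<integral>x. D n x * indicator E x \<partial>M)"
    proof (rule integral_dominated_convergence[where w = "\<lambda>x. K2 * indicator E x"])
      show "integrable M (\<lambda>x. K2 * indicator E x)" using Ef by simp
      show "AE x in M. (\<lambda>j. R n j x * indicator E x) \<longlonglongrightarrow> D n x * indicator E x"
        by (intro AE_I2 tendsto_intros RD)
      show "AE x in M. norm (R n j x * indicator E x) \<le> K2 * indicator E x" for j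
        using R0[of n j] RK[of n j] by (intro AE_I2) (auto simp: indicator_def)
    qed measurable
    thus "(\<integral>x. D n x * indicator E x \<partial>M) \<le> (\<integral>x. D n x * indicator E (f x) \<partial>M) + \<delta> * measure M E"
      by (rule LIMSEQ_le_const2) (use sub_R[OF \<delta>, of n] E Ef in \<open>auto simp: sub_def\<close>)
  qed
  define a where "a n k = (\<integral>x. D n x * indicator (hit k Y) x \<partial>M)" for n k
  define y where "y n = (\<integral>x. D n x * indicator Y x \<partial>M)" for n
  have hitf: "hit k Y \<in> sets M" "emeasure M (hit k Y) < \<infinity>" for k
    using Y emeasure_hit_fin[OF Y order_refl, of k] by auto
  have step: "a n k \<le> a n (Suc k) + (y n + \<delta>)" if \<delta>: "\<And>m. n \<le> m \<Longrightarrow> b m \<le> \<delta>" for n k \<delta>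
  proof -
    have \<delta>0: "\<delta> \<ge> 0" using \<delta>[of n] b(1)[of n] by simp
    have retf: "ret (Suc k) Y \<in> sets M" "emeasure M (ret (Suc k) Y) < \<infinity>"
      using emeasure_subset_Y_fin[OF ret_Y] by auto
    have ind: "indicator (hit k Y) (f x) = (indicator (hit (Suc k) Y) x + indicator (ret (Suc k) Y) x :: real)" if "x \<in> space M" for x
      using vimage_hit[OF order_refl, of k] hit_ret_disjoint[of k Y Y] that by (auto simp: indicator_def)
    have "a n k \<le> (\<integral>x. D n x * indicator (hit k Y) (f x) \<partial>M) + \<delta> * measure M (hit k Y)"
      using sub_D[OF \<delta>] hitf unfolding sub_def a_def by blast
    also have "(\<integral>x. D n x * indicator (hit k Y) (f x) \<partial>M) = (\<integral>x. D n x * indicator (hit (Suc k) Y) x + D n x * indicator (ret (Suc k) Y) x \<partial>M)"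
      by (intro Bochner_Integration.integral_cong) (auto simp: ind algebra_simps)
    also have "\<dots> = a n (Suc k) + (\<integral>x. D n x * indicator (ret (Suc k) Y) x \<partial>M)"
      using intb[OF Dm D1 hitf(1,2)] intb[OF Dm D1 retf] by (simp add: a_def)
    also have "(\<integral>x. D n x * indicator (ret (Suc k) Y) x \<partial>M) \<le> y n"
      unfolding y_def using Y1 ret_Y D0 by (intro integral_mono intb Dm D1 retf Y) (auto simp: indicator_def)
    also have "\<delta> * measure M (hit k Y) \<le> \<delta> * 1"
    proof (rule mult_left_mono[OF _ \<delta>0])
      have "decseq tail" by (rule tail_decseq)
      from decseqD[OF this, of 0 k] show "measure M (hit k Y) \<le> 1" by (simp add: measure_hit_eq_tail tail_0)
    qed
    finally show ?thesis by simp
  qed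
  have steps: "a n k \<le> a n (k + J) + real J * (y n + \<delta>)" if \<delta>: "\<And>m. n \<le> m \<Longrightarrow> b m \<le> \<delta>" for n k \<delta> J
  proof (induction J)
    case (Suc J)
    show ?case using Suc step[OF \<delta>, of n "k + J"] by (simp add: algebra_simps)
  qed simp
  have aK: "a n k \<le> K2 * tail k" for n k
  proof -
    have "a n k \<le> (\<integral>x. K2 * indicator (hit k Y) x \<partial>M)"
      unfolding a_def using hitf DK less_imp_le[OF K2]
      by (intro integral_mono intb Dm D1) (auto simp: indicator_def)
    also have "\<dots> = K2 * tail k" using hitf[of k] by (simp add: measure_hit_eq_tail)
    finally show ?thesis .
  qed
  have a0: "0 \<le> a n k" for n k unfolding a_def using D0 by simp
  have y0: "0 \<le> y n" for n unfolding y_def using D0 by simp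
  have y_lim: "y \<longlonglongrightarrow> 0"
  proof -
    have "(\<lambda>n. (\<integral>x. D n x * indicator Y x \<partial>M)) \<longlonglongrightarrow> (\<integral>x. 0 \<partial>M)"
    proof (rule integral_dominated_convergence[where w = "\<lambda>x. K2 * indicator Y x"])
      show "integrable M (\<lambda>x. K2 * indicator Y x)" using integrable_indicator_Y by simp
      show "AE x in M. norm (D n x * indicator Y x) \<le> K2 * indicator Y x" for n
        using D1[of n] by (intro AE_I2) (auto simp: indicator_def)
      show "AE x in M. (\<lambda>n. D n x * indicator Y x) \<longlonglongrightarrow> 0"
        using lim gg'
      proof eventually_elim
        case (elim x)
        show ?case
        proof (cases "x \<in> Y")
          case True
          have gl: "(\<lambda>n. g' n x) \<longlonglongrightarrow> c" using elim True by (simp add: g_def)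
          have "(\<lambda>n. D n x) \<longlonglongrightarrow> 0"
          proof (rule LIMSEQ_I)
            fix r :: real assume r: "r > 0"
            have "\<forall>\<^sub>F m in sequentially. h m x < r / 2"
              using gl r unfolding tendsto_iff dist_real_def h_def by (elim allE[of _ "r / 2"]) simp
            then obtain N where N: "\<And>m. m \<ge> N \<Longrightarrow> h m x < r / 2" by (auto simp: eventually_sequentially)
            have "norm (D n x - 0) < r" if "n \<ge> N" for n
            proof -
              have "D n x \<le> r / 2" by (rule Dle) (use N that in \<open>auto intro: less_imp_le\<close>)
              thus ?thesis using D0[of n x] r by simp
            qed
            thus "\<exists>no. \<forall>n\<ge>no. norm (D n x - 0) < r" by blast
          qed
          thus ?thesis using True by simp
        qed simp
      qed
    qed measurable
    thus ?thesis by (simp add: y_def[abs_def])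
  qed
  have a_lim: "(\<lambda>n. a n k) \<longlonglongrightarrow> 0" for k
  proof (rule LIMSEQ_I)
    fix r :: real assume r: "r > 0"
    have "(\<lambda>J. K2 * tail (k + J)) \<longlonglongrightarrow> K2 * 0"
      using LIMSEQ_ignore_initial_segment[OF tail_tendsto_0, of k] by (intro tendsto_intros) (simp add: add.commute)
    hence "\<forall>\<^sub>F J in sequentially. K2 * tail (k + J) < r / 2" using r by (intro order_tendstoD(2)) auto
    then obtain J where J: "K2 * tail (k + J) < r / 2" by (auto simp: eventually_sequentially)
    define \<delta> where "\<delta> = r / (4 * real (Suc J))"
    have \<delta>: "\<delta> > 0" using r by (simp add: \<delta>_def)
    obtain N1 where N1: "\<And>n. n \<ge> N1 \<Longrightarrow> y n < \<delta>"
      using order_tendstoD(2)[OF y_lim \<delta>] by (auto simp: eventually_sequentially)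
    obtain N2 where N2: "\<And>n. n \<ge> N2 \<Longrightarrow> b n < \<delta>"
      using order_tendstoD(2)[OF b(2) \<delta>] by (auto simp: eventually_sequentially)
    have "norm (a n k - 0) < r" if n: "n \<ge> max N1 N2" for n
    proof -
      have "a n k \<le> a n (k + J) + real J * (y n + \<delta>)"
        by (rule steps) (use n N2 in \<open>auto intro!: less_imp_le\<close>)
      also have "\<dots> \<le> K2 * tail (k + J) + real J * (\<delta> + \<delta>)"
        using aK N1[of n] n by (intro add_mono mult_left_mono) auto
      also have "real J * (\<delta> + \<delta>) \<le> real (Suc J) * (\<delta> + \<delta>)" using \<delta> by (intro mult_right_mono) auto
      also have "real (Suc J) * (\<delta> + \<delta>) = r / 2"
      proof -
        have "real (Suc J) * \<delta> = r / 4" by (simp add: \<delta>_def del: of_nat_Suc)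
        thus ?thesis by (simp add: distrib_left del: of_nat_Suc)
      qed
      finally show ?thesis using J a0[of n k] by simp
    qed
    thus "\<exists>no. \<forall>n\<ge>no. norm (a n k - 0) < r" by blast
  qed
  \<comment> \<open>Convergence of the integrals becomes convergence almost everywhere because
    \<open>D n\<close> decreases in \<open>n\<close>.\<close>
  define Di where "Di x = (INF n. D n x)" for x
  have bdD: "bdd_below (range (\<lambda>n. D n x))" for x by (rule bdd_belowI[of _ 0]) (use D0 in auto)
  have Dl: "(\<lambda>n. D n x) \<longlonglongrightarrow> Di x" for x unfolding Di_def by (rule LIMSEQ_decseq_INF[OF bdD Ddec])
  have Dim [measurable]: "Di \<in> borel_measurable M" by (rule borel_measurable_LIMSEQ_real[OF Dl Dm])
  have Di0: "0 \<le> Di x" for x unfolding Di_def by (rule cINF_greatest) (use D0 in auto)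
  have DiD: "Di x \<le> D n x" for n x unfolding Di_def by (rule cINF_lower[OF bdD]) simp
  have Di1: "\<bar>Di x\<bar> \<le> K2" for x using Di0[of x] DiD[of x 0] DK[of 0 x] by simp
  have "AE x in M. Di x * indicator (hit k Y) x = 0" for k
  proof -
    have le: "(\<integral>x. Di x * indicator (hit k Y) x \<partial>M) \<le> a n k" for n
      unfolding a_def using hitf DiD by (intro integral_mono intb Dm D1 Di1 Dim) (auto simp: indicator_def)
    have "(\<integral>x. Di x * indicator (hit k Y) x \<partial>M) \<le> 0"
      by (rule LIMSEQ_le_const[OF a_lim]) (use le in auto)
    moreover have "0 \<le> (\<integral>x. Di x * indicator (hit k Y) x \<partial>M)" using Di0 by simp
    ultimately have "(\<integral>x. Di x * indicator (hit k Y) x \<partial>M) = 0" by linarith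
    thus ?thesis
      using integral_nonneg_eq_0_iff_AE[OF intb[OF Dim Di1 hitf(1,2)[of k]]] Di0 by simp
  qed
  hence "AE x in M. \<forall>k. Di x * indicator (hit k Y) x = 0" unfolding AE_all_countable by blast
  thus ?thesis
    using AE_hit gg'
  proof eventually_elim
    case (elim x)
    obtain k where "x \<in> hit k Y" using elim(2) by blast
    hence "Di x = 0" using elim(1)[rule_format, of k] by simp
    hence "(\<lambda>n. D n x) \<longlonglongrightarrow> 0" using Dl[of x] by simp
    moreover have "\<forall>\<^sub>F n in sequentially. norm (g' n x - c) \<le> D n x"
      using hD[of n n x for n] by (simp add: h_def)
    ultimately have "(\<lambda>n. g' n x - c) \<longlonglongrightarrow> 0" by (rule Lim_null_comparison[rotated])
    hence "(\<lambda>n. g' n x) \<longlonglongrightarrow> c" by (rule LIM_zero_cancel)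
    thus ?case using elim(3) by (simp add: g_def)
  qed
qed

end

section \<open>The renewal identity\<close>

context first_return begin

abbreviation N :: "'a measure" where "N \<equiv> restrict_space M Y"

lemma space_N: "space N = Y"
  using sets.sets_into_space[OF Y] by (auto simp: space_restrict_space)

lemma sets_N: "A \<in> sets N \<longleftrightarrow> A \<in> sets M \<and> A \<subseteq> Y"
  using Y by (auto simp: sets_restrict_space_iff)

lemma measurable_N: "w \<in> borel_measurable M \<Longrightarrow> w \<in> borel_measurable N"
  by (rule measurable_restrict_space1)

lemma AE_N: "(AE y in N. P y) \<longleftrightarrow> (AE y in M. y \<in> Y \<longrightarrow> P y)"
  by (rule AE_restrict_space_iff) (simp add: Y)

lemma integral_N: "(\<integral>y. w y \<partial>N) = (\<integral>y. indicator Y y * w y \<partial>M)" for w :: "'a \<Rightarrow> real"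
  using Y by (subst integral_restrict_space) auto

lemma prob_N: "emeasure N (space N) = 1"
  using Y1 Y by (simp add: space_N emeasure_restrict_space sets.sets_into_space)

sublocale N: finite_measure N
  by (rule finite_measureI) (subst prob_N, simp)

lemma measure_N: "A \<subseteq> Y \<Longrightarrow> measure N A = measure M A"
  using Y by (intro measure_restrict_space) auto

lemma measure_N_space: "measure N (space N) = 1" using prob_N by (simp add: measure_def)

lemma F_meas_N: "F \<in> measurable N M" by (rule measurable_restrict_space1) (rule F_meas)

lemma AE_N_return: "AE y in N. \<phi> y \<ge> 1 \<and> F y \<in> Y \<and> (\<forall>i\<in>{1..<\<phi> y}. (f ^^ i) y \<notin> Y)"
  unfolding AE_N by (rule AE_F_Y)

lemma AE_N_space: "AE y in N. y \<in> Y"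
  using AE_space[of N] by (simp add: space_N)

text \<open>The equation \<open>(I - R\<^sub>u) G\<^sub>u = 1\<close> in dual form, with \<open>r\<close> in
  the role of \<open>R\<^sub>u h\<close>. For \<open>A \<subseteq> Y\<close> the discounted number
  \<open>W\<close> of visits to \<open>A\<close> satisfies \<open>W = 1\<^sub>A + exp (- u \<phi>)
  (W \<circ> F)\<close>. Integrating this against \<open>h\<close> gives
  \<open>\<integral>\<^sub>A h = \<integral> W (h - r) = \<kappa> \<integral> W\<close>, and
  \<open>\<integral> W\<close> is the integral of \<open>green u\<close> over \<open>A\<close>.\<close>

lemma renewal_identity:
  fixes h r :: "'a \<Rightarrow> real"
  assumes u: "u > 0"
    and h: "h \<in> borel_measurable N" "AE y in N. \<bar>h y\<bar> \<le> K"
    and r: "r \<in> borel_measurable N" "AE y in N. \<bar>r y\<bar> \<le> K'"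
    and dual: "\<And>w B. w \<in> borel_measurable M \<Longrightarrow> (\<And>x. \<bar>w x\<bar> \<le> B) \<Longrightarrow>
       (\<integral>y. w y * r y \<partial>N) = (\<integral>y. w (F y) * exp (- (u * real (\<phi> y))) * h y \<partial>N)"
    and eq: "AE y in N. h y - r y = \<kappa>"
  shows "AE y in N. h y = \<kappa> * green u y"
proof -
  define e where "e n = exp (- (u * real n))" for n
  have eg: "e n = exp (- u) ^ n" for n by (simp add: e_def exp_of_nat_mult[symmetric] mult.commute)
  have e0: "e n > 0" for n by (simp add: e_def)
  have es: "summable e" unfolding eg using u by (intro summable_geometric) simp
  have eb: "\<bar>e n * z\<bar> \<le> e n" "0 \<le> e n * z" "e n * z \<le> e n" if "0 \<le> z" "z \<le> 1" for n z
    using e0[of n] that by (auto simp: abs_mult mult_left_le)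
  have iY: "integrable M (indicator Y :: 'a \<Rightarrow> real)" using Y1 by simp
  have Lm [measurable]: "LY n \<in> borel_measurable M" for n
    using integrable_Lpow[OF iY] by auto
  have LmN [measurable]: "LY n \<in> borel_measurable N" for n
    by (rule measurable_N) (rule Lm)
  have L01: "AE y in N. \<forall>n. 0 \<le> LY n y \<and> LY n y \<le> 1"
    using Lpow_indicator_Y unfolding AE_N by eventually_elim simp
  define G where "G y = (\<Sum>n. e n * LY n y)" for y
  have Gm [measurable]: "G \<in> borel_measurable N" unfolding G_def[abs_def] by (rule borel_measurable_suminf) measurable
  have smG: "AE y in N. summable (\<lambda>n. e n * LY n y)"
    using L01
  proof eventually_elim
    case (elim y)
    show ?case
      by (rule summable_comparison_test'[OF es]) (use elim eb(1) in auto)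
  qed
  have GK: "AE y in N. \<bar>G y\<bar> \<le> (\<Sum>n. e n)"
    using L01 smG
  proof eventually_elim
    case (elim y)
    have "0 \<le> G y" unfolding G_def using elim eb(2) by (intro suminf_nonneg) auto
    moreover have "G y \<le> (\<Sum>n. e n)"
      unfolding G_def using elim eb(3) es by (intro suminf_le) auto
    ultimately show ?case by simp
  qed
  have iG: "integrable N G" by (rule N.integrable_const_bound[of _ "\<Sum>n. e n"]) (use GK in auto)
  have ih: "integrable N h" by (rule N.integrable_const_bound[of _ K]) (use h in auto)
  have "AE y in N. h y = \<kappa> * G y"
  proof (rule AE_eq_of_integrals[OF ih])
    show "integrable N (\<lambda>y. \<kappa> * G y)" using iG by simp
    fix A assume "A \<in> sets N"
    hence A [measurable]: "A \<in> sets M" and AY: "A \<subseteq> Y" by (auto simp: sets_N)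
    have AN [measurable]: "A \<in> sets N" by fact
    define W where "W x = (\<Sum>n. e n * indicator A ((f ^^ n) x))" for x
    have ib: "0 \<le> (indicator A x :: real)" "(indicator A x :: real) \<le> 1" for x by (auto simp: indicator_def)
    have smW: "summable (\<lambda>n. e n * indicator A ((f ^^ n) x))" for x
      by (rule summable_comparison_test'[OF es]) (use eb(1) ib in auto)
    have Wm [measurable]: "W \<in> borel_measurable M" unfolding W_def[abs_def] by (rule borel_measurable_suminf) measurable
    have WmN [measurable]: "W \<in> borel_measurable N" by (rule measurable_N) (rule Wm)
    have WK: "\<bar>W x\<bar> \<le> (\<Sum>n. e n)" for x
    proof -
      have "0 \<le> W x" unfolding W_def using eb(2) ib by (intro suminf_nonneg smW) auto
      moreover have "W x \<le> (\<Sum>n. e n)"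
        unfolding W_def using eb(3) ib by (intro suminf_le smW es) auto
      ultimately show ?thesis by simp
    qed
    \<comment> \<open>Between time \<open>0\<close> and the first return the orbit does not meet
      \<open>Y\<close>, hence not \<open>A\<close>.\<close>
    have ren: "AE y in N. W y = indicator A y + e (\<phi> y) * W (F y)"
      using AE_N_return
    proof eventually_elim
      case (elim y)
      define p where "p = \<phi> y"
      have p: "p \<ge> 1" "\<And>i. 1 \<le> i \<Longrightarrow> i < p \<Longrightarrow> (f ^^ i) y \<notin> A" using elim AY by (auto simp: p_def)
      have "W y = (\<Sum>n. e (n + p) * indicator A ((f ^^ (n + p)) y)) + (\<Sum>n<p. e n * indicator A ((f ^^ n) y))"
        unfolding W_def by (rule suminf_split_initial_segment[OF smW])
      also have "(\<Sum>n<p. e n * indicator A ((f ^^ n) y)) = (\<Sum>n\<in>{0}. e n * indicator A ((f ^^ n) y))"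
      proof (rule sum.mono_neutral_right)
        show "\<forall>i\<in>{..<p} - {0}. e i * indicator A ((f ^^ i) y) = 0"
        proof
          fix i assume "i \<in> {..<p} - {0}"
          hence "(f ^^ i) y \<notin> A" using p(2)[of i] by simp
          thus "e i * indicator A ((f ^^ i) y) = 0" by simp
        qed
      qed (use p in auto)
      also have "\<dots> = indicator A y" by (simp add: e_def)
      also have "(\<Sum>n. e (n + p) * indicator A ((f ^^ (n + p)) y)) = (\<Sum>n. e p * (e n * indicator A ((f ^^ n) (F y))))"
      proof (rule suminf_cong)
        fix n
        have "e (n + p) = e p * e n" by (simp add: eg power_add mult.commute)
        moreover have "(f ^^ (n + p)) y = (f ^^ n) (F y)"
          by (simp add: funpow_add first_return_map_def p_def)
        ultimately show "e (n + p) * indicator A ((f ^^ (n + p)) y) = e p * (e n * indicator A ((f ^^ n) (F y)))" by simp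
      qed
      also have "\<dots> = e p * W (F y)" unfolding W_def by (rule suminf_mult[OF smW])
      finally show ?case by (simp add: p_def)
    qed
    have bdint: "integrable N (\<lambda>y. a y * b y)"
      if "a \<in> borel_measurable N" "b \<in> borel_measurable N" "AE y in N. \<bar>a y\<bar> \<le> Ka" "AE y in N. \<bar>b y\<bar> \<le> Kb" for a b :: "'a \<Rightarrow> real" and Ka Kb
    proof (rule N.integrable_const_bound[of _ "Ka * Kb"])
      show "AE y in N. norm (a y * b y) \<le> Ka * Kb"
        using that(3,4) by eventually_elim (auto simp: abs_mult intro!: mult_mono order.trans[OF abs_ge_zero])
      show "(\<lambda>y. a y * b y) \<in> borel_measurable N" using that(1,2) by measurable
    qed
    have [measurable]: "h \<in> borel_measurable N" "r \<in> borel_measurable N" by (fact h(1)) (fact r(1))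
    have FN [measurable]: "F \<in> measurable N M" by (rule F_meas_N)
    have \<phi>N [measurable]: "\<phi> \<in> measurable N (count_space UNIV)" by (rule measurable_restrict_space1) (rule return_time_meas)
    have em [measurable]: "(\<lambda>y. e (\<phi> y)) \<in> borel_measurable N" unfolding e_def by measurable
    have iWh: "integrable N (\<lambda>y. W y * h y)" by (rule bdint[OF _ _ _ h(2)]) (use WK in auto)
    have iWr: "integrable N (\<lambda>y. W y * r y)" by (rule bdint[OF _ _ _ r(2)]) (use WK in auto)
    have iAh: "integrable N (\<lambda>y. h y * indicator A y)" by (rule integrable_real_mult_indicator[OF AN ih])
    have iWF: "integrable N (\<lambda>y. (W (F y) * e (\<phi> y)) * h y)"
    proof (rule bdint[OF _ _ _ h(2)])
      show "AE y in N. \<bar>W (F y) * e (\<phi> y)\<bar> \<le> (\<Sum>n. e n)"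
      proof (intro AE_I2)
        fix y
        have "\<bar>W (F y) * e (\<phi> y)\<bar> = \<bar>W (F y)\<bar> * e (\<phi> y)" using e0[of "\<phi> y"] by (simp add: abs_mult)
        also have "\<dots> \<le> \<bar>W (F y)\<bar> * 1" using u by (intro mult_left_mono) (auto simp: e_def)
        finally show "\<bar>W (F y) * e (\<phi> y)\<bar> \<le> (\<Sum>n. e n)" using WK[of "F y"] by simp
      qed
    qed auto
    have iW: "integrable N W" by (rule N.integrable_const_bound[of _ "\<Sum>n. e n"]) (use WK in auto)
    have "(\<integral>y. W y * h y \<partial>N) = (\<integral>y. h y * indicator A y + (W (F y) * e (\<phi> y)) * h y \<partial>N)"
    proof (rule integral_cong_AE)
      show "AE y in N. W y * h y = h y * indicator A y + (W (F y) * e (\<phi> y)) * h y"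
        using ren by eventually_elim (simp add: algebra_simps)
    qed measurable
    also have "\<dots> = (\<integral>y. h y * indicator A y \<partial>N) + (\<integral>y. (W (F y) * e (\<phi> y)) * h y \<partial>N)"
      using iAh iWF by simp
    also have "(\<integral>y. (W (F y) * e (\<phi> y)) * h y \<partial>N) = (\<integral>y. W y * r y \<partial>N)"
      using dual[OF Wm WK] by (simp add: e_def)
    finally have "(\<integral>y. h y * indicator A y \<partial>N) = (\<integral>y. W y * h y - W y * r y \<partial>N)" using iWh iWr by simp
    also have "\<dots> = (\<integral>y. \<kappa> * W y \<partial>N)"
    proof (rule integral_cong_AE)
      show "AE y in N. W y * h y - W y * r y = \<kappa> * W y"
        using eq by eventually_elim (simp add: right_diff_distrib[symmetric])
    qed measurable
    also have "\<dots> = \<kappa> * (\<integral>y. W y \<partial>N)" by simp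
    also have "(\<integral>y. W y \<partial>N) = (\<Sum>n. (\<integral>y. e n * indicator A ((f ^^ n) y) \<partial>N))"
      unfolding W_def
    proof (rule integral_suminf)
      have fN [measurable]: "f ^^ n \<in> measurable N M" for n by (rule measurable_restrict_space1) (rule fpow_meas)
      show i: "integrable N (\<lambda>y. e n * indicator A ((f ^^ n) y))" for n
        by (rule N.integrable_const_bound[of _ "e n"]) (use eb(1) ib in auto)
      show "AE y in N. summable (\<lambda>n. norm (e n * indicator A ((f ^^ n) y)))"
        using smW e0 by (intro AE_I2) (simp add: abs_mult abs_of_pos)
      show "summable (\<lambda>n. (\<integral>y. norm (e n * indicator A ((f ^^ n) y)) \<partial>N))"
      proof (rule summable_comparison_test'[OF es])
        fix n
        have "(\<integral>y. norm (e n * indicator A ((f ^^ n) y)) \<partial>N) \<le> (\<integral>y. e n \<partial>N)"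
          using i[of n] eb(1) ib by (intro integral_mono integrable_norm) auto
        thus "norm (\<integral>y. norm (e n * indicator A ((f ^^ n) y)) \<partial>N) \<le> e n" using measure_N_space by simp
      qed
    qed
    also have "\<dots> = (\<Sum>n. (\<integral>y. e n * LY n y * indicator A y \<partial>N))"
    proof (rule suminf_cong)
      fix n
      have "(\<integral>y. e n * indicator A ((f ^^ n) y) \<partial>N) = e n * (\<integral>y. indicator Y y * indicator A ((f ^^ n) y) \<partial>M)"
        by (simp add: integral_N)
      also have "(\<integral>y. indicator Y y * indicator A ((f ^^ n) y) \<partial>M) = (\<integral>y. LY n y * indicator A y \<partial>M)"
        by (rule transfer.dual_indicator[OF transfer_funpow iY A, symmetric])
      also have "\<dots> = (\<integral>y. LY n y * indicator A y \<partial>N)"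
        unfolding integral_N using AY by (intro Bochner_Integration.integral_cong) (auto simp: indicator_def)
      finally show "(\<integral>y. e n * indicator A ((f ^^ n) y) \<partial>N) = (\<integral>y. e n * LY n y * indicator A y \<partial>N)"
        by (simp add: mult.assoc)
    qed
    also have "\<dots> = (\<integral>y. (\<Sum>n. e n * LY n y * indicator A y) \<partial>N)"
    proof (rule integral_suminf[symmetric])
      have bnd: "AE y in N. norm (e n * LY n y * indicator A y) \<le> e n" for n
        using L01
      proof eventually_elim
        case (elim y)
        have "\<bar>e n * LY n y\<bar> \<le> e n" using elim by (intro eb(1)) auto
        thus ?case using e0[of n] by (simp add: indicator_def)
      qed
      show i: "integrable N (\<lambda>y. e n * LY n y * indicator A y)" for n
        by (rule N.integrable_const_bound[OF bnd]) measurable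
      show "AE y in N. summable (\<lambda>n. norm (e n * LY n y * indicator A y))"
      proof -
        have "AE y in N. \<forall>n. norm (e n * LY n y * indicator A y) \<le> e n"
          unfolding AE_all_countable using bnd by blast
        thus ?thesis by eventually_elim (rule summable_comparison_test'[OF es], auto)
      qed
      show "summable (\<lambda>n. (\<integral>y. norm (e n * LY n y * indicator A y) \<partial>N))"
      proof (rule summable_comparison_test'[OF es])
        fix n
        have "(\<integral>y. norm (e n * LY n y * indicator A y) \<partial>N) \<le> (\<integral>y. e n \<partial>N)"
          using i[of n] bnd[of n] by (intro integral_mono_AE integrable_norm) auto
        thus "norm (\<integral>y. norm (e n * LY n y * indicator A y) \<partial>N) \<le> e n" using measure_N_space by simp
      qed
    qed
    also have "\<dots> = (\<integral>y. G y * indicator A y \<partial>N)"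
    proof (rule integral_cong_AE)
      show "(\<lambda>y. \<Sum>n. e n * LY n y * indicator A y) \<in> borel_measurable N"
        by (rule borel_measurable_suminf) measurable
      show "AE y in N. (\<Sum>n. e n * LY n y * indicator A y) = G y * indicator A y"
        using smG by eventually_elim (simp add: G_def suminf_mult2)
    qed measurable
    finally show "(\<integral>y. h y * indicator A y \<partial>N) = (\<integral>y. \<kappa> * G y * indicator A y \<partial>N)"
      by (simp add: mult.assoc)
  qed
  thus ?thesis by (simp add: G_def e_def)
qed

end

section \<open>Asymptotics of the resolvent on the reference set\<close>

context first_return begin

text \<open>Equal to \<open>\<integral>\<^sub>Y (1 - exp (- u \<phi>)) d\<mu>\<close>, written in terms of
  the tail of \<open>\<phi>\<close> by summation by parts.\<close>

definition deficit :: "real \<Rightarrow> real" where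
  "deficit u = (1 - exp (- u)) * (\<Sum>n. tail n * exp (- (u * real n)))"

definition level :: "nat \<Rightarrow> real" where
  "level n = measure M {y \<in> Y. \<phi> y = Suc n}"

lemma tail_le_1: "tail n \<le> 1"
  using decseqD[OF tail_decseq, of 0 n] tail_0 by simp

lemma tail_nonneg: "0 \<le> tail n" by (simp add: tail_def)

lemma level_nonneg: "0 \<le> level n" by (simp add: level_def)

lemma level_eq: "level n = tail n - tail (Suc n)"
  by (simp add: level_def level_eq_tail_diff)

lemma level_sums_deficit:
  assumes u: "u > 0"
  shows "(\<lambda>n. (1 - exp (- (u * real (Suc n)))) * level n) sums deficit u"
proof -
  define x where "x = exp (- u)"
  have x: "0 < x" "x < 1" using u by (auto simp: x_def)
  have ex: "exp (- (u * real n)) = x ^ n" for n by (simp add: x_def exp_of_nat_mult[symmetric] mult.commute)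
  have fin: "(\<Sum>n<m. (1 - x ^ Suc n) * level n) = (1 - x) * (\<Sum>n<m. tail n * x ^ n) - (1 - x ^ m) * tail m" for m
  proof (induction m)
    case (Suc m)
    thus ?case by (simp add: level_eq algebra_simps)
  qed simp
  have "summable (\<lambda>n. tail n * x ^ n)"
  proof (rule summable_comparison_test'[of "\<lambda>n. x ^ n"])
    show "summable (\<lambda>n. x ^ n)" using x by (intro summable_geometric) auto
    show "norm (tail n * x ^ n) \<le> x ^ n" for n
      using tail_nonneg[of n] tail_le_1[of n] x by (simp add: abs_mult mult_left_le_one_le)
  qed
  hence a: "(\<lambda>m. \<Sum>n<m. tail n * x ^ n) \<longlonglongrightarrow> (\<Sum>n. tail n * x ^ n)" by (rule summable_LIMSEQ)
  have b: "(\<lambda>m. x ^ m) \<longlonglongrightarrow> 0" using x by (intro LIMSEQ_power_zero) auto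
  have "(\<lambda>m. (1 - x) * (\<Sum>n<m. tail n * x ^ n) - (1 - x ^ m) * tail m) \<longlonglongrightarrow> (1 - x) * (\<Sum>n. tail n * x ^ n) - (1 - 0) * 0"
    by (intro tendsto_diff tendsto_mult tendsto_const a b tail_tendsto_0)
  thus ?thesis unfolding sums_def ex deficit_def fin by (simp add: x_def)
qed

end

locale renewal = first_return +
  fixes R :: "('a \<Rightarrow> real) \<Rightarrow> 'a \<Rightarrow> real" and \<iota> :: "'b::banach \<Rightarrow> 'a \<Rightarrow> real"
  assumes trR: "transfer_operator N F R" and emb: "Linf_subspace N \<iota>" and const: "contains_constants N \<iota>"
    and h1: "H1 N \<phi> R \<iota>" and h2: "H2i N R \<iota>"
begin

lemma \<iota>_meas [measurable]: "\<iota> x \<in> borel_measurable N"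
  and \<iota>_bound: "AE y in N. \<bar>\<iota> x y\<bar> \<le> norm x"
  and \<iota>_add: "AE y in N. \<iota> (x + z) y = \<iota> x y + \<iota> z y"
  and \<iota>_scale: "AE y in N. \<iota> (s *\<^sub>R x) y = s * \<iota> x y"
  and \<iota>_inj: "(AE y in N. \<iota> x y = 0) \<Longrightarrow> x = 0"
  using emb unfolding Linf_subspace_def by blast+

lemma \<iota>_diff: "AE y in N. \<iota> (x - z) y = \<iota> x y - \<iota> z y"
  using \<iota>_add[of x "(-1) *\<^sub>R z"] \<iota>_scale[of "-1" z] by eventually_elim simp

lemma \<iota>_integrable: "integrable N (\<iota> x)"
  by (rule N.integrable_const_bound[OF _ \<iota>_meas]) (use \<iota>_bound in auto)

lemma integrable_\<iota>_mult:
  assumes "w \<in> borel_measurable N" "AE y in N. \<bar>w y\<bar> \<le> K"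
  shows "integrable N (\<lambda>y. w y * \<iota> x y)"
proof (rule N.integrable_const_bound[of _ "K * norm x"])
  show "AE y in N. norm (w y * \<iota> x y) \<le> K * norm x"
    using assms(2) \<iota>_bound[of x]
    by eventually_elim (auto simp: abs_mult intro!: mult_mono order.trans[OF abs_ge_zero])
  show "(\<lambda>y. w y * \<iota> x y) \<in> borel_measurable N" using assms(1) by measurable
qed

text \<open>Although \<open>\<iota>\<close> is linear only modulo null sets, its integrals against bounded
  functions are honest functionals on the Banach space. Identities between operators on the Banach
  space are tested against them.\<close>

lemma bounded_linear_pairing:
  assumes w: "w \<in> borel_measurable N" "AE y in N. \<bar>w y\<bar> \<le> K"
  shows "bounded_linear (\<lambda>x. \<integral>y. w y * \<iota> x y \<partial>N)"
proof (rule bounded_linear_intro[where K = K])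
  have [measurable]: "w \<in> borel_measurable N" by (fact w(1))
  note i = integrable_\<iota>_mult[OF w]
  fix x z :: 'b and s :: real
  have "(\<integral>y. w y * \<iota> (x + z) y \<partial>N) = (\<integral>y. w y * \<iota> x y + w y * \<iota> z y \<partial>N)"
  proof (rule integral_cong_AE)
    show "AE y in N. w y * \<iota> (x + z) y = w y * \<iota> x y + w y * \<iota> z y"
      using \<iota>_add[of x z] by eventually_elim (simp add: algebra_simps)
  qed measurable
  thus "(\<integral>y. w y * \<iota> (x + z) y \<partial>N) = (\<integral>y. w y * \<iota> x y \<partial>N) + (\<integral>y. w y * \<iota> z y \<partial>N)" using i by simp
  have "(\<integral>y. w y * \<iota> (s *\<^sub>R x) y \<partial>N) = (\<integral>y. s * (w y * \<iota> x y) \<partial>N)"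
  proof (rule integral_cong_AE)
    show "AE y in N. w y * \<iota> (s *\<^sub>R x) y = s * (w y * \<iota> x y)"
      using \<iota>_scale[of s x] by eventually_elim simp
  qed measurable
  thus "(\<integral>y. w y * \<iota> (s *\<^sub>R x) y \<partial>N) = s *\<^sub>R (\<integral>y. w y * \<iota> x y \<partial>N)" by simp
  have "norm (\<integral>y. w y * \<iota> x y \<partial>N) \<le> (\<integral>y. norm (w y * \<iota> x y) \<partial>N)" by (rule integral_norm_bound)
  also have "\<dots> \<le> (\<integral>y. K * norm x \<partial>N)"
  proof (rule integral_mono_AE)
    show "AE y in N. norm (w y * \<iota> x y) \<le> K * norm x"
      using w(2) \<iota>_bound[of x] by eventually_elim (auto simp: abs_mult intro!: mult_mono order.trans[OF abs_ge_zero])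
  qed (use i in auto)
  finally show "norm (\<integral>y. w y * \<iota> x y \<partial>N) \<le> norm x * K" using measure_N_space by (simp add: mult.commute)
qed

definition mean :: "'b \<Rightarrow>\<^sub>L real" where "mean = Blinfun (\<lambda>x. \<integral>y. 1 * \<iota> x y \<partial>N)"

lemma mean_apply: "mean x = (\<integral>y. \<iota> x y \<partial>N)"
  unfolding mean_def
  by (subst bounded_linear_Blinfun_apply) (use bounded_linear_pairing[of "\<lambda>_. 1" 1] in auto)

lemma dual_R:
  assumes "integrable N v" "w \<in> borel_measurable M" "\<And>x. \<bar>w x\<bar> \<le> K"
  shows "(\<integral>y. w y * R v y \<partial>N) = (\<integral>y. w (F y) * v y \<partial>N)"
proof -
  have "(\<integral>y. R v y * w y \<partial>N) = (\<integral>y. v y * w (F y) \<partial>N)"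
    using trR assms measurable_N[OF assms(2)] unfolding transfer_operator_def by blast
  thus ?thesis by (simp add: mult.commute)
qed

lemma integrable_R: "integrable N v \<Longrightarrow> integrable N (R v)"
  using trR unfolding transfer_operator_def by blast

lemma restricts_dual:
  assumes T: "restricts_to N \<iota> A T" and A: "integrable N (A (\<iota> x))" and w: "w \<in> borel_measurable M"
  shows "(\<integral>y. w y * \<iota> (T x) y \<partial>N) = (\<integral>y. w y * A (\<iota> x) y \<partial>N)"
proof (rule integral_cong_AE)
  have wN [measurable]: "w \<in> borel_measurable N" by (rule measurable_N) (rule w)
  have [measurable]: "A (\<iota> x) \<in> borel_measurable N" using A by auto
  show "AE y in N. w y * \<iota> (T x) y = w y * A (\<iota> x) y"
    using T unfolding restricts_to_def by (auto elim!: allE[of _ x] eventually_mono)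
  show "(\<lambda>y. w y * \<iota> (T x) y) \<in> borel_measurable N" "(\<lambda>y. w y * A (\<iota> x) y) \<in> borel_measurable N" by measurable
qed

text \<open>Uniformly almost everywhere on \<open>Y\<close>, the function \<open>green u\<close> is \<open>1
  / deficit u\<close> up to a relative error of the order of \<open>deficit u\<close>. On the
  Banach space \<open>R\<^sub>u = R - D\<close> with \<open>D = \<Sum>\<^sub>n (1 - exp (- u n))
  R\<^sub>n\<close>. By (H1) the norm of \<open>D\<close> is at most \<open>C deficit u\<close>,
  and the mean of \<open>D 1\<close> is exactly \<open>deficit u\<close>, which determines the
  constant \<open>\<kappa>\<close> to first order.\<close>

lemma resolvent_asymptotic:
  obtains C' \<epsilon>0 where "\<epsilon>0 > 0" "C' \<ge> 0" "\<And>u. u > 0 \<Longrightarrow> deficit u \<le> \<epsilon>0 \<Longrightarrow> \<exists>\<kappa>. \<bar>\<kappa> - deficit u\<bar> \<le> C' * (deficit u)\<^sup>2 \<and>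
     (AE y in N. \<bar>\<kappa> * green u y - 1\<bar> \<le> C' * deficit u)"
proof -
  obtain T where T: "restricts_to N \<iota> R T" and simple: "simple_isolated_eigenvalue T 1"
    using h2 unfolding H2i_def by blast
  obtain e where e: "AE y in N. \<iota> e y = 1" using const unfolding contains_constants_def by blast
  have meane: "mean e = 1"
  proof -
    have "(\<integral>y. \<iota> e y \<partial>N) = (\<integral>y. 1 \<partial>N)" using e by (intro integral_cong_AE) auto
    thus ?thesis using measure_N_space by (simp add: mean_apply)
  qed
  \<comment> \<open>The constant function is fixed by \<open>R\<close>, as the first return map
    preserves the measure.\<close>
  have Re: "AE y in N. R (\<iota> e) y = 1"
  proof (rule AE_eq_of_integrals)
    show "integrable N (R (\<iota> e))" by (rule integrable_R[OF \<iota>_integrable])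
    fix A assume "A \<in> sets N"
    hence A [measurable]: "A \<in> sets M" and AY: "A \<subseteq> Y" by (auto simp: sets_N)
    have AN [measurable]: "A \<in> sets N" by fact
    have FN [measurable]: "F \<in> measurable N M" by (rule F_meas_N)
    have "(\<integral>y. indicator A y * R (\<iota> e) y \<partial>N) = (\<integral>y. indicator A (F y) * \<iota> e y \<partial>N)"
      by (rule dual_R[OF \<iota>_integrable, where K = 1]) (auto simp: indicator_def)
    also have "\<dots> = (\<integral>y. indicator A (F y) \<partial>N)"
      using e by (intro integral_cong_AE) (auto elim!: eventually_mono)
    also have "\<dots> = (\<integral>y. indicator {y \<in> Y. F y \<in> A} y \<partial>N)"
      by (intro Bochner_Integration.integral_cong) (auto simp: indicator_def space_N)
    also have "\<dots> = measure N {y \<in> Y. F y \<in> A}"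
    proof -
      have "{y \<in> Y. F y \<in> A} \<inter> Y = {y \<in> Y. F y \<in> A}" by auto
      thus ?thesis by (simp add: space_N)
    qed
    also have "\<dots> = measure M {y \<in> Y. F y \<in> A}" by (rule measure_N) auto
    also have "\<dots> = measure M A" by (rule measure_first_return[OF A AY])
    also have "\<dots> = measure N A" using measure_N[OF AY] by simp
    also have "\<dots> = (\<integral>y. 1 * indicator A y \<partial>N)" using AY by (simp add: space_N Int_absorb2)
    finally show "(\<integral>y. R (\<iota> e) y * indicator A y \<partial>N) = (\<integral>y. 1 * indicator A y \<partial>N)" by (simp add: mult.commute)
  qed simp
  have Te: "T e = e"
  proof -
    have "AE y in N. \<iota> (T e) y = R (\<iota> e) y" using T unfolding restricts_to_def by blast
    with Re e \<iota>_diff[of "T e" e] have "AE y in N. \<iota> (T e - e) y = 0" by eventually_elim simp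
    from \<iota>_inj[OF this] show ?thesis by simp
  qed
  have meanT: "mean (T x) = mean x" for x
  proof -
    have "mean (T x) = (\<integral>y. 1 * R (\<iota> x) y \<partial>N)"
      using restricts_dual[OF T integrable_R[OF \<iota>_integrable], of "\<lambda>_. 1" x] by (simp add: mean_apply)
    also have "\<dots> = (\<integral>y. 1 * \<iota> x y \<partial>N)" by (rule dual_R[OF \<iota>_integrable, where K = 1]) auto
    finally show ?thesis by (simp add: mean_apply)
  qed
  obtain Sr :: "'b \<Rightarrow>\<^sub>L 'b" where Sr: "\<And>x. Sr x - T (Sr x) = x - mean x *\<^sub>R e"
    using reduced_resolvent[OF simple Te meanT meane] by blast
  obtain C where C: "C > 0" and Ch: "\<forall>n\<ge>1. \<exists>Tn. restricts_to N \<iota> (R_level \<phi> R n) Tn \<and> norm Tn \<le> C * measure N {y \<in> space N. \<phi> y = n}"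
    using h1 unfolding H1_def by blast
  have ex: "\<exists>Tn. restricts_to N \<iota> (R_level \<phi> R (Suc n)) Tn \<and> norm Tn \<le> C * level n" for n
  proof -
    have "measure N {y \<in> space N. \<phi> y = Suc n} = level n"
      unfolding space_N level_def by (rule measure_N) auto
    thus ?thesis using Ch[rule_format, of "Suc n"] by simp
  qed
  define Tn where "Tn n = (SOME Tn. restricts_to N \<iota> (R_level \<phi> R (Suc n)) Tn \<and> norm Tn \<le> C * level n)" for n
  have Tn: "restricts_to N \<iota> (R_level \<phi> R (Suc n)) (Tn n)" and nTn: "norm (Tn n) \<le> C * level n" for n
    using someI_ex[OF ex[of n]] unfolding Tn_def by blast+
  have \<phi>N [measurable]: "\<phi> \<in> measurable N (count_space UNIV)" by (rule measurable_restrict_space1) (rule return_time_meas)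
  have FN [measurable]: "F \<in> measurable N M" by (rule F_meas_N)
  have ilev: "integrable N (\<lambda>y. indicator {y. \<phi> y = Suc n} y * \<iota> x y)" for n x
  proof (rule integrable_\<iota>_mult[of _ 1])
    show "(\<lambda>y. indicator {y. \<phi> y = Suc n} y :: real) \<in> borel_measurable N" by measurable
  qed (auto simp: indicator_def)
  have Tn_dual: "(\<integral>y. w y * \<iota> (Tn n x) y \<partial>N) = (\<integral>y. w (F y) * (indicator {y. \<phi> y = Suc n} y * \<iota> x y) \<partial>N)"
    if w: "w \<in> borel_measurable M" "\<And>x. \<bar>w x\<bar> \<le> B" for w B n x
  proof -
    have "(\<integral>y. w y * \<iota> (Tn n x) y \<partial>N) = (\<integral>y. w y * R_level \<phi> R (Suc n) (\<iota> x) y \<partial>N)"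
      by (rule restricts_dual[OF Tn _ w(1)]) (simp add: R_level_def integrable_R ilev)
    also have "\<dots> = (\<integral>y. w (F y) * (indicator {y. \<phi> y = Suc n} y * \<iota> x y) \<partial>N)"
      unfolding R_level_def by (rule dual_R[OF ilev w])
    finally show ?thesis .
  qed
  have meanTn: "mean (Tn n e) = level n" for n
  proof -
    have "mean (Tn n e) = (\<integral>y. 1 * (indicator {y. \<phi> y = Suc n} y * \<iota> e y) \<partial>N)"
      using Tn_dual[of "\<lambda>_. 1" 1 n e] by (simp add: mean_apply)
    also have "\<dots> = (\<integral>y. indicator {y \<in> Y. \<phi> y = Suc n} y \<partial>N)"
    proof (rule integral_cong_AE)
      show "AE y in N. 1 * (indicator {y. \<phi> y = Suc n} y * \<iota> e y) = indicator {y \<in> Y. \<phi> y = Suc n} y"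
        using e AE_N_space by eventually_elim (simp add: indicator_def)
      have "{y \<in> Y. \<phi> y = Suc n} = {y \<in> space N. \<phi> y = Suc n}" by (simp add: space_N)
      also have "\<dots> \<in> sets N" by measurable
      finally show "(\<lambda>y. indicator {y \<in> Y. \<phi> y = Suc n} y :: real) \<in> borel_measurable N" by simp
    qed measurable
    also have "\<dots> = level n"
    proof -
      have "{y \<in> Y. \<phi> y = Suc n} \<inter> Y = {y \<in> Y. \<phi> y = Suc n}" by auto
      thus ?thesis using measure_N[of "{y \<in> Y. \<phi> y = Suc n}"] by (simp add: level_def space_N)
    qed
    finally show ?thesis .
  qed
  define C1 where "C1 = 2 * norm Sr * C * norm e"
  define C2 where "C2 = norm mean * C * C1"
  \<comment> \<open>Chosen such that \<open>norm Sr * norm D \<le> 1/2\<close> whenever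
    \<open>deficit u \<le> \<epsilon>0\<close>.\<close>
  define \<epsilon>0 where "\<epsilon>0 = 1 / (2 * (norm Sr * C + 1))"
  have pos1: "norm Sr * C \<ge> 0" using C by simp
  have C1: "C1 \<ge> 0" and C2: "C2 \<ge> 0" using C by (auto simp: C1_def C2_def)
  show ?thesis
  proof (rule that[of \<epsilon>0 "C1 + C2"])
    show "\<epsilon>0 > 0" using pos1 by (simp add: \<epsilon>0_def)
    show "C1 + C2 \<ge> 0" using C1 C2 by simp
    fix u :: real assume u: "u > 0" and small: "deficit u \<le> \<epsilon>0"
    define c where "c n = 1 - exp (- (u * real (Suc n)))" for n
    have c: "0 \<le> c n" "c n \<le> 1" for n using u by (auto simp: c_def)
    have sums: "(\<lambda>n. c n * level n) sums deficit u" unfolding c_def by (rule level_sums_deficit[OF u])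
    have def0: "deficit u \<ge> 0" using sums_le[OF _ sums_zero sums] c level_nonneg by simp
    have nD: "norm (c n *\<^sub>R Tn n) \<le> C * (c n * level n)" for n
      using mult_left_mono[OF nTn[of n] c(1)[of n]] c[of n] by (simp add: mult.left_commute)
    have sC: "summable (\<lambda>n. C * (c n * level n))" using sums by (intro summable_mult) (rule sums_summable)
    have snD: "summable (\<lambda>n. norm (c n *\<^sub>R Tn n))"
      by (rule summable_comparison_test'[OF sC]) (use nD in auto)
    have sD: "summable (\<lambda>n. c n *\<^sub>R Tn n)" by (rule summable_norm_cancel[OF snD])
    define D where "D = (\<Sum>n. c n *\<^sub>R Tn n)"
    have normD: "norm D \<le> C * deficit u"
    proof -
      have "norm D \<le> (\<Sum>n. norm (c n *\<^sub>R Tn n))" unfolding D_def by (rule summable_norm[OF snD])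
      also have "\<dots> \<le> (\<Sum>n. C * (c n * level n))" by (rule suminf_le[OF nD snD sC])
      also have "\<dots> = C * deficit u" using sums by (simp add: suminf_mult sums_iff)
      finally show ?thesis .
    qed
    have Dx: "(\<lambda>n. c n *\<^sub>R Tn n x) sums D x" for x
      using bounded_linear.sums[OF blinfun.bounded_linear_left summable_sums[OF sD], of x]
      by (simp add: D_def blinfun.scaleR_left)
    have meanDe: "mean (D e) = deficit u"
    proof -
      have "(\<lambda>n. mean (c n *\<^sub>R Tn n e)) sums mean (D e)"
        by (rule bounded_linear.sums[OF blinfun.bounded_linear_right Dx])
      thus ?thesis using sums by (simp add: blinfun.scaleR_right meanTn sums_unique2)
    qed
    have "norm Sr * norm D \<le> norm Sr * (C * deficit u)" by (intro mult_left_mono normD) auto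
    also have "\<dots> = (norm Sr * C) * deficit u" by simp
    also have "\<dots> \<le> (norm Sr * C + 1) * \<epsilon>0" using pos1 small def0 by (intro mult_mono) auto
    also have "\<dots> = 1/2" using pos1 by (simp add: \<epsilon>0_def field_simps)
    finally have half: "norm Sr * norm D \<le> 1/2" .
    obtain h where h: "h - T h + D h = mean (D h) *\<^sub>R e" and hn: "norm (h - e) \<le> 2 * norm Sr * norm D * norm e"
      using perturbed_eigenvector[OF Sr Te half] by blast
    define \<kappa> where "\<kappa> = mean (D h)"
    have hC1: "norm (h - e) \<le> C1 * deficit u"
    proof -
      have "2 * norm Sr * norm D * norm e \<le> 2 * norm Sr * (C * deficit u) * norm e"
        by (intro mult_right_mono mult_left_mono normD) auto
      thus ?thesis using hn by (simp add: C1_def mult_ac)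
    qed
    have "\<kappa> - deficit u = mean (D (h - e))" by (simp add: \<kappa>_def meanDe[symmetric] blinfun.diff_right)
    hence "\<bar>\<kappa> - deficit u\<bar> \<le> norm mean * norm (D (h - e))" using norm_blinfun[of mean "D (h - e)"] by simp
    also have "\<dots> \<le> norm mean * (norm D * norm (h - e))" by (intro mult_left_mono norm_blinfun) auto
    also have "\<dots> \<le> norm mean * ((C * deficit u) * (C1 * deficit u))"
      using normD hC1 C def0 by (intro mult_left_mono mult_mono) auto
    also have "\<dots> = C2 * (deficit u)\<^sup>2" by (simp add: C2_def power2_eq_square mult_ac)
    finally have k1: "\<bar>\<kappa> - deficit u\<bar> \<le> C2 * (deficit u)\<^sup>2" .
    have ren: "AE y in N. \<iota> h y = \<kappa> * green u y"
    proof (rule renewal_identity[OF u \<iota>_meas \<iota>_bound \<iota>_meas \<iota>_bound])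
      show "AE y in N. \<iota> h y - \<iota> (T h - D h) y = \<kappa>"
      proof -
        have "h - (T h - D h) = \<kappa> *\<^sub>R e" using h by (simp add: \<kappa>_def algebra_simps)
        from \<iota>_diff[of h "T h - D h", unfolded this] \<iota>_scale[of \<kappa> e] e show ?thesis
          by eventually_elim simp
      qed
      fix w :: "'a \<Rightarrow> real" and B assume w [measurable]: "w \<in> borel_measurable M" and wB: "\<And>x. \<bar>w x\<bar> \<le> B"
      have wN [measurable]: "w \<in> borel_measurable N" by (rule measurable_N) (rule w)
      have bl: "bounded_linear (\<lambda>x. \<integral>y. w y * \<iota> x y \<partial>N)"
        by (rule bounded_linear_pairing[OF wN, of B]) (use wB in simp)
      have wF: "(\<lambda>y. w (F y)) \<in> borel_measurable N" by measurable
      have iwF: "integrable N (\<lambda>y. w (F y) * \<iota> x y)" for x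
        by (rule integrable_\<iota>_mult[OF wF, of B]) (use wB in simp)
      have "(\<lambda>n. (\<integral>y. w y * \<iota> (c n *\<^sub>R Tn n h) y \<partial>N)) sums (\<integral>y. w y * \<iota> (D h) y \<partial>N)"
        by (rule bounded_linear.sums[OF bl Dx])
      hence s1: "(\<lambda>n. c n * (\<integral>y. w (F y) * (indicator {y. \<phi> y = Suc n} y * \<iota> h y) \<partial>N)) sums (\<integral>y. w y * \<iota> (D h) y \<partial>N)"
        by (simp add: linear_simps[OF bl] Tn_dual[OF w wB])
      \<comment> \<open>At each point only the term with \<open>Suc n = \<phi> y\<close> is nonzero,
        so the series can be summed pointwise and integrated termwise.\<close>
      define g where "g n y = c n * (w (F y) * (indicator {y. \<phi> y = Suc n} y * \<iota> h y))" for n y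
      have gsum: "AE y in N. (\<lambda>n. g n y) sums (w (F y) * (1 - exp (- (u * real (\<phi> y)))) * \<iota> h y)"
        using AE_N_return
      proof eventually_elim
        case (elim y)
        then obtain p where p: "\<phi> y = Suc p" by (cases "\<phi> y") auto
        have "(\<lambda>n. if n = p then c n * (w (F y) * \<iota> h y) else 0) sums (c p * (w (F y) * \<iota> h y))"
          by (rule sums_single)
        moreover have "g n y = (if n = p then c n * (w (F y) * \<iota> h y) else 0)" for n
          by (simp add: g_def p indicator_def)
        ultimately show ?case by (simp add: c_def p mult_ac)
      qed
      have "(\<lambda>m. (\<integral>y. (\<Sum>n<m. g n y) \<partial>N)) \<longlonglongrightarrow> (\<integral>y. w (F y) * (1 - exp (- (u * real (\<phi> y)))) * \<iota> h y \<partial>N)"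
      proof (rule integral_dominated_convergence[where w = "\<lambda>_. B * norm h"])
        show "(\<lambda>y. w (F y) * (1 - exp (- (u * real (\<phi> y)))) * \<iota> h y) \<in> borel_measurable N" by measurable
        show "(\<lambda>y. \<Sum>n<m. g n y) \<in> borel_measurable N" for m unfolding g_def by measurable
        show "integrable N (\<lambda>_. B * norm h)" by simp
        show "AE y in N. (\<lambda>m. \<Sum>n<m. g n y) \<longlonglongrightarrow> w (F y) * (1 - exp (- (u * real (\<phi> y)))) * \<iota> h y"
          using gsum by (simp add: sums_def)
        show "AE y in N. norm (\<Sum>n<m. g n y) \<le> B * norm h" for m
          using \<iota>_bound[of h]
        proof eventually_elim
          case (elim y)
          have "(\<Sum>n<m. g n y) = (\<Sum>n<m. c n * indicator {y. \<phi> y = Suc n} y) * (w (F y) * \<iota> h y)"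
            unfolding g_def sum_distrib_right by (intro sum.cong refl) (simp only: mult_ac)
          moreover have "0 \<le> (\<Sum>n<m. c n * indicator {y. \<phi> y = Suc n} y)" using c by (intro sum_nonneg) auto
          moreover have "(\<Sum>n<m. c n * indicator {y. \<phi> y = Suc n} y) \<le> 1"
          proof -
            have "(\<Sum>n<m. c n * indicator {y. \<phi> y = Suc n} y) \<le> (\<Sum>n<m. if n = \<phi> y - 1 then 1 else 0)"
              using c by (intro sum_mono) (auto simp: indicator_def)
            also have "\<dots> \<le> (1::real)" by (simp add: sum.delta)
            finally show ?thesis .
          qed
          ultimately have "norm (\<Sum>n<m. g n y) \<le> 1 * \<bar>w (F y) * \<iota> h y\<bar>"
            by (simp only: real_norm_def abs_mult[of "sum _ _"]) (intro mult_right_mono, auto)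
          also have "\<dots> \<le> B * norm h" using wB[of "F y"] elim by (auto simp: abs_mult intro!: mult_mono order.trans[OF abs_ge_zero wB])
          finally show ?case .
        qed
      qed
      moreover have "(\<integral>y. (\<Sum>n<m. g n y) \<partial>N) = (\<Sum>n<m. c n * (\<integral>y. w (F y) * (indicator {y. \<phi> y = Suc n} y * \<iota> h y) \<partial>N))" for m
      proof -
        have ig: "integrable N (\<lambda>y. w (F y) * (indicator {y. \<phi> y = Suc n} y * \<iota> h y))" for n
        proof (rule Bochner_Integration.integrable_bound[OF iwF[of h]])
          show "(\<lambda>y. w (F y) * (indicator {y. \<phi> y = Suc n} y * \<iota> h y)) \<in> borel_measurable N" by measurable
        qed (auto simp: indicator_def)
        show ?thesis unfolding g_def by (subst Bochner_Integration.integral_sum) (auto intro!: integrable_mult_right ig)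
      qed
      ultimately have "(\<lambda>m. \<Sum>n<m. c n * (\<integral>y. w (F y) * (indicator {y. \<phi> y = Suc n} y * \<iota> h y) \<partial>N)) \<longlonglongrightarrow> (\<integral>y. w (F y) * (1 - exp (- (u * real (\<phi> y)))) * \<iota> h y \<partial>N)"
        by simp
      hence wD: "(\<integral>y. w y * \<iota> (D h) y \<partial>N) = (\<integral>y. w (F y) * (1 - exp (- (u * real (\<phi> y)))) * \<iota> h y \<partial>N)"
        using s1 unfolding sums_def by (rule LIMSEQ_unique[rotated])
      have "(\<integral>y. w y * \<iota> (T h) y \<partial>N) = (\<integral>y. w y * R (\<iota> h) y \<partial>N)"
        by (rule restricts_dual[OF T integrable_R[OF \<iota>_integrable] w])
      also have "\<dots> = (\<integral>y. w (F y) * \<iota> h y \<partial>N)" by (rule dual_R[OF \<iota>_integrable w wB])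
      finally have wT: "(\<integral>y. w y * \<iota> (T h) y \<partial>N) = (\<integral>y. w (F y) * \<iota> h y \<partial>N)" .
      have ie: "integrable N (\<lambda>y. w (F y) * (1 - exp (- (u * real (\<phi> y)))) * \<iota> h y)"
      proof (rule Bochner_Integration.integrable_bound[OF iwF[of h]])
        show "(\<lambda>y. w (F y) * (1 - exp (- (u * real (\<phi> y)))) * \<iota> h y) \<in> borel_measurable N" by measurable
        have "\<bar>1 - exp (- (u * real n))\<bar> \<le> 1" for n using u by simp
        hence "\<bar>w (F y)\<bar> * \<bar>1 - exp (- (u * real (\<phi> y)))\<bar> * \<bar>\<iota> h y\<bar> \<le> \<bar>w (F y)\<bar> * 1 * \<bar>\<iota> h y\<bar>" for y
          by (intro mult_right_mono mult_left_mono) auto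
        thus "AE y in N. norm (w (F y) * (1 - exp (- (u * real (\<phi> y)))) * \<iota> h y) \<le> norm (w (F y) * \<iota> h y)"
          by (simp add: abs_mult)
      qed
      have "(\<integral>y. w y * \<iota> (T h - D h) y \<partial>N) = (\<integral>y. w (F y) * \<iota> h y \<partial>N) - (\<integral>y. w (F y) * (1 - exp (- (u * real (\<phi> y)))) * \<iota> h y \<partial>N)"
        by (simp add: linear_simps[OF bl] wD wT)
      also have "\<dots> = (\<integral>y. w (F y) * \<iota> h y - w (F y) * (1 - exp (- (u * real (\<phi> y)))) * \<iota> h y \<partial>N)"
        using iwF ie by simp
      also have "\<dots> = (\<integral>y. w (F y) * exp (- (u * real (\<phi> y))) * \<iota> h y \<partial>N)"
        by (intro Bochner_Integration.integral_cong) (auto simp: algebra_simps)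
      finally show "(\<integral>y. w y * \<iota> (T h - D h) y \<partial>N) = (\<integral>y. w (F y) * exp (- (u * real (\<phi> y))) * \<iota> h y \<partial>N)" .
    qed
    have "AE y in N. \<bar>\<kappa> * green u y - 1\<bar> \<le> C1 * deficit u"
      using ren \<iota>_diff[of h e] e \<iota>_bound[of "h - e"]
    proof eventually_elim
      case (elim y)
      thus ?case using hC1 by simp
    qed
    moreover have "C1 * deficit u \<le> (C1 + C2) * deficit u" using C2 def0 by (intro mult_right_mono) auto
    ultimately have "AE y in N. \<bar>\<kappa> * green u y - 1\<bar> \<le> (C1 + C2) * deficit u"
      by (auto elim!: eventually_mono)
    moreover have "C2 * (deficit u)\<^sup>2 \<le> (C1 + C2) * (deficit u)\<^sup>2" using C1 by (intro mult_right_mono) auto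
    ultimately show "\<exists>\<kappa>. \<bar>\<kappa> - deficit u\<bar> \<le> (C1 + C2) * (deficit u)\<^sup>2 \<and>
     (AE y in N. \<bar>\<kappa> * green u y - 1\<bar> \<le> (C1 + C2) * deficit u)"
      using k1 by (intro exI[of _ \<kappa>]) auto
  qed
qed

end

section \<open>Normalised sums of the transfer operator\<close>

text \<open>The reflection formula of the Gamma function.\<close>

lemma inverse_Gamma_product:
  assumes "0 < \<beta>" "\<beta> < 1"
  shows "1 / (Gamma (1 - \<beta>) * Gamma (\<beta> + 1)) = sin (\<beta> * pi) / (pi * \<beta>)"
proof -
  have "complex_of_real (Gamma \<beta> * Gamma (1 - \<beta>)) = complex_of_real (pi / sin (pi * \<beta>))"
    using Gamma_reflection_complex[of "complex_of_real \<beta>"]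
    by (simp add: Gamma_complex_of_real[symmetric] sin_of_real[symmetric])
  hence "Gamma \<beta> * Gamma (1 - \<beta>) = pi / sin (pi * \<beta>)" by (simp only: of_real_eq_iff)
  moreover have "Gamma (\<beta> + 1) = \<beta> * Gamma \<beta>"
    using assms by (intro Gamma_plus1) (auto elim!: nonpos_Ints_cases)
  ultimately have "Gamma (1 - \<beta>) * Gamma (\<beta> + 1) = \<beta> * (pi / sin (pi * \<beta>))" by (simp add: mult_ac)
  thus ?thesis by (simp add: mult.commute)
qed

context renewal begin

text \<open>Only the countably many values \<open>u = k / N\<close> are needed, hence there is one null set
  outside of which the Tauberian theorem applies. The uniform bound follows from \<open>S\<^sub>n
  \<le> e \<Sum>\<^sub>j exp (- j / n) L\<^sup>j 1\<^sub>Y\<close>.\<close>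

lemma return_sums_asymptotic:
  assumes rv: "regularly_varying_tail tail \<beta>" and \<beta>: "0 < \<beta>" "\<beta> \<le> 1"
  defines "b \<equiv> regularly_varying_tail.norming tail \<beta>"
  shows "b \<longlonglongrightarrow> 0"
    and "AE y in M. y \<in> Y \<longrightarrow> (\<lambda>n. b n * SY n y) \<longlonglongrightarrow> 1 / Gamma (\<beta> + 1)"
    and "\<exists>K. AE y in M. y \<in> Y \<longrightarrow> (\<forall>n. b n * SY n y \<le> K)"
proof -
  interpret rv: regularly_varying_tail tail \<beta> by (rule rv)
  have bpos: "b n > 0" if "n \<ge> 1" for n unfolding b_def by (rule rv.norming_pos) (use \<beta> that in auto)
  have b0: "b n \<ge> 0" for n unfolding b_def by (rule rv.norming_nonneg) (rule \<beta>)
  show blim: "b \<longlonglongrightarrow> 0"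
  proof (cases "\<beta> = 1")
    case True
    have "(\<lambda>N. (\<Sum>n\<le>N. tail n) / real N) \<longlonglongrightarrow> 0"
      by (rule cesaro_null_sequence[OF tail_tendsto_0 tail_nonneg])
    moreover have "b = (\<lambda>N. (\<Sum>n\<le>N. tail n) / real N)"
      by (rule ext) (simp only: b_def rv.norming_1[OF True] rv.partial_sum_def)
    ultimately show ?thesis by (simp only:)
  next
    case False
    have "(\<lambda>N. Gamma (1 - \<beta>) * tail N) \<longlonglongrightarrow> Gamma (1 - \<beta>) * 0" by (intro tendsto_intros tail_tendsto_0)
    moreover have "b = (\<lambda>N. Gamma (1 - \<beta>) * tail N)"
      by (rule ext) (simp only: b_def rv.norming_less_1[OF False])
    ultimately show ?thesis by simp
  qed
  define d where "d k N = deficit (real k / real N)" for k N :: nat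
  have ratio: "(\<lambda>N. d k N / b N) \<longlonglongrightarrow> real k powr \<beta>" if "k \<ge> 1" for k
    using rv.laplace_norming[OF \<beta>, of "real k"] that by (simp add: d_def deficit_def b_def)
  have dlim: "(\<lambda>N. d k N) \<longlonglongrightarrow> 0" if k: "k \<ge> 1" for k
  proof -
    have l: "(\<lambda>N. d k N / b N * b N) \<longlonglongrightarrow> real k powr \<beta> * 0" by (intro tendsto_mult ratio k blim)
    have "\<forall>\<^sub>F N in sequentially. d k N / b N * b N = d k N"
      using eventually_ge_at_top[of 1] 
    proof eventually_elim
      case (elim N)
      from bpos[OF this] show ?case by simp
    qed
    from Lim_transform_eventually[OF l this] show ?thesis by simp
  qed
  have dpos: "\<forall>\<^sub>F N in sequentially. 0 < d k N" if k: "k \<ge> 1" for k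
  proof -
    have "\<forall>\<^sub>F N in sequentially. 0 < d k N / b N" using ratio[OF k] by (rule order_tendstoD(1)) (use k in simp)
    thus ?thesis using eventually_ge_at_top[of 1]
    proof eventually_elim
      case (elim N)
      thus ?case using bpos[of N] by (simp add: zero_less_divide_iff)
    qed
  qed
  obtain \<epsilon>0 C where \<epsilon>0: "\<epsilon>0 > 0" and C: "C \<ge> 0"
    and res: "\<And>u. u > 0 \<Longrightarrow> deficit u \<le> \<epsilon>0 \<Longrightarrow> \<exists>\<kappa>. \<bar>\<kappa> - deficit u\<bar> \<le> C * (deficit u)\<^sup>2 \<and>
     (AE y in N. \<bar>\<kappa> * green u y - 1\<bar> \<le> C * deficit u)"
    by (rule resolvent_asymptotic) blast
  define G where "G k N y = (\<Sum>n. LY n y * exp (- (real k / real N * real n)))" for k N :: nat and y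
  define good where "good k n \<kappa> \<longleftrightarrow> \<bar>\<kappa> - d k n\<bar> \<le> C * (d k n)\<^sup>2 \<and> (AE y in N. \<bar>\<kappa> * G k n y - 1\<bar> \<le> C * d k n)"
    for k n \<kappa>
  define \<kappa> where "\<kappa> k n = (SOME \<kappa>. good k n \<kappa>)" for k n
  have \<kappa>: "\<bar>\<kappa> k n - d k n\<bar> \<le> C * (d k n)\<^sup>2 \<and> (AE y in N. \<bar>\<kappa> k n * G k n y - 1\<bar> \<le> C * d k n)"
    if "k \<ge> 1" "n \<ge> 1" "d k n \<le> \<epsilon>0" for k n
  proof -
    have "real k / real n > 0" using that by simp
    from res[OF this] that(3) have "\<exists>\<kappa>. good k n \<kappa>" by (simp add: good_def d_def G_def mult.commute)
    hence "good k n (\<kappa> k n)" unfolding \<kappa>_def by (rule someI_ex)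
    thus ?thesis by (simp add: good_def)
  qed
  have AEG: "AE y in N. \<forall>k n. k \<ge> 1 \<longrightarrow> n \<ge> 1 \<longrightarrow> d k n \<le> \<epsilon>0 \<longrightarrow> \<bar>\<kappa> k n * G k n y - 1\<bar> \<le> C * d k n"
    unfolding AE_all_countable
  proof (intro allI)
    fix k n
    show "AE y in N. k \<ge> 1 \<longrightarrow> n \<ge> 1 \<longrightarrow> d k n \<le> \<epsilon>0 \<longrightarrow> \<bar>\<kappa> k n * G k n y - 1\<bar> \<le> C * d k n"
      using \<kappa>[of k n] by (cases "k \<ge> 1 \<and> n \<ge> 1 \<and> d k n \<le> \<epsilon>0") auto
  qed
  have L01: "AE y in N. \<forall>n. 0 \<le> LY n y \<and> LY n y \<le> 1"
    using Lpow_indicator_Y unfolding AE_N by eventually_elim simp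
  have small: "\<forall>\<^sub>F n in sequentially. n \<ge> 1 \<and> d k n \<le> \<epsilon>0 \<and> 0 < d k n" if k: "k \<ge> 1" for k
    using eventually_ge_at_top[of 1] order_tendstoD(2)[OF dlim[OF k] \<epsilon>0] dpos[OF k] by eventually_elim auto
  \<comment> \<open>Therefore \<open>\<kappa>\<close> may be replaced by the deficit in limits.\<close>
  have \<kappa>d: "(\<lambda>n. \<kappa> k n / d k n) \<longlonglongrightarrow> 1" if k: "k \<ge> 1" for k
  proof -
    have "(\<lambda>n. \<kappa> k n / d k n - 1) \<longlonglongrightarrow> 0"
    proof (rule Lim_null_comparison)
      show "\<forall>\<^sub>F n in sequentially. norm (\<kappa> k n / d k n - 1) \<le> C * d k n"
        using small[OF k]
      proof eventually_elim
        case (elim n)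
        have "\<kappa> k n / d k n - 1 = (\<kappa> k n - d k n) / d k n" using elim by (simp add: field_simps)
        hence "norm (\<kappa> k n / d k n - 1) = \<bar>\<kappa> k n - d k n\<bar> / d k n" using elim by simp
        also have "\<dots> \<le> C * (d k n)\<^sup>2 / d k n" using \<kappa>[of k n] elim k by (intro divide_right_mono) auto
        also have "\<dots> = C * d k n" using elim by (simp add: power2_eq_square)
        finally show ?case .
      qed
      show "(\<lambda>n. C * d k n) \<longlonglongrightarrow> 0" using tendsto_mult[OF tendsto_const dlim[OF k], of C] by simp
    qed
    thus ?thesis by (rule LIM_zero_cancel)
  qed
  have summ: "summable (\<lambda>n. a n * exp (- (c * real n)))" if c: "c > 0" and a: "\<And>n. 0 \<le> a n" "\<And>n. a n \<le> 1" for a :: "nat \<Rightarrow> real" and c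
  proof (rule summable_comparison_test'[of "\<lambda>n. exp (- c) ^ n"])
    show "summable (\<lambda>n. exp (- c) ^ n)" using c by (intro summable_geometric) simp
    show "norm (a n * exp (- (c * real n))) \<le> exp (- c) ^ n" for n
    proof -
      have "exp (- (c * real n)) = exp (- c) ^ n" by (simp add: exp_of_nat_mult[symmetric] mult.commute)
      thus ?thesis using a[of n] by (simp add: abs_mult mult_left_le_one_le)
    qed
  qed
  have "AE y in N. (\<lambda>n. b n * SY n y) \<longlonglongrightarrow> 1 / Gamma (\<beta> + 1)"
    using AEG L01
  proof eventually_elim
    case (elim y)
    note Gy = elim(1) and a01 = elim(2)
    have lim: "(\<lambda>n. b n * G k n y) \<longlonglongrightarrow> real k powr -\<beta>" if k: "k \<ge> 1" for k
    proof -
      have kG: "(\<lambda>n. \<kappa> k n * G k n y) \<longlonglongrightarrow> 1"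
      proof (rule LIM_zero_cancel, rule Lim_null_comparison)
        show "\<forall>\<^sub>F n in sequentially. norm (\<kappa> k n * G k n y - 1) \<le> C * d k n"
          using small[OF k] by eventually_elim (use Gy k in auto)
        show "(\<lambda>n. C * d k n) \<longlonglongrightarrow> 0" using tendsto_mult[OF tendsto_const dlim[OF k], of C] by simp
      qed
      have "(\<lambda>n. (\<kappa> k n * G k n y) / (\<kappa> k n / d k n) / (d k n / b n)) \<longlonglongrightarrow> 1 / 1 / (real k powr \<beta>)"
        using k by (intro tendsto_divide kG \<kappa>d ratio) auto
      moreover have "\<forall>\<^sub>F n in sequentially. (\<kappa> k n * G k n y) / (\<kappa> k n / d k n) / (d k n / b n) = b n * G k n y"
        using small[OF k] order_tendstoD(1)[OF \<kappa>d[OF k], of 0, simplified]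
      proof eventually_elim
        case (elim n)
        thus ?case using bpos[of n] by (auto simp: field_simps zero_less_divide_iff)
      qed
      ultimately have "(\<lambda>n. b n * G k n y) \<longlonglongrightarrow> 1 / 1 / (real k powr \<beta>)" by (rule Lim_transform_eventually)
      thus ?thesis by (simp add: powr_minus_divide)
    qed
    have "(\<lambda>n. b n * (\<Sum>j\<le>n. LY j y)) \<longlonglongrightarrow> 1 / Gamma (\<beta> + 1)"
    proof (rule karamata_tauberian[OF \<beta>(1)])
      show "0 \<le> LY n y" for n using a01 by blast
      show "summable (\<lambda>n. LY n y * exp (- (1 / real N * real n)))" if "N \<ge> 1" for N
        using a01 that by (intro summ) auto
    qed (use b0 lim in \<open>auto simp: G_def\<close>)
    moreover have "(\<lambda>n. b n * LY n y) \<longlonglongrightarrow> 0"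
    proof (rule Lim_null_comparison[OF always_eventually blim], rule allI)
      fix n
      show "norm (b n * LY n y) \<le> b n"
        using a01[rule_format, of n] b0[of n] by (simp add: abs_mult mult_left_le)
    qed
    ultimately have "(\<lambda>n. b n * (\<Sum>j\<le>n. LY j y) - b n * LY n y) \<longlonglongrightarrow> 1 / Gamma (\<beta> + 1) - 0"
      by (rule tendsto_diff)
    moreover have "b n * (\<Sum>j\<le>n. LY j y) - b n * LY n y = b n * SY n y" for n
      by (simp add: S_def lessThan_Suc_atMost[symmetric] algebra_simps)
    ultimately show ?case by simp
  qed
  thus "AE y in M. y \<in> Y \<longrightarrow> (\<lambda>n. b n * SY n y) \<longlonglongrightarrow> 1 / Gamma (\<beta> + 1)" by (simp only: AE_N)
  have "\<forall>\<^sub>F n in sequentially. n \<ge> 1 \<and> d 1 n \<le> \<epsilon>0 \<and> 0 < d 1 n \<and> C * d 1 n \<le> 1/2 \<and> b n \<le> 2 * d 1 n"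
  proof -
    have "(\<lambda>n. C * d 1 n) \<longlonglongrightarrow> C * 0" by (intro tendsto_intros dlim) simp
    hence "\<forall>\<^sub>F n in sequentially. C * d 1 n < 1/2" by (rule order_tendstoD(2)) simp
    moreover have "\<forall>\<^sub>F n in sequentially. d 1 n / b n > 1/2"
      using ratio[of 1] by (intro order_tendstoD(1)) auto
    ultimately show ?thesis using small[OF order_refl]
    proof eventually_elim
      case (elim n)
      have "b n > 0" using elim by (intro bpos) simp
      thus ?case using elim by (simp add: field_simps)
    qed
  qed
  then obtain n0 where n0: "\<And>n. n \<ge> n0 \<Longrightarrow> n \<ge> 1 \<and> d 1 n \<le> \<epsilon>0 \<and> 0 < d 1 n \<and> C * d 1 n \<le> 1/2 \<and> b n \<le> 2 * d 1 n"
    by (auto simp: eventually_sequentially)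
  \<comment> \<open>For \<open>n \<ge> n0\<close> one has \<open>\<kappa> \<ge> d / 2\<close>,
    \<open>\<kappa> G \<le> 3 / 2\<close> and \<open>b \<le> 2 d\<close>, hence
    \<open>b G \<le> 6\<close>.\<close>
  define K where "K = 6 * exp 1 + (\<Sum>m<n0. b m * real m)"
  have "AE y in N. \<forall>n. b n * SY n y \<le> K"
    using AEG L01
  proof eventually_elim
    case (elim y)
    note Gy = elim(1) and a01 = elim(2)
    show ?case
    proof
      fix n
      show "b n * SY n y \<le> K"
      proof (cases "n \<ge> n0")
        case False
        have "SY n y \<le> (\<Sum>j<n. 1)" unfolding S_def using a01 by (intro sum_mono) blast
        hence "b n * SY n y \<le> b n * real n" using b0 by (intro mult_left_mono) auto
        also have "\<dots> \<le> (\<Sum>m<n0. b m * real m)"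
          using False b0 by (intro member_le_sum[of n "{..<n0}" "\<lambda>m. b m * real m"]) auto
        finally show ?thesis by (simp add: K_def add_increasing)
      next
        case True
        define D where "D = d 1 n"
        have D: "n \<ge> 1" "D \<le> \<epsilon>0" "0 < D" "C * D \<le> 1/2" "b n \<le> 2 * D" using n0[OF True] by (auto simp: D_def)
        have k1: "\<bar>\<kappa> 1 n - D\<bar> \<le> C * D\<^sup>2" using \<kappa>[of 1 n] D by (simp add: D_def)
        have "C * D\<^sup>2 = (C * D) * D" by (simp add: power2_eq_square)
        also have "\<dots> \<le> 1/2 * D" using D by (intro mult_right_mono) auto
        finally have k2: "\<kappa> 1 n \<ge> D / 2" using k1 by linarith
        have G0: "0 \<le> G 1 n y" unfolding G_def using a01 D(1) by (intro suminf_nonneg summ) auto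
        have "\<bar>\<kappa> 1 n * G 1 n y - 1\<bar> \<le> 1/2" using Gy[rule_format, of 1 n] D by (simp add: D_def)
        hence "\<kappa> 1 n * G 1 n y \<le> 3/2" by linarith
        moreover have "D / 2 * G 1 n y \<le> \<kappa> 1 n * G 1 n y" using k2 G0 by (rule mult_right_mono)
        ultimately have DG: "D * G 1 n y \<le> 3" by simp
        have "b n * G 1 n y \<le> 2 * D * G 1 n y" using D(5) G0 by (rule mult_right_mono)
        with DG have bG: "b n * G 1 n y \<le> 6" by simp
        have "SY n y \<le> (\<Sum>j<n. exp 1 * (LY j y * exp (- (real 1 / real n * real j))))"
          unfolding S_def
        proof (rule sum_mono)
          fix j assume "j \<in> {..<n}"
          hence "1 / real n * real j \<le> 1" by simp
          hence "1 \<le> exp (1 - real 1 / real n * real j)" by simp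
          also have "\<dots> = exp 1 * exp (- (real 1 / real n * real j))" by (simp add: exp_add[symmetric])
          finally have "LY j y * 1 \<le> LY j y * (exp 1 * exp (- (real 1 / real n * real j)))"
            using a01 by (intro mult_left_mono) auto
          thus "LY j y \<le> exp 1 * (LY j y * exp (- (real 1 / real n * real j)))"
            by (simp add: mult_ac)
        qed
        also have "\<dots> = exp 1 * (\<Sum>j<n. LY j y * exp (- (real 1 / real n * real j)))"
          by (simp add: sum_distrib_left)
        also have "\<dots> \<le> exp 1 * G 1 n y"
          unfolding G_def using a01 D(1) by (intro mult_left_mono sum_le_suminf summ) auto
        finally have "b n * SY n y \<le> b n * (exp 1 * G 1 n y)" by (intro mult_left_mono b0)
        also have "\<dots> = exp 1 * (b n * G 1 n y)" by simp
        also have "\<dots> \<le> exp 1 * 6" using bG by (intro mult_left_mono) auto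
        also have "\<dots> \<le> K" using b0 by (auto simp: K_def intro!: sum_nonneg)
        finally show ?thesis .
      qed
    qed
  qed
  thus "\<exists>K. AE y in M. y \<in> Y \<longrightarrow> (\<forall>n. b n * SY n y \<le> K)" unfolding AE_N by blast
qed

end

lemma tail_regularly_varying:
  fixes t :: "nat \<Rightarrow> real"
  assumes sv: "slowly_varying l" and dec: "decseq t" and t0: "t 0 > 0"
    and t: "\<And>n. n \<ge> 1 \<Longrightarrow> t n = l (real n) * real n powr (-\<beta>)"
  shows "regularly_varying_tail t \<beta>"
proof
  have lpos: "x > 0 \<Longrightarrow> l x > 0" for x using sv by (simp add: slowly_varying_def)
  show "decseq t" by fact
  show "t n > 0" for n using t0 t[of n] lpos[of "real n"] by (cases "n = 0") auto
  fix c :: nat assume c: "c \<ge> 1"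
  have "((\<lambda>x. l (real c * x) / l x) \<longlongrightarrow> 1) at_top" using sv c by (auto simp: slowly_varying_def)
  from filterlim_compose[OF this filterlim_real_sequentially]
  have lim: "(\<lambda>N. l (real c * real N) / l (real N) * real c powr -\<beta>) \<longlonglongrightarrow> 1 * real c powr -\<beta>"
    by (intro tendsto_intros)
  have "\<forall>\<^sub>F N in sequentially. l (real c * real N) / l (real N) * real c powr -\<beta> = t (c * N) / t N"
    using eventually_ge_at_top[of 1]
  proof eventually_elim
    case (elim N)
    have "c * N \<ge> 1" using c elim by simp
    thus ?case using elim c lpos[of "real N"] by (simp add: t powr_mult)
  qed
  from Lim_transform_eventually[OF lim this] show "(\<lambda>N. t (c * N) / t N) \<longlonglongrightarrow> real c powr -\<beta>"
    by simp
qed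

theorem theorem7p2:
  fixes M :: "'a measure" and f :: "'a \<Rightarrow> 'a" and Y :: "'a set"
    and L R :: "('a \<Rightarrow> real) \<Rightarrow> 'a \<Rightarrow> real"
    and \<iota> :: "'b::banach \<Rightarrow> 'a \<Rightarrow> real"
    and \<beta> :: real and l :: "real \<Rightarrow> real" and v :: "'a \<Rightarrow> real"
  assumes "sigma_finite_measure M" and "emeasure M (space M) = \<infinity>"
    and "measure_preserving_map M f" and "conservative_map M f" and "ergodic_map M f"
    and "Y \<in> sets M" and "emeasure M Y = 1"
    and "AE x in M. \<exists>k. (f ^^ k) x \<in> Y"
    and "0 < \<beta>" and "\<beta> \<le> 1" and "slowly_varying l"
    and "\<And>n::nat. n \<ge> 1 \<Longrightarrow>
           measure M {y \<in> Y. return_time f Y y > n} = l (real n) * real n powr (-\<beta>)"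
    and "transfer_operator M f L"
    and "transfer_operator (restrict_space M Y) (first_return_map f Y) R"
    and "Linf_subspace (restrict_space M Y) \<iota>" and "contains_constants (restrict_space M Y) \<iota>"
    and "H1 (restrict_space M Y) (return_time f Y) R \<iota>"
    and "H2i (restrict_space M Y) R \<iota>"
    and "integrable M v"
  shows "AE x in M.
           (\<lambda>n. m_seq \<beta> l n * real n powr (-\<beta>) * (\<Sum>j=1..n. (L ^^ j) v x))
             \<longlonglongrightarrow> (1 / \<beta>) * d_const \<beta> * (\<integral>x. v x \<partial>M)"
proof -
  interpret renewal M f L Y R \<iota>
    by unfold_locales (use assms in auto)
  note \<beta> = assms(9,10)
  have t: "tail n = l (real n) * real n powr (-\<beta>)" if "n \<ge> 1" for n
    using assms(12)[OF that] by (simp add: tail_def)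
  have rv: "regularly_varying_tail tail \<beta>"
    by (rule tail_regularly_varying[OF assms(11) tail_decseq _ t]) (simp_all add: tail_0)
  interpret rv: regularly_varying_tail tail \<beta> by (rule rv)
  define b where "b = rv.norming"
  define c where "c = 1 / Gamma (\<beta> + 1)"
  define c' where "c' n = m_seq \<beta> l n * real n powr (-\<beta>)" for n
  note asym = return_sums_asymptotic[OF rv \<beta>, folded b_def c_def]
  have b0: "b n \<ge> 0" for n unfolding b_def by (rule rv.norming_nonneg) (rule \<beta>)
  obtain K where K: "AE y in M. y \<in> Y \<longrightarrow> (\<forall>n. b n * SY n y \<le> K)" using asym(3) by blast
  have convY: "AE x in M. (\<lambda>n. b n * SY n x) \<longlonglongrightarrow> c"
    by (rule convergence_extends[OF b0 asym(1) K asym(2)])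
  have Lv: "integrable M (L v)" by (rule integrable_L[OF assms(19)])
  have conv: "AE x in M. (\<lambda>n. b n * S n (L v) x) \<longlonglongrightarrow> c * (\<integral>x. L v x \<partial>M)"
  proof (rule pointwise_dual_ergodic[OF assms(1) assms(5) _ assms(6,7) b0 asym(1) convY _ _ AE_hit S_hit_le Lv])
    show "emeasure M (space M) \<noteq> 0" using assms(2) by simp
    show "hit k Y \<in> sets M" "emeasure M (hit k Y) < \<infinity>" for k
      using Y emeasure_hit_fin[OF Y order_refl, of k] by auto
  qed
  \<comment> \<open>Passing to \<open>L v\<close>, which has the same integral as \<open>v\<close>,
    avoids boundary terms.\<close>
  have SL: "S n (L v) x = (\<Sum>j=1..n. (L ^^ j) v x)" for n x
  proof -
    have "S n (L v) x = (\<Sum>j<n. (L ^^ Suc j) v x)" by (simp add: S_def funpow_swap1)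
    also have "\<dots> = (\<Sum>j=1..n. (L ^^ j) v x)"
      by (rule sum.reindex_bij_witness[of _ "\<lambda>j. j - 1" Suc]) auto
    finally show ?thesis .
  qed
  \<comment> \<open>The quotient of the two normings: \<open>1 / \<Gamma>(1 - \<beta>)\<close> for
    \<open>\<beta> < 1\<close>, and for \<open>\<beta> = 1\<close> the limit of
    \<open>1 - 1 / partial_sum n\<close>.\<close>
  have d0: "\<exists>a. (\<lambda>n. c' n / b n) \<longlonglongrightarrow> a \<and> a * c = (1 / \<beta>) * d_const \<beta>"
  proof (cases "\<beta> = 1")
    case True
    have U: "filterlim rv.partial_sum at_top sequentially"
    proof (rule ccontr)
      assume nl: "\<not> ?thesis"
      have "\<not> summable tail" by (rule kac[OF assms(2)])
      have "incseq rv.partial_sum" by (auto simp: incseq_def intro: rv.partial_sum_mono)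
      obtain B where B: "\<And>n. rv.partial_sum n \<le> B"
      proof -
        obtain Z where "\<not> (\<forall>\<^sub>F n in sequentially. Z \<le> rv.partial_sum n)" using nl unfolding filterlim_at_top by blast
        hence "\<forall>n. \<exists>m\<ge>n. rv.partial_sum m < Z" by (auto simp: eventually_sequentially not_le)
        hence "rv.partial_sum n \<le> Z" for n using rv.partial_sum_mono by (meson le_less_trans less_imp_le)
        thus ?thesis by (rule that)
      qed
      have "summable tail"
      proof (rule summableI_nonneg_bounded[of _ B])
        show "(\<Sum>i<n. tail i) \<le> B" for n
        proof -
          have "(\<Sum>i<n. tail i) \<le> rv.partial_sum n"
            unfolding rv.partial_sum_def by (intro sum_mono2 tail_nonneg) auto
          thus ?thesis using B[of n] by linarith
        qed
      qed (rule tail_nonneg)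
      thus False using \<open>\<not> summable tail\<close> by blast
    qed
    have "(\<lambda>n. 1 - inverse (rv.partial_sum n)) \<longlonglongrightarrow> 1 - 0"
      by (intro tendsto_diff tendsto_const tendsto_inverse_0_at_top U)
    moreover have "\<forall>\<^sub>F n in sequentially. 1 - inverse (rv.partial_sum n) = c' n / b n"
      using eventually_ge_at_top[of 1]
    proof eventually_elim
      case (elim n)
      have "m_seq \<beta> l n = (\<Sum>j=1..n. tail j)"
        using True by (auto simp: m_seq_def t powr_minus divide_inverse intro!: sum.cong)
      also have "\<dots> = rv.partial_sum n - 1"
      proof -
        have "{..n} = insert 0 {1..n}" by auto
        thus ?thesis by (simp add: rv.partial_sum_def tail_0)
      qed
      finally have "c' n = (rv.partial_sum n - 1) / real n" using True by (simp add: c'_def powr_minus divide_inverse)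
      moreover have "b n = rv.partial_sum n / real n" by (simp only: b_def rv.norming_1[OF True])
      ultimately have "c' n / b n = (rv.partial_sum n - 1) / rv.partial_sum n" using elim by simp
      thus ?case using rv.partial_sum_pos[of n] by (simp add: diff_divide_distrib inverse_eq_divide)
    qed
    ultimately have "(\<lambda>n. c' n / b n) \<longlonglongrightarrow> 1 - 0" by (rule Lim_transform_eventually)
    moreover have "Gamma (2::real) = 1" using Gamma_fact[of 1, where 'a = real] by simp
    ultimately show ?thesis using True by (intro exI[of _ 1]) (simp add: c_def d_const_def)
  next
    case False
    hence \<beta>1: "\<beta> < 1" using \<beta> by simp
    have "\<forall>\<^sub>F n in sequentially. 1 / Gamma (1 - \<beta>) = c' n / b n"
      using eventually_ge_at_top[of 1]
    proof eventually_elim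
      case (elim n)
      have "c' n = tail n" using False elim by (simp add: c'_def m_seq_def t)
      moreover have "tail n > 0" by (rule rv.pos)
      moreover have "b n = Gamma (1 - \<beta>) * tail n" by (simp only: b_def rv.norming_less_1[OF False])
      ultimately show ?case by simp
    qed
    hence "(\<lambda>n. c' n / b n) \<longlonglongrightarrow> 1 / Gamma (1 - \<beta>)" by (rule Lim_transform_eventually[OF tendsto_const])
    moreover have "1 / Gamma (1 - \<beta>) * c = (1 / \<beta>) * d_const \<beta>"
      using inverse_Gamma_product[OF \<beta>(1) \<beta>1] False by (simp add: c_def d_const_def mult.commute)
    ultimately show ?thesis by blast
  qed
  then obtain a where a: "(\<lambda>n. c' n / b n) \<longlonglongrightarrow> a" "a * c = (1 / \<beta>) * d_const \<beta>" by blast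
  show ?thesis
    using conv
  proof eventually_elim
    case (elim x)
    have "(\<lambda>n. (c' n / b n) * (b n * S n (L v) x)) \<longlonglongrightarrow> a * (c * (\<integral>x. L v x \<partial>M))"
      by (intro tendsto_mult a elim)
    moreover have "\<forall>\<^sub>F n in sequentially. (c' n / b n) * (b n * S n (L v) x) = c' n * (\<Sum>j=1..n. (L ^^ j) v x)"
      using eventually_ge_at_top[of 1]
    proof eventually_elim
      case (elim n)
      have "b n > 0" unfolding b_def by (rule rv.norming_pos[OF \<beta> elim])
      thus ?case by (simp add: SL)
    qed
    ultimately have "(\<lambda>n. c' n * (\<Sum>j=1..n. (L ^^ j) v x)) \<longlonglongrightarrow> a * (c * (\<integral>x. L v x \<partial>M))"
      by (rule Lim_transform_eventually)
    moreover have "a * (c * (\<integral>x. L v x \<partial>M)) = (1 / \<beta>) * d_const \<beta> * (\<integral>x. v x \<partial>M)"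
      using a(2) integral_L[OF assms(19)] by (simp add: mult.assoc[symmetric])
    ultimately show ?case by (simp add: c'_def)
  qed
qed

end
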